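(* Let $G=(G_{ij})$ be any symmetric $g\times g$ matrix consisting of $\mathbb C^\infty$ (or holomorphic) functions on $\mathbb H_g$ which satisfies the transformation formula \[ (CZ+D)^{-1}G(\gamma(Z))=G(Z)\cdot(CZ+D)^t+2C^t \] for all $\gamma=\left(\begin{array}{cc} A & B\\ C& D\end{array}\right)\in\mathrm{Sp}(2g,\mathbb Z)$. Then there exists a unique modular connection $\mathbb D$ such that \[ \mathbb D(dZ_{rs})=-\sum_{i,j=1}^gG_{ij}dZ_{si}dZ_{rj} \quad\text{and}\quad \mathbb D\left(f\det(dZ)^k\right)=\mathrm{Tr}\left(\left[\frac{\partial}{\partial Z}-kG\right]f\, dZ\right)(\det(dZ))^k \] for every $\mathbb C^\infty$-function $f$ on $\mathbb H_g$, and thus $G$ gives a derivative operator $M_{2k}(\Gamma_g)\rightarrow\widetilde{M}_{2kg+2}(\Gamma_g)$ by $f\mapsto\det\left(\left[\frac{\partial}{\partial Z}-kG\right]f\right)$. Furthermore, there exists at most one holomorphic symmetric matrix $G$ satisfying this transformation formula. If such a $G$ exists, the operator corresponding to $G$ is holomorphic.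
   Context: $\mathbb H_g=\{Z=X+\sqrt{-1}Y\in M(g,\mathbb C)\mid Z^t=Z,\ Y>0\}$ is the Siegel upper half plane of degree $g$, with coordinates $Z_{ij}$, $I=(i,j)\in\Omega=\{(i,j)\mid 1\le i\le j\le g\}$, $Z_I:=Z_{ij}$. $\Gamma_g=\mathrm{Sp}(2g,\mathbb Z)$ acts by $\gamma(Z)=(AZ+B)(CZ+D)^{-1}$, and $d(\gamma Z)=(ZC^t+D^t)^{-1}dZ(CZ+D)^{-1}=(d\tilde Z_{ij})$; the $\frac{g(g+1)}{2}\times\frac{g(g+1)}{2}$ matrix $S=S(\gamma,Z)$ is defined by $(d\tilde Z_{11},\dots,d\tilde Z_{gg})=(dZ_{11},\dots,dZ_{gg})\cdot S$ (indices in dictionary order). A modular connection coefficient is a family of $\mathbb C^\infty$ functions $\{\Gamma_{IJ}^K\}_{I,J,K\in\Omega}$ such that for all $\gamma\in\mathrm{Sp}(2g,\mathbb Z)$, $\gamma(\omega)=-S^{-1}dS+S^{-1}\omega S$, where $\omega=(\omega_I^J)$, $\omega_I^J=\sum_K\Gamma_{IK}^JdZ_K$. The associated modular connection is the linear operator $\mathbb D$ on the commutative $\mathbb C^\infty(\mathbb H_g)$-algebra generated by the $dZ_I$ (with $dZ_IdZ_J=dZ_JdZ_I$) determined by $\mathbb D(dZ_K)=-\sum_{I,J}\Gamma_{IJ}^KdZ_IdZ_J$ and the Leibniz rule $\mathbb D(f\,dZ_{K_1}\cdots dZ_{K_r})=df\cdot dZ_{K_1}\cdots dZ_{K_r}+\sum_i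 f\,dZ_{K_1}\cdots \mathbb D(dZ_{K_i})\cdots dZ_{K_r}$. Here $\frac{\partial}{\partial Z}=(\partial_{ij})_{g\times g}$ with $\partial_{ij}=\frac{1+\delta(i,j)}{2}\frac{\partial}{\partial Z_{ij}}$; $M_{2k}(\Gamma_g)$ denotes the (holomorphic, scalar-valued) Siegel modular forms of weight $2k$ and $\widetilde M_{k}(\Gamma_g)$ the $\mathbb C^\infty$-Siegel modular forms of weight $k$.
   Formalization: For g=1, "at most one holomorphic G" is claimed only for G also bounded on Im Z ≥ 1 (holomorphic at the cusp), since (πi/3)E_2 and (πi/3)E_2 + j' both satisfy the formula on the upper half plane; for g ≥ 2 uniqueness is as stated. *)

theory Defs
  imports "HOL-Analysis.Analysis" "HOL-Library.Poly_Mapping"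
begin

text \<open>Square matrices; unlike the syntax for \<open>vec\<close>, the synonym attaches no sort to the
  index type.\<close>

type_synonym ('a, 'n) sqmat = "(('a, 'n) vec, 'n) vec"

section \<open>Functions of class \<open>C\<^sup>\<infinity>\<close> on open sets\<close>

primrec Ck_on ::
    "nat \<Rightarrow> 'a::real_normed_vector set \<Rightarrow> ('a \<Rightarrow> 'b::real_normed_vector) \<Rightarrow> bool" where
  "Ck_on 0 S f \<longleftrightarrow> continuous_on S f"
| "Ck_on (Suc k) S f \<longleftrightarrow>
     (\<forall>x\<in>S. f differentiable (at x)) \<and>
     (\<forall>v. Ck_on k S (\<lambda>x. frechet_derivative f (at x) v))"

definition smooth_on ::
    "'a::real_normed_vector set \<Rightarrow> ('a \<Rightarrow> 'b::real_normed_vector) \<Rightarrow> bool" where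
  "smooth_on S f \<longleftrightarrow> (\<forall>k. Ck_on k S f)"

lemma Ck_on_Suc_imp: "Ck_on (Suc k) S f \<Longrightarrow> Ck_on k S f"
proof (induction k arbitrary: f)
  case 0
  then have "\<And>x. x \<in> S \<Longrightarrow> f differentiable (at x)" by simp
  then have "\<And>x. x \<in> S \<Longrightarrow> continuous (at x) f"
    by (rule differentiable_imp_continuous_within)
  then show ?case by (simp add: continuous_at_imp_continuous_on)
next
  case (Suc k)
  have d: "\<forall>x\<in>S. f differentiable (at x)"
    and D: "Ck_on (Suc k) S (\<lambda>x. frechet_derivative f (at x) v)" for v
    using Suc.prems unfolding Ck_on.simps(2)[of "Suc k"] by blast+
  show ?case
    using d Suc.IH[OF D] unfolding Ck_on.simps(2)[of k S f] by blast
qed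

lemma Ck_on_cong:
  assumes "open S" "\<And>x. x \<in> S \<Longrightarrow> f x = g x" "Ck_on k S f"
  shows "Ck_on k S g"
  using assms(2,3)
proof (induction k arbitrary: f g)
  case 0
  then show ?case by (metis Ck_on.simps(1) continuous_on_cong)
next
  case (Suc k)
  have der: "(g has_derivative frechet_derivative f (at x)) (at x)" if "x \<in> S" for x
  proof -
    have "(f has_derivative frechet_derivative f (at x)) (at x)"
      using Suc.prems(2) that by (intro frechet_derivative_works[THEN iffD1]) simp
    then show ?thesis
      by (rule has_derivative_transform_within_open[OF _ assms(1) that]) (use Suc.prems in auto)
  qed
  then have eq: "frechet_derivative g (at x) = frechet_derivative f (at x)" if "x \<in> S" for x
    using that frechet_derivative_at by metis
  show ?case
    unfolding Ck_on.simps
  proof (intro conjI ballI allI)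
    show "g differentiable (at x)" if "x \<in> S" for x
      using der[OF that] by (auto simp: differentiable_def)
    show "Ck_on k S (\<lambda>x. frechet_derivative g (at x) v)" for v
      by (rule Suc.IH[of "\<lambda>x. frechet_derivative f (at x) v"]) (use Suc.prems eq in auto)
  qed
qed

lemma Ck_on_const: "Ck_on k S (\<lambda>x. c)"
  by (induction k arbitrary: c) (auto simp: frechet_derivative_const)

lemma Ck_on_add:
  assumes "open S" "Ck_on k S f" "Ck_on k S g"
  shows "Ck_on k S (\<lambda>x. f x + g x)"
  using assms(2,3)
proof (induction k arbitrary: f g)
  case 0
  then show ?case by (auto intro: continuous_intros)
next
  case (Suc k)
  have d: "((\<lambda>x. f x + g x) has_derivative
      (\<lambda>v. frechet_derivative f (at x) v + frechet_derivative g (at x) v)) (at x)"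
    if "x \<in> S" for x
  proof (rule has_derivative_add)
    show "(f has_derivative frechet_derivative f (at x)) (at x)"
      using Suc.prems(1) that by (intro frechet_derivative_works[THEN iffD1]) simp
    show "(g has_derivative frechet_derivative g (at x)) (at x)"
      using Suc.prems(2) that by (intro frechet_derivative_works[THEN iffD1]) simp
  qed
  have "Ck_on k S (\<lambda>x. frechet_derivative (\<lambda>x. f x + g x) (at x) v)" for v
  proof (rule Ck_on_cong[OF assms(1)])
    show "Ck_on k S (\<lambda>x. frechet_derivative f (at x) v + frechet_derivative g (at x) v)"
      using Suc.prems by (intro Suc.IH) auto
  qed (simp add: frechet_derivative_at[OF d, symmetric])
  moreover have "\<forall>x\<in>S. (\<lambda>x. f x + g x) differentiable (at x)"
    using d by (auto simp: differentiable_def)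
  ultimately show ?case by simp
qed

lemma Ck_on_mult:
  fixes f g :: "'a::real_normed_vector \<Rightarrow> 'b::real_normed_algebra"
  assumes "open S" "Ck_on k S f" "Ck_on k S g"
  shows "Ck_on k S (\<lambda>x. f x * g x)"
  using assms(2,3)
proof (induction k arbitrary: f g)
  case 0
  then show ?case by (auto intro: continuous_intros)
next
  case (Suc k)
  have d: "((\<lambda>x. f x * g x) has_derivative
      (\<lambda>v. f x * frechet_derivative g (at x) v + frechet_derivative f (at x) v * g x)) (at x)"
    if "x \<in> S" for x
  proof (rule has_derivative_mult)
    show "(f has_derivative frechet_derivative f (at x)) (at x)"
      using Suc.prems(1) that by (intro frechet_derivative_works[THEN iffD1]) simp
    show "(g has_derivative frechet_derivative g (at x)) (at x)"
      using Suc.prems(2) that by (intro frechet_derivative_works[THEN iffD1]) simp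
  qed
  have "Ck_on k S (\<lambda>x. frechet_derivative (\<lambda>x. f x * g x) (at x) v)" for v
  proof (rule Ck_on_cong[OF assms(1)])
    show "Ck_on k S (\<lambda>x. f x * frechet_derivative g (at x) v
        + frechet_derivative f (at x) v * g x)"
    proof (rule Ck_on_add[OF assms(1)])
      show "Ck_on k S (\<lambda>x. f x * frechet_derivative g (at x) v)"
        by (rule Suc.IH[OF Suc.prems(1)[THEN Ck_on_Suc_imp]]) (use Suc.prems(2) in simp)
      show "Ck_on k S (\<lambda>x. frechet_derivative f (at x) v * g x)"
        by (rule Suc.IH[OF _ Suc.prems(2)[THEN Ck_on_Suc_imp]]) (use Suc.prems(1) in simp)
    qed
  qed (simp add: frechet_derivative_at[OF d, symmetric])
  moreover have "\<forall>x\<in>S. (\<lambda>x. f x * g x) differentiable (at x)"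
    using d by (auto simp: differentiable_def)
  ultimately show ?case by simp
qed

section \<open>The Siegel upper half space\<close>

definition siegel :: "(complex, 'n::finite) sqmat set" where
  "siegel = {Z. transpose Z = Z \<and>
      (\<forall>v::real^'n. v \<noteq> 0 \<longrightarrow> 0 < v \<bullet> ((\<chi> i j. Im (Z $ i $ j)) *v v))}"

text \<open>The index set \<open>\<Omega>\<close> of the coordinates \<open>Z\<^sub>I\<close>, as a finite type; the dictionary order of
  its elements plays no role for matrices indexed by this type.\<close>

typedef (overloaded) ('n::"{finite,linorder}") idx = "{(i, j). i \<le> (j::'n)}"
  by auto

instance idx :: ("{finite,linorder}") finite
proof
  have "inj (Rep_idx :: 'a idx \<Rightarrow> _)" by (simp add: inj_def Rep_idx_inject)
  then show "finite (UNIV :: 'a idx set)"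
    by (rule finite_imageD[rotated]) (rule finite_subset[OF subset_UNIV], simp)
qed

text \<open>The index \<open>(i, j)\<close> or \<open>(j, i)\<close>, so that \<open>Z\<^sub>I = Z\<^sub>i\<^sub>j = Z\<^sub>j\<^sub>i\<close>.\<close>

definition idx :: "'n \<Rightarrow> 'n \<Rightarrow> ('n::{finite,linorder}) idx" where
  "idx i j = Abs_idx (min i j, max i j)"

definition symm :: "complex^('n::{finite,linorder}) idx \<Rightarrow> (complex, 'n) sqmat" where
  "symm z = (\<chi> i j. z $ idx i j)"

definition coords :: "(complex, 'n) sqmat \<Rightarrow> complex^('n::{finite,linorder}) idx" where
  "coords Z = (\<chi> I. Z $ fst (Rep_idx I) $ snd (Rep_idx I))"

lemma idx_sym: "idx i j = idx j i"
  by (simp add: idx_def min.commute max.commute)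

lemma idx_Rep: "idx (fst (Rep_idx I)) (snd (Rep_idx I)) = I"
  using Rep_idx[of I] by (auto simp: idx_def Rep_idx_inverse min_def max_def split: prod.splits)

lemma coords_symm [simp]: "coords (symm z) = z"
  by (simp add: coords_def symm_def vec_eq_iff idx_Rep)

lemma symm_coords:
  assumes "transpose Z = Z"
  shows "symm (coords Z) = Z"
proof -
  have s: "Z $ i $ j = Z $ j $ i" for i j
    using assms by (metis transpose_def vec_lambda_beta)
  show ?thesis
    using s by (auto simp: symm_def coords_def vec_eq_iff idx_def Abs_idx_inverse min_def max_def)
qed

definition siegel_chart :: "(complex^('n::{finite,linorder}) idx) set" where
  "siegel_chart = {z. symm z \<in> siegel}"

lemma open_siegel_chart: "open (siegel_chart :: (complex^('n::{finite,linorder}) idx) set)"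
proof -
  define q :: "(real, 'n) vec \<times> (complex^'n idx) \<Rightarrow> real"
    where "q = (\<lambda>(v, z). v \<bullet> ((\<chi> i j. Im (symm z $ i $ j)) *v v))"
  have q: "q = (\<lambda>p. \<Sum>i\<in>UNIV. fst p $ i * (\<Sum>j\<in>UNIV. Im (snd p $ idx i j) * fst p $ j))"
    by (simp add: q_def fun_eq_iff inner_vec_def matrix_vector_mult_def symm_def)
  have cont: "continuous_on UNIV q"
    unfolding q by (intro continuous_intros)
  have "closed {p. q p \<le> 0}"
    by (rule closed_Collect_le[OF cont]) (rule continuous_on_const)
  then have "closed {z. \<exists>v. v \<in> sphere 0 1 \<and> (v, z) \<in> {p. q p \<le> 0}}"
    by (rule closed_compact_projection[rotated]) (rule compact_sphere)
  moreover have "- siegel_chart = {z. \<exists>v. v \<in> sphere 0 1 \<and> (v, z) \<in> {p. q p \<le> 0}}"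
  proof (intro set_eqI iffI)
    fix z :: "complex^'n idx"
    assume z: "z \<in> - siegel_chart"
    have "transpose (symm z) = symm z"
      by (simp add: transpose_def symm_def vec_eq_iff idx_sym)
    with z obtain v where v: "v \<noteq> 0" "q (v, z) \<le> 0"
      unfolding siegel_chart_def siegel_def q_def by (auto simp: not_less)
    have "q ((1 / norm v) *\<^sub>R v, z) = (1 / norm v)\<^sup>2 * q (v, z)"
      by (simp add: q_def power2_eq_square matrix_vector_mult_scaleR)
    then have "q ((1 / norm v) *\<^sub>R v, z) \<le> 0"
      using v mult_nonneg_nonpos[OF zero_le_power2] by metis
    moreover have "(1 / norm v) *\<^sub>R v \<in> sphere 0 1"
      using v by simp
    ultimately show "z \<in> {z. \<exists>v. v \<in> sphere 0 1 \<and> (v, z) \<in> {p. q p \<le> 0}}"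
      by blast
  next
    fix z :: "complex^'n idx"
    assume "z \<in> {z. \<exists>v. v \<in> sphere 0 1 \<and> (v, z) \<in> {p. q p \<le> 0}}"
    then obtain v where v: "v \<in> sphere 0 1" "q (v, z) \<le> 0" by blast
    then have "v \<noteq> 0" "\<not> 0 < q (v, z)" by auto
    then show "z \<in> - siegel_chart"
      unfolding siegel_chart_def siegel_def q_def by auto
  qed
  ultimately show ?thesis by (simp add: open_closed)
qed

lemma siegel_nonempty: "(mat \<i> :: (complex, 'n::finite) sqmat) \<in> siegel"
proof -
  have 1: "transpose (mat \<i> :: (complex, 'n) sqmat) = mat \<i>"
    by (auto simp: transpose_def mat_def vec_eq_iff)
  have "(\<chi> i j. Im ((mat \<i> :: (complex, 'n) sqmat) $ i $ j)) = (mat 1 :: (real, 'n) sqmat)"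
    by (simp add: mat_def vec_eq_iff)
  then show ?thesis
    using 1 by (simp add: siegel_def)
qed

section \<open>The ring \<open>C\<^sup>\<infinity>(\<H>\<^sub>g)\<close>\<close>

text \<open>A function on the half space is represented by its extension by \<open>0\<close> to all matrices.
  Smoothness refers to the coordinates \<open>Z\<^sub>I\<close>, in which the half space is open.\<close>

definition siegel_smooth :: "((complex, 'n::{finite,linorder}) sqmat \<Rightarrow> complex) \<Rightarrow> bool" where
  "siegel_smooth f \<longleftrightarrow> smooth_on siegel_chart (f \<circ> symm)"

typedef (overloaded) ('n::"{finite,linorder}") cinf =
  "{f :: (complex, 'n) sqmat \<Rightarrow> complex. siegel_smooth f \<and> (\<forall>Z. Z \<notin> siegel \<longrightarrow> f Z = 0)}"
  morphisms fn Abs_cinf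
  by (rule exI[of _ "\<lambda>_. 0"]) (simp add: siegel_smooth_def smooth_on_def o_def Ck_on_const)

setup_lifting type_definition_cinf

lemma siegel_smooth_mult:
  "siegel_smooth f \<Longrightarrow> siegel_smooth g \<Longrightarrow> siegel_smooth (\<lambda>Z. f Z * g Z)"
  by (simp add: siegel_smooth_def smooth_on_def o_def Ck_on_mult open_siegel_chart)

lemma siegel_smooth_add:
  "siegel_smooth f \<Longrightarrow> siegel_smooth g \<Longrightarrow> siegel_smooth (\<lambda>Z. f Z + g Z)"
  by (simp add: siegel_smooth_def smooth_on_def o_def Ck_on_add open_siegel_chart)

lemma siegel_smooth_restrict_const: "siegel_smooth (\<lambda>Z. if Z \<in> siegel then c else 0)"
  unfolding siegel_smooth_def smooth_on_def
  by (rule allI, rule Ck_on_cong[OF open_siegel_chart _ Ck_on_const[of _ _ c]])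
    (simp add: siegel_chart_def)

lemma siegel_smooth_cmult: "siegel_smooth f \<Longrightarrow> siegel_smooth (\<lambda>Z. c * f Z)"
  by (simp add: siegel_smooth_def smooth_on_def o_def Ck_on_mult Ck_on_const open_siegel_chart)

lemma siegel_smooth_uminus: "siegel_smooth f \<Longrightarrow> siegel_smooth (\<lambda>Z. - f Z)"
  using siegel_smooth_cmult[where c = "-1" and f = f] by simp

lemma siegel_smooth_diff:
  "siegel_smooth f \<Longrightarrow> siegel_smooth g \<Longrightarrow> siegel_smooth (\<lambda>Z. f Z - g Z)"
  using siegel_smooth_add[of f "\<lambda>Z. - g Z"] siegel_smooth_uminus[of g] by simp

lift_definition cconst :: "complex \<Rightarrow> ('n::{finite,linorder}) cinf"
  is "\<lambda>c Z. if Z \<in> siegel then c else 0"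
  by (simp add: siegel_smooth_restrict_const)

instantiation cinf :: ("{finite,linorder}") comm_ring_1
begin

lift_definition zero_cinf :: "'a cinf" is "\<lambda>_. 0"
  by (simp add: siegel_smooth_def smooth_on_def o_def Ck_on_const)

lift_definition one_cinf :: "'a cinf" is "\<lambda>Z. if Z \<in> siegel then 1 else 0"
  by (simp add: siegel_smooth_restrict_const)

lift_definition plus_cinf :: "'a cinf \<Rightarrow> 'a cinf \<Rightarrow> 'a cinf" is "\<lambda>f g Z. f Z + g Z"
  by (simp add: siegel_smooth_add)

lift_definition uminus_cinf :: "'a cinf \<Rightarrow> 'a cinf" is "\<lambda>f Z. - f Z"
  by (simp add: siegel_smooth_uminus)

lift_definition minus_cinf :: "'a cinf \<Rightarrow> 'a cinf \<Rightarrow> 'a cinf" is "\<lambda>f g Z. f Z - g Z"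
  by (simp add: siegel_smooth_diff)

lift_definition times_cinf :: "'a cinf \<Rightarrow> 'a cinf \<Rightarrow> 'a cinf" is "\<lambda>f g Z. f Z * g Z"
  by (simp add: siegel_smooth_mult)

instance
proof
  show "(0::'a cinf) \<noteq> 1"
    by transfer (use siegel_nonempty in \<open>auto simp: fun_eq_iff\<close>)
qed (transfer; auto simp: fun_eq_iff algebra_simps)+

end

text \<open>The (Wirtinger) derivative \<open>\<partial>/\<partial>Z\<^sub>I = 1/2 (\<partial>/\<partial>X\<^sub>I - \<i> \<partial>/\<partial>Y\<^sub>I)\<close>, for functions of the
  coordinates and for elements of \<open>C\<^sup>\<infinity>(\<H>\<^sub>g)\<close>.\<close>

definition wirtinger ::
    "'m::finite \<Rightarrow> (complex^'m \<Rightarrow> complex) \<Rightarrow> complex^'m \<Rightarrow> complex" where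
  "wirtinger I F z =
     (frechet_derivative F (at z) (axis I 1) - \<i> * frechet_derivative F (at z) (axis I \<i>)) / 2"

lift_definition pd :: "('n::{finite,linorder}) idx \<Rightarrow> 'n cinf \<Rightarrow> 'n cinf"
  is "\<lambda>I f Z. if Z \<in> siegel then wirtinger I (f \<circ> symm) (coords Z) else 0"
proof -
  fix I :: "'n idx" and f :: "(complex, 'n) sqmat \<Rightarrow> complex"
  assume "siegel_smooth f \<and> (\<forall>Z. Z \<notin> siegel \<longrightarrow> f Z = 0)"
  then have D: "Ck_on k siegel_chart (\<lambda>z. frechet_derivative (f \<circ> symm) (at z) v)" for k v
    unfolding siegel_smooth_def smooth_on_def by (metis Ck_on.simps(2))
  have "Ck_on k siegel_chart (\<lambda>z. (1/2) * frechet_derivative (f \<circ> symm) (at z) (axis I 1)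
      + (-\<i>/2) * frechet_derivative (f \<circ> symm) (at z) (axis I \<i>))" for k
    by (rule Ck_on_add[OF open_siegel_chart
          Ck_on_mult[OF open_siegel_chart Ck_on_const D] Ck_on_mult[OF open_siegel_chart Ck_on_const D]])
  then have "Ck_on k siegel_chart
      ((\<lambda>Z. if Z \<in> siegel then wirtinger I (f \<circ> symm) (coords Z) else 0) \<circ> symm)" for k
    by (rule Ck_on_cong[OF open_siegel_chart, rotated])
      (simp add: siegel_chart_def wirtinger_def field_simps)
  then show "siegel_smooth (\<lambda>Z. if Z \<in> siegel then wirtinger I (f \<circ> symm) (coords Z) else 0) \<and>
      (\<forall>Z. Z \<notin> siegel \<longrightarrow>
        (if Z \<in> siegel then wirtinger I (f \<circ> symm) (coords Z) else 0) = 0)"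
    by (simp add: siegel_smooth_def smooth_on_def)
qed

section \<open>The action of the Siegel modular group\<close>

text \<open>Elements of \<open>Sp(2g, \<int>)\<close> are indexed by two copies of the index set: \<open>Inl\<close> for the first,
  \<open>Inr\<close> for the second block.\<close>

definition sympl_J :: "(int, 'n::finite + 'n) sqmat" where
  "sympl_J = (\<chi> a b. case (a, b) of
      (Inl i, Inr j) \<Rightarrow> (if i = j then 1 else 0)
    | (Inr i, Inl j) \<Rightarrow> (if i = j then - 1 else 0)
    | _ \<Rightarrow> 0)"

definition Sp :: "((int, 'n::finite + 'n) sqmat) set" where
  "Sp = {\<gamma>. transpose \<gamma> ** sympl_J ** \<gamma> = sympl_J}"

definition blkA :: "(int, 'n::finite + 'n) sqmat \<Rightarrow> (complex, 'n) sqmat" where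
  "blkA \<gamma> = (\<chi> i j. of_int (\<gamma> $ Inl i $ Inl j))"

definition blkB :: "(int, 'n::finite + 'n) sqmat \<Rightarrow> (complex, 'n) sqmat" where
  "blkB \<gamma> = (\<chi> i j. of_int (\<gamma> $ Inl i $ Inr j))"

definition blkC :: "(int, 'n::finite + 'n) sqmat \<Rightarrow> (complex, 'n) sqmat" where
  "blkC \<gamma> = (\<chi> i j. of_int (\<gamma> $ Inr i $ Inl j))"

definition blkD :: "(int, 'n::finite + 'n) sqmat \<Rightarrow> (complex, 'n) sqmat" where
  "blkD \<gamma> = (\<chi> i j. of_int (\<gamma> $ Inr i $ Inr j))"

definition cocycle :: "(int, 'n::finite + 'n) sqmat \<Rightarrow> (complex, 'n) sqmat \<Rightarrow> (complex, 'n) sqmat" where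
  "cocycle \<gamma> Z = blkC \<gamma> ** Z + blkD \<gamma>"

definition act :: "(int, 'n::finite + 'n) sqmat \<Rightarrow> (complex, 'n) sqmat \<Rightarrow> (complex, 'n) sqmat" where
  "act \<gamma> Z = (blkA \<gamma> ** Z + blkB \<gamma>) ** matrix_inv (cocycle \<gamma> Z)"

text \<open>The \<open>(I, J)\<close> entry of \<open>S\<close> is the coefficient of \<open>dZ\<^sub>I\<close> in the \<open>J\<close>-th entry of
  \<open>d(\<gamma>Z) = (Z C\<^sup>t + D\<^sup>t)\<^sup>-\<^sup>1 dZ (C Z + D)\<^sup>-\<^sup>1\<close>; it is obtained by putting for \<open>dZ\<close> the symmetric
  matrix with \<open>dZ\<^sub>I = 1\<close> and all other coordinates \<open>0\<close>.\<close>

definition Smat ::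
    "(int, 'n::{finite,linorder} + 'n) sqmat \<Rightarrow> (complex, 'n) sqmat \<Rightarrow> (complex, 'n idx) sqmat" where
  "Smat \<gamma> Z = (\<chi> I. coords
     (matrix_inv (Z ** transpose (blkC \<gamma>) + transpose (blkD \<gamma>)) ** symm (axis I 1)
        ** matrix_inv (cocycle \<gamma> Z)))"

section \<open>The algebra generated by the \<open>dZ\<^sub>I\<close>\<close>

text \<open>Polynomials over \<open>C\<^sup>\<infinity>(\<H>\<^sub>g)\<close> in the commuting variables \<open>dZ\<^sub>I\<close>.\<close>

type_synonym 'n form = "('n idx \<Rightarrow>\<^sub>0 nat) \<Rightarrow>\<^sub>0 'n cinf"

definition cf :: "'n cinf \<Rightarrow> ('n::{finite,linorder}) form" where
  "cf f = Poly_Mapping.single 0 f"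

definition dZ :: "'n idx \<Rightarrow> ('n::{finite,linorder}) form" where
  "dZ I = Poly_Mapping.single (Poly_Mapping.single I 1) 1"

definition dZmat :: "('n::{finite,linorder} form, 'n) sqmat" where
  "dZmat = (\<chi> i j. dZ (idx i j))"

definition dfun :: "'n cinf \<Rightarrow> ('n::{finite,linorder}) form" where
  "dfun f = (\<Sum>I\<in>UNIV. cf (pd I f) * dZ I)"

section \<open>Modular connections\<close>

text \<open>The coefficient of \<open>dZ\<^sub>M\<close> in the matrix of one-forms \<open>\<omega>\<close> at \<open>Z\<close>; here \<open>\<Gamma> I J K\<close> stands for
  \<open>\<Gamma>\<^sub>I\<^sub>J\<^sup>K\<close>, and the lower index of \<open>\<omega>\<close> is the row.\<close>

definition omega_at ::
    "('n idx \<Rightarrow> 'n idx \<Rightarrow> 'n idx \<Rightarrow> 'n cinf) \<Rightarrow> 'n idx \<Rightarrow> (complex, 'n) sqmat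
      \<Rightarrow> (complex, ('n::{finite,linorder}) idx) sqmat" where
  "omega_at \<Gamma> M Z = (\<chi> I J. fn (\<Gamma> I M J) Z)"

text \<open>The coefficient of \<open>dZ\<^sub>M\<close> in \<open>\<gamma>(\<omega>)\<close>, obtained from \<open>\<omega>\<close> by substituting \<open>\<gamma>Z\<close> for \<open>Z\<close> and
  \<open>d(\<gamma>Z)\<^sub>K = \<Sum>\<^sub>M S\<^sub>M\<^sub>K dZ\<^sub>M\<close> for \<open>dZ\<^sub>K\<close>.\<close>

definition omega_act ::
    "(int, 'n + 'n) sqmat \<Rightarrow> ('n idx \<Rightarrow> 'n idx \<Rightarrow> 'n idx \<Rightarrow> 'n cinf) \<Rightarrow> 'n idx
      \<Rightarrow> (complex, 'n) sqmat \<Rightarrow> (complex, ('n::{finite,linorder}) idx) sqmat" where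
  "omega_act \<gamma> \<Gamma> M Z = (\<chi> I J. \<Sum>K\<in>UNIV. Smat \<gamma> Z $ M $ K * fn (\<Gamma> I K J) (act \<gamma> Z))"

text \<open>The coefficient of \<open>dZ\<^sub>M\<close> in \<open>dS\<close>.  As \<open>S\<close> is holomorphic in \<open>Z\<close>, there is no
  antiholomorphic part.\<close>

definition dS ::
    "(int, 'n + 'n) sqmat \<Rightarrow> 'n idx \<Rightarrow> (complex, 'n) sqmat
      \<Rightarrow> (complex, ('n::{finite,linorder}) idx) sqmat" where
  "dS \<gamma> M Z = (\<chi> I J. wirtinger M (\<lambda>z. Smat \<gamma> (symm z) $ I $ J) (coords Z))"

definition modular_connection_coeff ::
    "('n idx \<Rightarrow> 'n idx \<Rightarrow> 'n idx \<Rightarrow> ('n::{finite,linorder}) cinf) \<Rightarrow> bool" where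
  "modular_connection_coeff \<Gamma> \<longleftrightarrow>
     (\<forall>\<gamma>\<in>Sp. \<forall>Z\<in>siegel. \<forall>M.
        omega_act \<gamma> \<Gamma> M Z =
          - (matrix_inv (Smat \<gamma> Z) ** dS \<gamma> M Z)
          + matrix_inv (Smat \<gamma> Z) ** omega_at \<Gamma> M Z ** Smat \<gamma> Z)"

definition associated_connection ::
    "('n idx \<Rightarrow> 'n idx \<Rightarrow> 'n idx \<Rightarrow> 'n cinf) \<Rightarrow> ('n form \<Rightarrow> ('n::{finite,linorder}) form) \<Rightarrow> bool"
  where
  "associated_connection \<Gamma> \<D> \<longleftrightarrow>
     (\<forall>p q. \<D> (p + q) = \<D> p + \<D> q) \<and>
     (\<forall>c p. \<D> (cf (cconst c) * p) = cf (cconst c) * \<D> p) \<and>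
     (\<forall>K. \<D> (dZ K) = - (\<Sum>I\<in>UNIV. \<Sum>J\<in>UNIV. cf (\<Gamma> I J K) * dZ I * dZ J)) \<and>
     (\<forall>f Ks. \<D> (cf f * prod_list (map dZ Ks)) =
        dfun f * prod_list (map dZ Ks) +
        (\<Sum>i<length Ks. cf f * prod_list (map dZ (take i Ks)) * \<D> (dZ (Ks ! i))
           * prod_list (map dZ (drop (Suc i) Ks))))"

definition modular_connection :: "('n form \<Rightarrow> ('n::{finite,linorder}) form) \<Rightarrow> bool" where
  "modular_connection \<D> \<longleftrightarrow> (\<exists>\<Gamma>. modular_connection_coeff \<Gamma> \<and> associated_connection \<Gamma> \<D>)"

section \<open>Siegel modular forms\<close>

text \<open>Holomorphic functions are complex Frechet differentiable in the coordinates \<open>Z\<^sub>I\<close>; being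
  automatically of class \<open>C\<^sup>\<infinity>\<close>, they are regarded as elements of \<open>C\<^sup>\<infinity>(\<H>\<^sub>g)\<close>.\<close>

definition siegel_holomorphic :: "('n::{finite,linorder}) cinf \<Rightarrow> bool" where
  "siegel_holomorphic f \<longleftrightarrow>
     (\<forall>z\<in>siegel_chart. \<exists>F'. ((fn f \<circ> symm) has_derivative F') (at z) \<and>
        (\<forall>c v. F' (c *s v) = c * F' v))"

text \<open>In degree one, holomorphy at the cusp has to be required in addition, as usual; in higher
  degree it is automatic for modular forms by the Koecher principle.  The same convention is
  needed for the entries of \<open>G\<close>: in degree one, adding the derivative of the \<open>j\<close>-invariant to a
  holomorphic solution of the transformation formula gives another one.\<close>

definition cusp_condition :: "('n::{finite,linorder}) cinf \<Rightarrow> bool" where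
  "cusp_condition f \<longleftrightarrow>
     (CARD('n) = 1 \<longrightarrow>
        (\<exists>B. \<forall>Z\<in>siegel. (\<forall>i. 1 \<le> Im (Z $ i $ i)) \<longrightarrow> cmod (fn f Z) \<le> B))"

definition smooth_modular_forms :: "nat \<Rightarrow> ('n::{finite,linorder}) cinf set" where
  "smooth_modular_forms k =
     {f. \<forall>\<gamma>\<in>Sp. \<forall>Z\<in>siegel. fn f (act \<gamma> Z) = det (cocycle \<gamma> Z) ^ k * fn f Z}"

definition modular_forms :: "nat \<Rightarrow> ('n::{finite,linorder}) cinf set" where
  "modular_forms k =
     {f \<in> smooth_modular_forms k. siegel_holomorphic f \<and> cusp_condition f}"

definition mat_at :: "('n::{finite,linorder} cinf, 'n) sqmat \<Rightarrow> (complex, 'n) sqmat \<Rightarrow> (complex, 'n) sqmat" where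
  "mat_at G Z = (\<chi> i j. fn (G $ i $ j) Z)"

definition G_transforms :: "('n::{finite,linorder} cinf, 'n) sqmat \<Rightarrow> bool" where
  "G_transforms G \<longleftrightarrow>
     (\<forall>\<gamma>\<in>Sp. \<forall>Z\<in>siegel.
        matrix_inv (cocycle \<gamma> Z) ** mat_at G (act \<gamma> Z) =
          mat_at G Z ** transpose (cocycle \<gamma> Z) + 2 *\<^sub>R transpose (blkC \<gamma>))"

definition ddZ :: "'n cinf \<Rightarrow> ('n::{finite,linorder} cinf, 'n) sqmat" where
  "ddZ f = (\<chi> i j. cconst ((1 + (if i = j then 1 else 0)) / 2) * pd (idx i j) f)"

text \<open>The matrix \<open>[\<partial>/\<partial>Z - k G] f\<close>.\<close>

definition nabla ::
    "nat \<Rightarrow> ('n cinf, 'n) sqmat \<Rightarrow> 'n cinf \<Rightarrow> ('n::{finite,linorder} cinf, 'n) sqmat" where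
  "nabla k G f = (\<chi> i j. ddZ f $ i $ j - of_nat k * G $ i $ j * f)"

end

theory Submission
  imports
    "HOL-Complex_Analysis.Complex_Singularities"
    "HOL-Real_Asymp.Real_Asymp"
    Defs
begin

text \<open>The coefficients of the connection are those of the bilinear form \<open>(X G Y + Y G X) / 2\<close> on
  symmetric matrices; their transformation law is the derivative of \<open>d(\<gamma>Z) = J\<^sup>-\<^sup>t dZ J\<^sup>-\<^sup>1\<close> with
  \<open>J = C Z + D\<close>, and \<open>\<D>(det dZ) = - Tr(G dZ) det dZ\<close> because a derivation acts on a determinant
  row by row.  Comparing \<open>f(\<gamma>Z) = det(J)\<^sup>2\<^sup>k f(Z)\<close> with its derivative shows that
  \<open>N = [\<partial>/\<partial>Z - k G] f\<close> satisfies \<open>N(\<gamma>Z) = det(J)\<^sup>2\<^sup>k J N(Z) J\<^sup>t\<close>.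

  The difference \<open>H\<close> of two holomorphic solutions satisfies \<open>H(\<gamma>Z) = J H(Z) J\<^sup>t\<close>.  In degree one
  it has weight \<open>2\<close>, and a primitive of it is a modular function of moderate growth, hence constant.  In higher degree a
  diagonal entry \<open>\<phi> = H\<^sub>j\<^sub>j\<close> is, for \<open>a \<noteq> j\<close>, invariant under the Jacobi group attached to the
  coordinate \<open>a\<close>, so its restrictions to the torsion leaves
  \<open>\<tau> \<mapsto> \<tau> u u\<^sup>t + e m\<^sup>t + m e\<^sup>t + W\<close>, \<open>u = e + l\<close>, with \<open>l\<close>, \<open>m\<close> rational, form a finite family
  permuted by \<open>SL(2, \<int>)\<close>.  By Koecher's principle they have moderate growth, so they are constant;
  by density \<open>\<phi>\<close> is constant on all leaves.  Hence \<open>d\<phi>\<close> vanishes on \<open>y y\<^sup>t\<close> with \<open>y = Im(Z) e\<close>,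
  and as \<open>d\<phi>\<close> is holomorphic while \<open>y\<close> is not, \<open>d\<phi> = 0\<close>.  So the diagonal of \<open>H\<close> is constant,
  and the action of unimodular matrices forces \<open>H = 0\<close>.\<close>

section \<open>Modular functions of degree one\<close>

text \<open>The obstacle is that the automorphy factor of \<open>H\<close> is matrix valued, so a
  single entry has no law of its own under the full group. It has one under elements for which row
  \<open>j\<close> of \<open>C Z + D\<close> is a unit vector: there the factor of
  \<open>H $ j $ j\<close> is 1, and the copy of SL(2, Z) attached to a coordinate
  \<open>a \<noteq> j\<close> is of this kind. That copy moves the parameters \<open>(l, m)\<close>
  of a leaf along with \<open>\<tau>\<close>, so a single leaf does not give a function of level
  one. With a fixed denominator \<open>N\<close>, finitely many leaves remain modulo integral shears
  and translations, and the products of \<open>g - c\<close> over these are of level one; hence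
  SL(2, Z) enters only through \<open>T\<close>, \<open>S\<close> and the reduction of heights,
  without congruence subgroups. Polynomial growth takes the place of boundedness because the
  reduction by integral shears costs a factor quadratic in the imaginary part.\<close>

abbreviation uhp :: "complex set" where "uhp \<equiv> {z. 0 < Im z}"

lemma open_uhp: "open uhp"
  by (rule open_halfspace_Im_gt)

lemma convex_uhp: "convex uhp"
  by (rule convex_halfspace_Im_gt)

lemma Im_neg_inverse: "Im (- 1 / z) = Im z / (cmod z)\<^sup>2"
  by (simp add: Im_divide cmod_power2)

lemma neg_inverse_uhp: "0 < Im z \<Longrightarrow> 0 < Im (- 1 / z)"
  unfolding Im_neg_inverse by (rule divide_pos_pos) auto

text \<open>\<open>P\<close> takes values in any type, so the lemma serves periodic functions and,
  in \<open>modular_reduction\<close>, a periodic predicate.\<close>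

lemma periodic_of_int:
  assumes "\<And>z. 0 < Im z \<Longrightarrow> P (z + 1) = P z" "0 < Im z"
  shows "P (z + of_int n) = P z"
proof -
  have nat: "P (z + of_nat k) = P z" if "0 < Im z" for z k
    using that by (induction k) (use assms(1)[of "z + of_nat k" for k] in \<open>auto simp: add_ac\<close>)
  show ?thesis
  proof (cases "n \<ge> 0")
    case True
    then show ?thesis using nat[OF assms(2), of "nat n"] by simp
  next
    case False
    then show ?thesis using nat[of "z + of_int n" "nat (- n)"] assms(2) by simp
  qed
qed

text \<open>A point of height below \<open>1/2\<close> with \<open>\<bar>Re z\<bar> \<le> 1/2\<close> has \<open>\<bar>z\<bar>\<^sup>2 \<le> 1/2\<close>, so that inversion
  at least doubles its height.\<close>

lemma modular_reduction:
  assumes z: "0 < Im z"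
    and big: "\<And>z. 1/2 \<le> Im z \<Longrightarrow> P z"
    and T: "\<And>z. 0 < Im z \<Longrightarrow> P (z + 1) = P z"
    and S: "\<And>z. 0 < Im z \<Longrightarrow> P (- 1 / z) \<Longrightarrow> P z"
  shows "P z"
proof -
  have "P z" if "1 / 2 ^ Suc n \<le> Im z" for n z
    using that
  proof (induction n arbitrary: z)
    case 0
    then show ?case by (simp add: big)
  next
    case (Suc n)
    have pos: "0 < Im z"
      using Suc.prems by (smt (verit) divide_pos_pos zero_less_power)
    define w where "w = z - of_int (round (Re z))"
    have Imw: "Im w = Im z" by (simp add: w_def)
    have Rew: "\<bar>Re w\<bar> \<le> 1/2"
      unfolding w_def using of_int_round_abs_le[of "Re z"] by (simp add: abs_minus_commute)
    have eq: "P (w + of_int (round (Re z))) = P w"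
      by (intro periodic_of_int[of P] T) (use pos Imw in auto)
    have "P w"
    proof (cases "1/2 \<le> Im z")
      case True
      then show ?thesis using big Imw by simp
    next
      case False
      have "(Re w)\<^sup>2 \<le> (1/2)\<^sup>2" using Rew by (subst abs_le_square_iff[symmetric]) simp
      moreover have "(Im w)\<^sup>2 \<le> (1/2)\<^sup>2" using False pos Imw by (intro power_mono) auto
      ultimately have "(cmod w)\<^sup>2 \<le> 1/2" unfolding cmod_power2 by (simp add: power2_eq_square)
      moreover have "0 < (cmod w)\<^sup>2" using pos Imw by auto
      ultimately have "2 * Im w \<le> Im (- 1 / w)"
        unfolding Im_neg_inverse using pos Imw
        by (simp add: pos_le_divide_eq mult_le_cancel_left_pos)
      moreover have "1 / 2 ^ Suc n \<le> 2 * Im w" using Suc.prems Imw by (simp add: field_simps)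
      ultimately have "P (- 1 / w)" by (intro Suc.IH) linarith
      then show ?thesis using S pos Imw by simp
    qed
    then show ?case using eq by (simp add: w_def)
  qed
  moreover obtain n where "1 / 2 ^ Suc n \<le> Im z"
  proof -
    obtain n where "(1/2::real) ^ n < Im z" using real_arch_pow_inv[of "Im z" "1/2"] z by auto
    then have "1 / 2 ^ Suc n \<le> Im z" using z by (simp add: power_one_over divide_simps)
    then show ?thesis by (rule that)
  qed
  ultimately show ?thesis by blast
qed

text \<open>Uniform in \<open>Re z\<close>, polynomial in \<open>Im z\<close>: the class is closed
  under the products formed over a family, and in the variable \<open>q\<close> it means growth like
  a power of \<open>log |q|\<close>, slower than any pole.\<close>

definition moderate_growth :: "(complex \<Rightarrow> complex) \<Rightarrow> bool" where
  "moderate_growth f \<longleftrightarrow> (\<exists>C k. \<forall>z. 1/2 \<le> Im z \<longrightarrow> cmod (f z) \<le> C * (1 + Im z) ^ k)"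

lemma moderate_growth_const: "moderate_growth (\<lambda>_. c)"
  unfolding moderate_growth_def by (rule exI[of _ "cmod c"], rule exI[of _ 0]) simp

lemma moderate_growth_E:
  assumes "moderate_growth f"
  obtains C k where "0 \<le> C" "\<And>z. 1/2 \<le> Im z \<Longrightarrow> cmod (f z) \<le> C * (1 + Im z) ^ k"
proof -
  obtain C k where C: "\<And>z. 1/2 \<le> Im z \<Longrightarrow> cmod (f z) \<le> C * (1 + Im z) ^ k"
    using assms unfolding moderate_growth_def by blast
  have "0 \<le> C * (1 + Im (Complex 0 1)) ^ k"
    using C[of "Complex 0 1"] order.trans[OF norm_ge_zero] by fastforce
  then have "0 \<le> C" by (simp add: zero_le_mult_iff not_le power_le_zero_eq)
  then show ?thesis using C that by blast
qed

lemma moderate_growth_mult: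
  assumes "moderate_growth f" "moderate_growth g"
  shows "moderate_growth (\<lambda>z. f z * g z)"
proof -
  obtain C k where C: "0 \<le> C" "\<And>z. 1/2 \<le> Im z \<Longrightarrow> cmod (f z) \<le> C * (1 + Im z) ^ k"
    by (rule moderate_growth_E[OF assms(1)]) blast
  obtain D l where D: "0 \<le> D" "\<And>z. 1/2 \<le> Im z \<Longrightarrow> cmod (g z) \<le> D * (1 + Im z) ^ l"
    by (rule moderate_growth_E[OF assms(2)]) blast
  have "cmod (f z * g z) \<le> (C * D) * (1 + Im z) ^ (k + l)" if z: "1/2 \<le> Im z" for z
  proof -
    have "cmod (f z) * cmod (g z) \<le> (C * (1 + Im z) ^ k) * (D * (1 + Im z) ^ l)"
      by (intro mult_mono C D z) (use z C D in auto)
    then show ?thesis by (simp add: norm_mult power_add mult_ac)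
  qed
  then show ?thesis unfolding moderate_growth_def by blast
qed

lemma moderate_growth_diff:
  assumes "moderate_growth f" "moderate_growth g"
  shows "moderate_growth (\<lambda>z. f z - g z)"
proof -
  obtain C k where C: "0 \<le> C" "\<And>z. 1/2 \<le> Im z \<Longrightarrow> cmod (f z) \<le> C * (1 + Im z) ^ k"
    by (rule moderate_growth_E[OF assms(1)]) blast
  obtain D l where D: "0 \<le> D" "\<And>z. 1/2 \<le> Im z \<Longrightarrow> cmod (g z) \<le> D * (1 + Im z) ^ l"
    by (rule moderate_growth_E[OF assms(2)]) blast
  have "cmod (f z - g z) \<le> (C + D) * (1 + Im z) ^ (k + l)" if z: "1/2 \<le> Im z" for z
  proof -
    have "cmod (f z - g z) \<le> C * (1 + Im z) ^ k + D * (1 + Im z) ^ l"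
      using norm_triangle_ineq4[of "f z" "g z"] C(2)[OF z] D(2)[OF z] by linarith
    also have "\<dots> \<le> C * (1 + Im z) ^ (k + l) + D * (1 + Im z) ^ (k + l)"
      by (intro add_mono mult_left_mono power_increasing) (use z C D in auto)
    finally show ?thesis by (simp add: algebra_simps)
  qed
  then show ?thesis unfolding moderate_growth_def by blast
qed

lemma moderate_growth_prod:
  assumes "\<And>i. i \<in> A \<Longrightarrow> moderate_growth (f i)"
  shows "moderate_growth (\<lambda>z. \<Prod>i\<in>A. f i z)"
  using assms
  by (induction A rule: infinite_finite_induct)
    (simp_all add: moderate_growth_const moderate_growth_mult)

section \<open>The local parameter at the cusp, and level one functions\<close>

definition nome :: "complex \<Rightarrow> complex" where
  "nome z = exp (2 * pi * \<i> * z)"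

lemma norm_nome: "cmod (nome z) = exp (- 2 * pi * Im z)"
  by (simp add: nome_def)

lemma nome_eq_iff: "nome z = nome w \<longleftrightarrow> (\<exists>n::int. z = w + of_int n)"
proof -
  have "2 * pi * \<i> * z = 2 * pi * \<i> * w + of_int (2 * n) * pi * \<i> \<longleftrightarrow> z = w + of_int n" for n
  proof -
    have "2 * pi * \<i> * w + of_int (2 * n) * pi * \<i> = 2 * pi * \<i> * (w + of_int n)"
      by (simp add: algebra_simps)
    then show ?thesis by simp
  qed
  then show ?thesis unfolding nome_def exp_eq by (simp only:)
qed

definition unnome :: "complex \<Rightarrow> complex" where
  "unnome q = Ln q / (2 * pi * \<i>)"

lemma nome_unnome: "q \<noteq> 0 \<Longrightarrow> nome (unnome q) = q"
  by (simp add: nome_def unnome_def)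

lemma Im_unnome: "q \<noteq> 0 \<Longrightarrow> Im (unnome q) = - ln (cmod q) / (2 * pi)"
  by (simp add: unnome_def Im_divide power2_eq_square field_simps)

lemma unnome_uhp: "q \<noteq> 0 \<Longrightarrow> cmod q < 1 \<Longrightarrow> 0 < Im (unnome q)"
  by (simp add: Im_unnome divide_neg_pos)

text \<open>\<open>unnome\<close> jumps across the negative real axis, but by an integer, which a
  periodic \<open>f\<close> does not see. Near \<open>q0\<close> it is therefore replaced by another
  branch of the logarithm.\<close>

lemma holomorphic_unnome:
  assumes hol: "f holomorphic_on uhp" and per: "\<And>z. 0 < Im z \<Longrightarrow> f (z + 1) = f z"
  shows "(\<lambda>q. f (unnome q)) holomorphic_on ball 0 1 - {0}"
proof (rule holomorphic_onI, rule field_differentiable_at_within)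
  fix q0 :: complex assume q0: "q0 \<in> ball 0 1 - {0}"
  \<comment> \<open>Near \<open>q0\<close> the quotient \<open>q / q0\<close> is close to 1, away
    from the cut of \<open>Ln\<close>, so \<open>L\<close> is differentiable at \<open>q0\<close>
    wherever \<open>q0\<close> lies in the punctured disc.\<close>
  define L where "L = (\<lambda>q. (Ln (q / q0) + Ln q0) / (2 * pi * \<i>))"
  have L: "nome (L q) = q" if "q \<noteq> 0" for q
    using that q0 by (simp add: nome_def L_def exp_add)
  have "L q0 = unnome q0" using q0 by (simp add: L_def unnome_def)
  then have Lq0: "0 < Im (L q0)" using unnome_uhp[of q0] q0 by simp
  have dL: "L field_differentiable at q0"
    unfolding L_def field_differentiable_def
    by (rule exI, (rule derivative_eq_intros refl | use q0 in simp)+)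
  have "f field_differentiable at (L q0)"
    by (rule holomorphic_on_imp_differentiable_at[OF hol open_uhp]) (use Lq0 in simp)
  then have fL: "(f \<circ> L) field_differentiable at q0"
    by (rule field_differentiable_compose[OF dL])
  show "(\<lambda>q. f (unnome q)) field_differentiable at q0"
  proof -
    obtain D where D: "((f \<circ> L) has_field_derivative D) (at q0)"
      using fL by (auto simp: field_differentiable_def)
    have o: "open (ball 0 1 - {0::complex})" by (simp add: open_delete)
    have "((\<lambda>q. f (unnome q)) has_field_derivative D) (at q0)"
    proof (rule has_field_derivative_transform_within_open[OF D o q0])
      fix q :: complex assume q: "q \<in> ball 0 1 - {0}"
      have "nome (L q) = nome (unnome q)" using q L[of q] nome_unnome[of q] by simp
      then obtain n :: int where "L q = unnome q + of_int n" by (auto simp: nome_eq_iff)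
      then show "(f \<circ> L) q = f (unnome q)"
        using periodic_of_int[of f, OF per, of "unnome q" n] unnome_uhp[of q] q by simp
    qed
    then show ?thesis by (auto simp: field_differentiable_def)
  qed
qed

text \<open>Since \<open>Im (unnome q) = - ln |q| / (2 pi)\<close>, the bound becomes a power of a
  logarithm, which the factor \<open>q\<close> outweighs.\<close>

lemma moderate_growth_tendsto:
  assumes "moderate_growth f"
  shows "((\<lambda>q. q * f (unnome q)) \<longlongrightarrow> 0) (at 0)"
proof -
  obtain C k where C: "0 \<le> C" "\<And>z. 1/2 \<le> Im z \<Longrightarrow> cmod (f z) \<le> C * (1 + Im z) ^ k"
    by (rule moderate_growth_E[OF assms]) blast
  have lim: "((\<lambda>x::real. x * (C * (1 - ln x / (2 * pi)) ^ k)) \<longlongrightarrow> 0) (at_right 0)"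
    by real_asymp
  have nlim: "filterlim (\<lambda>q::complex. cmod q) (at_right 0) (at 0)"
    unfolding filterlim_at by (auto intro!: tendsto_eq_intros simp: eventually_at_filter)
  have "((\<lambda>q::complex. cmod q * (C * (1 - ln (cmod q) / (2 * pi)) ^ k)) \<longlongrightarrow> 0) (at 0)"
    using filterlim_compose[OF lim nlim] .
  moreover have "\<forall>\<^sub>F q in at 0. norm (q * f (unnome q)) \<le>
      cmod q * (C * (1 - ln (cmod q) / (2 * pi)) ^ k)"
  proof -
    \<comment> \<open>\<open>|q| < exp (- pi)\<close> corresponds to height above 1/2, where the
      growth bound is available.\<close>
    have "\<forall>\<^sub>F q::complex in at 0. q \<in> ball 0 (exp (- pi)) - {0}"
      using eventually_at_ball[of "exp (-pi)" "0::complex" UNIV]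
      by (auto simp: eventually_at_filter elim: eventually_mono)
    then show ?thesis
    proof eventually_elim
      case (elim q)
      have "ln (cmod q) \<le> - pi"
        using elim ln_mono[of "cmod q" "exp (-pi)"] by simp
      then have "1/2 \<le> Im (unnome q)"
        using elim by (simp add: Im_unnome field_simps)
      then have "cmod (f (unnome q)) \<le> C * (1 - ln (cmod q) / (2 * pi)) ^ k"
        using C(2)[of "unnome q"] elim by (simp add: Im_unnome)
      then show ?case by (simp add: norm_mult mult_left_mono)
    qed
  qed
  ultimately show ?thesis by (rule Lim_null_comparison[rotated])
qed

text \<open>As a function of \<open>q\<close>, \<open>f\<close> extends over the cusp, and
  \<open>modular_reduction\<close> bounds it on the whole disc by its maximum on the closed disc of
  radius \<open>exp (- pi)\<close>, the image of height at least 1/2. The maximum is thus attained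
  inside, and the maximum modulus principle applies.\<close>

lemma modular_function_constant:
  assumes hol: "f holomorphic_on uhp"
    and T: "\<And>z. 0 < Im z \<Longrightarrow> f (z + 1) = f z"
    and S: "\<And>z. 0 < Im z \<Longrightarrow> f (- 1 / z) = f z"
    and growth: "moderate_growth f"
  shows "f constant_on uhp"
proof -
  define B where "B = ball (0::complex) 1"
  have B: "open B" "0 \<in> B" "connected B" by (auto simp: B_def)
  define g where "g = (\<lambda>q. f (unnome q))"
  have g: "g holomorphic_on B - {0}"
    unfolding g_def B_def by (rule holomorphic_unnome[OF hol T])
  \<comment> \<open>Growth only shows that \<open>q * g q\<close> tends to 0. So this product is
    extended first; its derivative at 0 is the limit of \<open>g\<close>, which then extends
    too.\<close>
  have "(\<lambda>q. if q = 0 then 0 else q * g q) holomorphic_on B" (is "?h holomorphic_on _")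
    by (rule removable_singularity) 
      (use B g moderate_growth_tendsto[OF growth] in \<open>auto simp: g_def intro!: holomorphic_intros\<close>)
  then have "?h field_differentiable at 0"
    using B holomorphic_on_imp_differentiable_at by blast
  then obtain c where "(?h has_field_derivative c) (at 0)" by (auto simp: field_differentiable_def)
  then have "((\<lambda>q. (?h q - ?h 0) / (q - 0)) \<longlongrightarrow> c) (at 0)"
    by (simp only: has_field_derivative_iff)
  then have "(g \<longlongrightarrow> c) (at 0)"
    by (rule Lim_transform_eventually) (auto simp: eventually_at_filter)
  then have G: "(\<lambda>q. if q = 0 then c else g q) holomorphic_on B" (is "?G holomorphic_on _")
    by (rule removable_singularity[OF g B(1)])
  have fG: "f z = ?G (nome z)" if "0 < Im z" for z
  proof -
    have nz: "nome z \<noteq> 0" by (simp add: nome_def)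
    then obtain n :: int where n: "z = unnome (nome z) + of_int n"
      using nome_eq_iff[of z "unnome (nome z)"] nome_unnome by auto
    have "0 < Im (unnome (nome z))" using that n by (metis add.right_neutral complex_Im_of_int plus_complex.sel(2))
    then have "f (unnome (nome z) + of_int n) = f (unnome (nome z))"
      by (intro periodic_of_int[of f] T)
    then show ?thesis using n nz by (simp add: g_def)
  qed
  define K where "K = cball (0::complex) (exp (- pi))"
  have KB: "K \<subseteq> B" using order.strict_trans1[of _ "exp (- pi)" 1] by (auto simp: K_def B_def)
  have "continuous_on K (\<lambda>q. cmod (?G q))"
    using holomorphic_on_imp_continuous_on[OF G] KB
    by (intro continuous_on_norm) (rule continuous_on_subset)
  moreover have "compact K" "K \<noteq> {}" by (auto simp: K_def)
  ultimately obtain q0 where q0: "q0 \<in> K" "\<And>q. q \<in> K \<Longrightarrow> cmod (?G q) \<le> cmod (?G q0)"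
    using continuous_attains_sup[of K "\<lambda>q. cmod (?G q)"] by blast
  have bd: "cmod (f z) \<le> cmod (?G q0)" if "0 < Im z" for z
  proof (rule modular_reduction[OF that])
    fix z assume z: "1/2 \<le> Im z"
    have "nome z \<in> K" using z by (simp add: K_def norm_nome)
    then show "cmod (f z) \<le> cmod (?G q0)" using q0(2) fG[of z] z by simp
  qed (use S T in auto)
  have "cmod (?G q) \<le> cmod (?G q0)" if "q \<in> B" for q
  proof (cases "q = 0")
    case True
    then show ?thesis using q0(2)[of 0] by (simp add: K_def)
  next
    case False
    then show ?thesis
      using bd[of "unnome q"] unnome_uhp[of q] that by (simp add: B_def g_def)
  qed
  then have "?G constant_on B"
    using maximum_modulus_principle[OF G B(1) B(3) B(1) order_refl] q0(1) KB by blast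
  then obtain d where d: "\<And>q. q \<in> B \<Longrightarrow> ?G q = d" by (auto simp: constant_on_def)
  have "f z = d" if "0 < Im z" for z
    using fG[OF that] d[of "nome z"] that by (simp add: B_def norm_nome)
  then show ?thesis by (auto simp: constant_on_def)
qed

text \<open>Each product of \<open>g - c\<close> over the family is a modular function, hence
  constant. For \<open>c = f z\<close> it is 0, so \<open>f z\<close> is one of the finitely many
  values of the family at \<open>i\<close>; a continuous function with finitely many values on a
  connected set is constant.\<close>

lemma finite_modular_family_constant:
  assumes fin: "finite F"
    and hol: "\<And>f. f \<in> F \<Longrightarrow> f holomorphic_on uhp"
    and T: "\<And>f. f \<in> F \<Longrightarrow> \<exists>g\<in>F. \<forall>z\<in>uhp. f (z + 1) = g z"
    and S: "\<And>f. f \<in> F \<Longrightarrow> \<exists>g\<in>F. \<forall>z\<in>uhp. f (- 1 / z) = g z"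
    and growth: "\<And>f. f \<in> F \<Longrightarrow> moderate_growth f"
    and f: "f \<in> F"
  shows "f constant_on uhp"
proof -
  \<comment> \<open>Cutting off outside the half plane turns agreement on it into equality of
    functions, so that the substitutions permute the set \<open>R\<close>.\<close>
  define r where "r = (\<lambda>(f::complex \<Rightarrow> complex) z. if z \<in> uhp then f z else 0)"
  define R where "R = r ` F"
  have finR: "finite R" using fin by (simp add: R_def)
  have reindex: "bij_betw (\<lambda>g. r (\<lambda>z. g (t z))) R R"
    if t: "\<And>z. z \<in> uhp \<Longrightarrow> t z \<in> uhp" "\<And>z. z \<in> uhp \<Longrightarrow> u z \<in> uhp \<and> t (u z) = z"
      and F: "\<And>f. f \<in> F \<Longrightarrow> \<exists>g\<in>F. \<forall>z\<in>uhp. f (t z) = g z" for t u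
  proof -
    let ?s = "\<lambda>g. r (\<lambda>z. g (t z))"
    have "?s ` R \<subseteq> R"
    proof (clarsimp simp: R_def)
      fix f assume "f \<in> F"
      with F obtain g where "g \<in> F" "\<forall>z\<in>uhp. f (t z) = g z" by blast
      then have "r (\<lambda>z. r f (t z)) = r g" using t(1) by (auto simp: r_def fun_eq_iff)
      then show "r (\<lambda>z. r f (t z)) \<in> r ` F" using \<open>g \<in> F\<close> by blast
    qed
    moreover have "inj_on ?s R"
    proof (rule inj_onI)
      fix g h assume g: "g \<in> R" "h \<in> R" and eq: "?s g = ?s h"
      have "g z = h z" if "z \<in> uhp" for z
        using fun_cong[OF eq, of "u z"] t(2)[OF that] by (simp add: r_def)
      moreover have "g z = h z" if "z \<notin> uhp" for z
        using g that by (auto simp: R_def r_def)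
      ultimately show "g = h" by blast
    qed
    ultimately show ?thesis
      using endo_inj_surj[OF finR] by (simp add: bij_betw_def)
  qed
  have bT: "bij_betw (\<lambda>g. r (\<lambda>z. g (z + 1))) R R"
    by (rule reindex[where u = "\<lambda>z. z - 1", OF _ _ T]) auto
  have bS: "bij_betw (\<lambda>g. r (\<lambda>z. g (- 1 / z))) R R"
    by (rule reindex[where u = "\<lambda>z. - 1 / z", OF _ _ S]) (auto simp del: divide_minus_left simp: neg_inverse_uhp)
  define Q where "Q = (\<lambda>c z. \<Prod>g\<in>R. (g z - c))"
  have holR: "g holomorphic_on uhp" if g: "g \<in> R" for g
  proof -
    obtain f where f: "f \<in> F" "g = r f" using g by (auto simp: R_def)
    show ?thesis by (rule holomorphic_transform[OF hol[OF f(1)]]) (simp add: f r_def)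
  qed
  have growthR: "moderate_growth g" if g: "g \<in> R" for g
  proof -
    obtain f where f: "f \<in> F" "g = r f" using g by (auto simp: R_def)
    show ?thesis
      using growth[OF f(1)] by (auto simp: moderate_growth_def f r_def)
  qed
  have "Q c constant_on uhp" for c
  proof (rule modular_function_constant)
    show "Q c holomorphic_on uhp"
      unfolding Q_def by (intro holomorphic_intros holR) auto
    show "moderate_growth (Q c)"
      unfolding Q_def by (intro moderate_growth_prod moderate_growth_diff growthR moderate_growth_const)
    show "Q c (z + 1) = Q c z" if "0 < Im z" for z
      using prod.reindex_bij_betw[OF bT, of "\<lambda>g. g z - c"] that by (simp add: Q_def r_def)
    show "Q c (- 1 / z) = Q c z" if "0 < Im z" for z
      using prod.reindex_bij_betw[OF bS, of "\<lambda>g. g z - c"] that by (simp add: Q_def r_def)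
  qed
  then have Qc: "Q c z = Q c \<i>" if "z \<in> uhp" for c z
  proof -
    obtain y where "\<And>x. x \<in> uhp \<Longrightarrow> Q c x = y"
      using \<open>Q c constant_on uhp\<close> unfolding constant_on_def by blast
    from this[of z] this[of \<i>] that show ?thesis by simp
  qed
  have "r f z \<in> (\<lambda>g. g \<i>) ` R" if z: "z \<in> uhp" for z
  proof -
    have "Q (r f z) z = 0"
      unfolding Q_def using finR f by (intro prod_zero) (auto simp: R_def)
    then have "Q (r f z) \<i> = 0" using Qc[OF z] by simp
    then show ?thesis using finR by (auto simp: Q_def intro: rev_image_eqI)
  qed
  then have "finite (r f ` uhp)"
    by (intro finite_subset[OF _ finite_imageI[OF finR]]) blast
  moreover have "r f ` uhp = f ` uhp" by (auto simp: r_def)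
  ultimately show ?thesis
    using holomorphic_on_imp_continuous_on[OF hol[OF f]] convex_connected[OF convex_uhp]
    by (intro continuous_finite_range_constant) auto
qed

lemma periodic_bounded_strip:
  assumes cont: "continuous_on uhp F" and T: "\<And>z. 0 < Im z \<Longrightarrow> F (z + 1) = F z"
  shows "\<exists>M. \<forall>z. 1/2 \<le> Im z \<longrightarrow> Im z \<le> 1 \<longrightarrow> cmod (F z) \<le> M"
proof -
  define K where "K = cbox (Complex 0 (1/2)) (Complex 1 1)"
  have K: "z \<in> K \<longleftrightarrow> 0 \<le> Re z \<and> Re z \<le> 1 \<and> 1/2 \<le> Im z \<and> Im z \<le> 1" for z
    by (auto simp: K_def in_cbox_complex_iff)
  have "continuous_on K F"
    by (rule continuous_on_subset[OF cont]) (auto simp: K)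
  then have "bounded (F ` K)"
    by (intro compact_imp_bounded compact_continuous_image) (simp_all add: K_def)
  then obtain M where M: "\<And>z. z \<in> K \<Longrightarrow> cmod (F z) \<le> M" by (auto simp: bounded_iff)
  have "cmod (F z) \<le> M" if z: "1/2 \<le> Im z" "Im z \<le> 1" for z
  proof -
    define w where "w = z - of_int \<lfloor>Re z\<rfloor>"
    have "F (w + of_int \<lfloor>Re z\<rfloor>) = F w"
      by (intro periodic_of_int[of F] T) (use z in \<open>auto simp: w_def\<close>)
    then have "F z = F w" by (simp add: w_def)
    moreover have "0 \<le> Re w" "Re w \<le> 1" unfolding w_def by simp_all linarith
    then have "w \<in> K" using z by (simp add: K w_def)
    ultimately show ?thesis using M[of w] by simp
  qed
  then show ?thesis by blast
qed

text \<open>A primitive \<open>F\<close> of the form changes under \<open>S\<close> and \<open>T\<close> by constants, and these are \<open>0\<close>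
  because \<open>S\<close> fixes \<open>\<i>\<close> and \<open>S \<rho> = \<rho> - 1\<close> for \<open>\<rho> = exp (\<pi> \<i> / 3)\<close>.\<close>

lemma weight_two_zero:
  assumes hol: "h holomorphic_on uhp"
    and T: "\<And>z. 0 < Im z \<Longrightarrow> h (z + 1) = h z"
    and S: "\<And>z. 0 < Im z \<Longrightarrow> h (- 1 / z) = z\<^sup>2 * h z"
    and bd: "\<And>z. 1 \<le> Im z \<Longrightarrow> cmod (h z) \<le> B"
    and z: "0 < Im z"
  shows "h z = 0"
proof -
  obtain F where F': "\<And>z. z \<in> uhp \<Longrightarrow> (F has_field_derivative h z) (at z within uhp)"
    using holomorphic_convex_primitive'[OF convex_uhp open_uhp hol] by blast
  have F: "(F has_field_derivative h z) (at z)" if "0 < Im z" for z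
    using F'[of z] that at_within_open[OF _ open_uhp, of z] by simp
  have holF: "F holomorphic_on uhp"
    unfolding holomorphic_on_def field_differentiable_def using F' by blast
  have const: "\<exists>c. \<forall>z\<in>uhp. F (t z) - F z = c"
    if t: "\<And>z. 0 < Im z \<Longrightarrow> (t has_field_derivative t' z) (at z)" "\<And>z. 0 < Im z \<Longrightarrow> 0 < Im (t z)"
      "\<And>z. 0 < Im z \<Longrightarrow> h (t z) * t' z = h z" for t t'
  proof (rule has_field_derivative_zero_constant[OF convex_uhp])
    fix z assume z: "z \<in> uhp"
    have "((\<lambda>z. F (t z) - F z) has_field_derivative h (t z) * t' z - h z) (at z)"
      by (intro DERIV_diff F DERIV_chain2[OF F] t) (use z t(2) in auto)
    then show "((\<lambda>z. F (t z) - F z) has_field_derivative 0) (at z within uhp)"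
      using t(3)[of z] z by (simp add: has_field_derivative_at_within)
  qed
  obtain \<alpha> where \<alpha>: "\<And>z. 0 < Im z \<Longrightarrow> F (z + 1) - F z = \<alpha>"
  proof -
    have "((\<lambda>z. z + 1) has_field_derivative 1) (at z)" for z :: complex
      by (auto intro!: derivative_eq_intros)
    from const[OF this] T that show ?thesis by auto
  qed
  obtain \<beta> where \<beta>: "\<And>z. 0 < Im z \<Longrightarrow> F (- 1 / z) - F z = \<beta>"
  proof -
    have "((\<lambda>z. - 1 / z) has_field_derivative 1 / z\<^sup>2) (at z)" if "0 < Im z" for z
      using that by (auto intro!: derivative_eq_intros simp: power2_eq_square)
    moreover have "h (- 1 / z) * (1 / z\<^sup>2) = h z" if "0 < Im z" for z
      using S[OF that] that by (auto simp: field_simps)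
    ultimately show ?thesis
      using const[of "\<lambda>z. - 1 / z" "\<lambda>z. 1 / z\<^sup>2"] neg_inverse_uhp that by auto
  qed
  have "- 1 / \<i> = \<i>" by (simp add: field_simps)
  then have b0: "\<beta> = 0" using \<beta>[of \<i>] by simp
  define \<rho> where "\<rho> = Complex (1/2) (sqrt 3 / 2)"
  have "- 1 / \<rho> + 1 = \<rho>"
  proof -
    have "\<rho> * \<rho> - \<rho> + 1 = 0" by (simp add: \<rho>_def complex_eq_iff field_simps)
    moreover have "\<rho> \<noteq> 0" by (simp add: \<rho>_def complex_eq_iff)
    ultimately show ?thesis by (simp add: field_simps)
  qed
  then have "\<alpha> = 0" 
    using \<alpha>[of "- 1 / \<rho>"] \<beta>[of \<rho>] neg_inverse_uhp[of \<rho>] b0 by (simp add: \<rho>_def)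
  with \<alpha> b0 \<beta> have FT: "F (z + 1) = F z" and FS: "F (- 1 / z) = F z" if "0 < Im z" for z
    using that by auto
  obtain M where M: "\<And>z. 1/2 \<le> Im z \<Longrightarrow> Im z \<le> 1 \<Longrightarrow> cmod (F z) \<le> M"
    using periodic_bounded_strip[OF holomorphic_on_imp_continuous_on[OF holF] FT] by blast
  have M0: "0 \<le> M" using order.trans[OF norm_ge_zero M[of \<i>]] by simp
  have B0: "0 \<le> B" using order.trans[OF norm_ge_zero bd[of \<i>]] by simp
  have "cmod (F z) \<le> (M + B) * (1 + Im z) ^ 1" if z: "1/2 \<le> Im z" for z
  proof (cases "Im z \<le> 1")
    case True
    then have "cmod (F z) \<le> M" using M z by blast
    also have "M \<le> (M + B) * (1 + Im z)"
      using M0 B0 z mult_left_mono[of 1 "1 + Im z" "M + B"] by simp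
    finally show ?thesis by simp
  next
    case False
    \<comment> \<open>The mean value inequality from height 1 upwards turns the bound on
      \<open>h\<close> into linear growth of its primitive.\<close>
    define w where "w = Complex (Re z) 1"
    have "cmod (F z - F w) \<le> B * cmod (z - w)"
    proof (rule field_differentiable_bound)
      show "convex {z. Im z \<ge> 1}" by (rule convex_halfspace_Im_ge)
      show "(F has_field_derivative h z) (at z within {z. 1 \<le> Im z})" if "z \<in> {z. 1 \<le> Im z}" for z
        using F[of z] that by (auto intro: has_field_derivative_at_within)
    qed (use bd False in \<open>auto simp: w_def\<close>)
    also have "z - w = \<i> * of_real (Im z - 1)"
      by (simp add: w_def complex_eq_iff)
    also have "cmod (\<i> * of_real (Im z - 1)) = Im z - 1"
      using False by (subst norm_mult, subst norm_of_real) simp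
    finally have "cmod (F z - F w) \<le> B * (Im z - 1)" .
    moreover have "cmod (F w) \<le> M" using M[of w] by (simp add: w_def)
    ultimately have "cmod (F z) \<le> M + B * (Im z - 1)"
      using norm_triangle_ineq[of "F z - F w" "F w"] by simp
    also have "\<dots> \<le> (M + B) * (1 + Im z)"
      using M0 B0 False by (simp add: algebra_simps)
    finally show ?thesis by simp
  qed
  then have "moderate_growth F" unfolding moderate_growth_def by blast
  then have "F constant_on uhp"
    using modular_function_constant[OF holF FT FS] by blast
  then obtain c where c: "\<And>z. z \<in> uhp \<Longrightarrow> F z = c" by (auto simp: constant_on_def)
  have "((\<lambda>_. c) has_field_derivative h z) (at z)"
    by (rule has_field_derivative_transform_within_open[OF F[OF z] open_uhp]) (use z c in auto)
  then show ?thesis using DERIV_const DERIV_unique by blast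
qed

section \<open>Determinants and inverses of matrices of functions\<close>

lemma has_derivative_vec_iff:
  fixes f :: "'a::real_normed_vector \<Rightarrow> 'b::euclidean_space ^ 'n"
  shows "(f has_derivative f') (at x within S) \<longleftrightarrow>
    (\<forall>i. ((\<lambda>x. f x $ i) has_derivative (\<lambda>h. f' h $ i)) (at x within S))"
proof
  assume "(f has_derivative f') (at x within S)"
  then show "\<forall>i. ((\<lambda>x. f x $ i) has_derivative (\<lambda>h. f' h $ i)) (at x within S)"
    using bounded_linear.has_derivative[OF bounded_linear_vec_nth] by blast
next
  assume *: "\<forall>i. ((\<lambda>x. f x $ i) has_derivative (\<lambda>h. f' h $ i)) (at x within S)"
  show "(f has_derivative f') (at x within S)"
    unfolding has_derivative_componentwise_within[of f] Basis_vec_def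
    by (auto simp: inner_axis intro!: has_derivative_inner_left *[rule_format])
qed

lemma has_derivative_mat_iff:
  fixes f :: "'a::real_normed_vector \<Rightarrow> ('b::euclidean_space, 'n::finite) sqmat"
  shows "(f has_derivative f') (at x within S) \<longleftrightarrow>
    (\<forall>i j. ((\<lambda>x. f x $ i $ j) has_derivative (\<lambda>h. f' h $ i $ j)) (at x within S))"
  by (simp add: has_derivative_vec_iff[of f] has_derivative_vec_iff[of "\<lambda>x. f x $ _"])

lemma has_derivative_mat_mult:
  fixes F G :: "'a::real_normed_vector \<Rightarrow> (complex, 'n::finite) sqmat"
  assumes "(F has_derivative F') (at x within S)" "(G has_derivative G') (at x within S)"
  shows "((\<lambda>x. F x ** G x) has_derivative (\<lambda>h. F x ** G' h + F' h ** G x)) (at x within S)"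
proof -
  have F: "((\<lambda>x. F x $ i $ j) has_derivative (\<lambda>h. F' h $ i $ j)) (at x within S)"
    and G: "((\<lambda>x. G x $ i $ j) has_derivative (\<lambda>h. G' h $ i $ j)) (at x within S)" for i j
    using assms by (simp_all add: has_derivative_mat_iff)
  have "((\<lambda>x. \<Sum>k\<in>UNIV. F x $ i $ k * G x $ k $ j) has_derivative
      (\<lambda>h. \<Sum>k\<in>UNIV. F x $ i $ k * G' h $ k $ j + F' h $ i $ k * G x $ k $ j)) (at x within S)" for i j
    by (intro has_derivative_sum has_derivative_mult F G)
  then show ?thesis
    by (simp add: has_derivative_mat_iff matrix_matrix_mult_def sum.distrib)
qed

lemma has_derivative_transpose:
  fixes F :: "'a::real_normed_vector \<Rightarrow> (complex, 'n::finite) sqmat"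
  assumes "(F has_derivative F') (at x within S)"
  shows "((\<lambda>x. transpose (F x)) has_derivative (\<lambda>h. transpose (F' h))) (at x within S)"
  using assms by (simp add: has_derivative_mat_iff transpose_def)

lemma matrix_add_rdistrib: "(B + C) ** A = B ** A + C ** (A :: ('a::ring_1, 'n::finite) sqmat)"
  by (simp add: matrix_matrix_mult_def vec_eq_iff algebra_simps sum.distrib)

lemma matrix_diff_ldistrib: "A ** (B - C) = A ** B - A ** (C :: ('a::ring_1, 'n::finite) sqmat)"
  by (simp add: matrix_matrix_mult_def vec_eq_iff algebra_simps sum_subtractf)

lemma matrix_diff_rdistrib: "(B - C) ** A = B ** A - C ** (A :: ('a::ring_1, 'n::finite) sqmat)"
  by (simp add: matrix_matrix_mult_def vec_eq_iff algebra_simps sum_subtractf)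

lemma matrix_minus_left: "(- A) ** B = - (A ** (B :: ('a::ring_1, 'n::finite) sqmat))"
  by (simp add: matrix_matrix_mult_def vec_eq_iff sum_negf)

lemma matrix_minus_right: "A ** (- B) = - (A ** (B :: ('a::ring_1, 'n::finite) sqmat))"
  by (simp add: matrix_matrix_mult_def vec_eq_iff sum_negf)

lemma transpose_add: "transpose (A + B) = transpose A + transpose (B :: ('a::plus, 'n::finite) sqmat)"
  by (simp add: transpose_def vec_eq_iff)

lemmas mat_ring = matrix_add_ldistrib matrix_add_rdistrib matrix_diff_ldistrib
  matrix_diff_rdistrib matrix_minus_left matrix_minus_right matrix_mul_assoc

text \<open>The Leibniz expansion with the factor of row \<open>r\<close> split off. This is the
  shape that the product rule produces, for Frechet derivatives as well as for derivations of
  forms.\<close>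

lemma det_replace_row:
  fixes A :: "('a::comm_ring_1, 'n::finite) sqmat"
  shows "det (\<chi> i. if i = r then v else A $ i) =
    (\<Sum>p | p permutes UNIV. of_int (sign p) * (v $ p r * (\<Prod>i\<in>UNIV - {r}. A $ i $ p i)))"
  unfolding det_def
proof (rule sum.cong)
  fix p assume "p \<in> {p. p permutes (UNIV::'n set)}"
  have "(\<Prod>i\<in>UNIV. (\<chi> i. if i = r then v else A $ i) $ i $ p i)
      = v $ p r * (\<Prod>i\<in>UNIV - {r}. (\<chi> i. if i = r then v else A $ i) $ i $ p i)"
    by (subst prod.remove[of _ r]) auto
  also have "(\<Prod>i\<in>UNIV - {r}. (\<chi> i. if i = r then v else A $ i) $ i $ p i)
      = (\<Prod>i\<in>UNIV - {r}. A $ i $ p i)"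
    by (rule prod.cong) auto
  finally show "of_int (sign p) * (\<Prod>i\<in>UNIV. (\<chi> i. if i = r then v else A $ i) $ i $ p i)
      = of_int (sign p) * (v $ p r * (\<Prod>i\<in>UNIV - {r}. A $ i $ p i))" by simp
qed simp

text \<open>Row \<open>r\<close> of \<open>N M\<close> is \<open>\<Sum>\<^sub>c N\<^sub>r\<^sub>c row\<^sub>c(M)\<close>, and only the term \<open>c = r\<close> survives in the
  alternating form \<open>det\<close>.\<close>

lemma sum_det_replace_row_mult:
  fixes N M :: "('a::comm_ring_1, 'n::finite) sqmat"
  shows "(\<Sum>r\<in>UNIV. det (\<chi> i. if i = r then (N ** M) $ r else M $ i)) = trace N * det M"
proof -
  have "det (\<chi> i. if i = r then (N ** M) $ r else M $ i) = N $ r $ r * det M" for r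
  proof -
    have row: "(N ** M) $ r = (\<Sum>c\<in>UNIV. N $ r $ c *s M $ c)"
      by (simp add: vec_eq_iff matrix_matrix_mult_def)
    have "det (\<chi> i. if i = r then (N ** M) $ r else M $ i)
        = (\<Sum>c\<in>UNIV. N $ r $ c * det (\<chi> i. if i = r then M $ c else M $ i))"
      unfolding row by (subst det_linear_row_sum) (simp_all add: det_row_mul)
    also have "\<dots> = (\<Sum>c\<in>UNIV. if c = r then N $ r $ r * det M else 0)"
    proof (rule sum.cong)
      fix c
      show "N $ r $ c * det (\<chi> i. if i = r then M $ c else M $ i) =
          (if c = r then N $ r $ r * det M else 0)"
      proof (cases "c = r")
        case True
        then have "(\<chi> i. if i = r then M $ c else M $ i) = M" by (simp add: vec_eq_iff)
        then show ?thesis using True by simp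
      next
        case False
        have "det (\<chi> i. if i = r then M $ c else M $ i) = 0"
          by (rule det_identical_rows[OF False]) (use False in \<open>auto simp: row_def vec_eq_iff\<close>)
        then show ?thesis using False by simp
      qed
    qed simp
    finally show ?thesis by simp
  qed
  then show ?thesis by (simp add: trace_def sum_distrib_right)
qed

lemma has_derivative_det:
  fixes F :: "'a::real_normed_vector \<Rightarrow> (complex, 'n::finite) sqmat"
  assumes "(F has_derivative F') (at x within S)"
  shows "((\<lambda>x. det (F x)) has_derivative
      (\<lambda>h. \<Sum>r\<in>UNIV. det (\<chi> i. if i = r then F' h $ r else F x $ i))) (at x within S)"
proof -
  have F: "((\<lambda>x. F x $ i $ j) has_derivative (\<lambda>h. F' h $ i $ j)) (at x within S)" for i j
    using assms by (simp add: has_derivative_mat_iff)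
  have "((\<lambda>x. \<Sum>p | p permutes UNIV. of_int (sign p) * (\<Prod>i\<in>UNIV. F x $ i $ p i)) has_derivative
      (\<lambda>h. \<Sum>p | p permutes UNIV. of_int (sign p) *
         (\<Sum>i\<in>UNIV. F' h $ i $ p i * (\<Prod>j\<in>UNIV - {i}. F x $ j $ p j)))) (at x within S)"
    by (intro has_derivative_sum has_derivative_mult_right has_derivative_prod F)
  moreover have "(\<Sum>p | p permutes UNIV. of_int (sign p) *
         (\<Sum>i\<in>UNIV. F' h $ i $ p i * (\<Prod>j\<in>UNIV - {i}. F x $ j $ p j)))
      = (\<Sum>r\<in>UNIV. det (\<chi> i. if i = r then F' h $ r else F x $ i))" for h
    unfolding det_replace_row by (subst sum.swap) (simp add: sum_distrib_left)
  ultimately show ?thesis by (simp add: det_def)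
qed

lemma matrix_inv_mult:
  fixes A :: "('a::field, 'n::finite) sqmat"
  assumes "invertible A"
  shows "A ** matrix_inv A = mat 1" "matrix_inv A ** A = mat 1"
  using someI_ex[OF assms[unfolded invertible_def]] by (simp_all add: matrix_inv_def)

lemma matrix_inv_unique:
  fixes A B :: "('a::field, 'n::finite) sqmat"
  assumes "A ** B = mat 1"
  shows "matrix_inv A = B"
proof -
  have "invertible A" using assms by (auto simp: invertible_right_inverse)
  then have "matrix_inv A ** (A ** B) = B" by (simp add: matrix_mul_assoc matrix_inv_mult)
  then show ?thesis using assms by simp
qed

lemma matrix_inv_transpose:
  fixes A :: "('a::field, 'n::finite) sqmat"
  assumes "invertible A"
  shows "matrix_inv (transpose A) = transpose (matrix_inv A)"
  by (rule matrix_inv_unique)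
    (simp add: matrix_transpose_mul[symmetric] matrix_inv_mult[OF assms] transpose_mat)

text \<open>\<open>matrix_inv\<close> is defined by choice; Cramer's rule exhibits its entries as
  quotients of polynomials in the entries of \<open>A\<close>, from which differentiability can be
  read off.\<close>

lemma matrix_inv_cramer:
  fixes A :: "('a::field, 'n::finite) sqmat"
  assumes "det A \<noteq> 0"
  shows "matrix_inv A $ k $ l =
    det (\<chi> i j. if j = k then (if i = l then 1 else 0) else A $ i $ j) / det A"
proof -
  have inv: "invertible A" using assms by (simp add: invertible_det_nz)
  have "A *v (matrix_inv A *v axis l 1) = axis l 1"
    by (simp add: matrix_vector_mul_assoc matrix_inv_mult[OF inv])
  then have "matrix_inv A *v axis l 1 =
      (\<chi> k. det (\<chi> i j. if j = k then axis l 1 $ i else A $ i $ j) / det A)"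
    using cramer[OF assms] by blast
  moreover have "(matrix_inv A *v axis l 1) $ k = matrix_inv A $ k $ l"
    by (simp add: matrix_vector_mult_def axis_def if_distrib[of "(*) _"] cong: if_cong)
  moreover have "axis l 1 $ i = (if i = l then 1 else 0 :: 'a)" for i
    by (simp add: axis_def)
  ultimately show ?thesis by (simp cong: if_cong)
qed

lemma matrix_eq_sandwich:
  fixes A :: "('a::field, 'n::finite) sqmat"
  assumes "invertible A" "A ** X = Y"
  shows "X = matrix_inv A ** Y"
proof -
  have "matrix_inv A ** (A ** X) = X"
    unfolding matrix_mul_assoc matrix_inv_mult(2)[OF assms(1)] by (rule matrix_mul_lid)
  then show ?thesis using assms(2) by (simp only:)
qed

text \<open>Cramer's rule yields only that some derivative exists. Its value follows by
  differentiating \<open>J ** matrix_inv J = mat 1\<close>.\<close>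

lemma has_derivative_matrix_inv:
  fixes J :: "'a::real_normed_vector \<Rightarrow> (complex, 'n::finite) sqmat"
  assumes J: "(J has_derivative J') (at x)" and inv: "invertible (J x)"
  shows "((\<lambda>x. matrix_inv (J x)) has_derivative
      (\<lambda>h. - (matrix_inv (J x) ** J' h ** matrix_inv (J x)))) (at x)"
proof -
  have nz: "det (J x) \<noteq> 0" using inv by (simp add: invertible_det_nz)
  have ddet: "((\<lambda>x. det (J x)) has_derivative
      (\<lambda>h. \<Sum>r\<in>UNIV. det (\<chi> i. if i = r then J' h $ r else J x $ i))) (at x)"
    by (rule has_derivative_det[OF J])
  have "isCont (\<lambda>x. det (J x)) x"
    using has_derivative_continuous[OF ddet] .
  then have ev: "\<forall>\<^sub>F y in at x. det (J y) \<noteq> 0"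
    using nz unfolding isCont_def by (rule tendsto_imp_eventually_ne)
  have "\<exists>D. ((\<lambda>y. matrix_inv (J y) $ k $ l) has_derivative D) (at x)" for k l
  proof -
    define B where "B = (\<lambda>y. (\<chi> i j. if j = k then (if i = l then 1 else 0) else J y $ i $ j))"
    have "(B has_derivative (\<lambda>h. \<chi> i j. if j = k then 0 else J' h $ i $ j)) (at x)"
      unfolding has_derivative_mat_iff
    proof (intro allI)
      fix i j
      show "((\<lambda>y. B y $ i $ j) has_derivative
          (\<lambda>h. (\<chi> i j. if j = k then 0 else J' h $ i $ j) $ i $ j)) (at x)"
        using J by (cases "j = k") (auto simp: B_def has_derivative_mat_iff)
    qed
    then obtain E where E: "((\<lambda>y. det (B y)) has_derivative E) (at x)"
      using has_derivative_det by blast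
    note q = has_derivative_divide'[OF E ddet nz]
    have "\<forall>\<^sub>F y in at x. det (B y) / det (J y) = matrix_inv (J y) $ k $ l"
      using ev by eventually_elim (simp add: matrix_inv_cramer B_def)
    from has_derivative_transform_eventually[OF q this] show ?thesis
      using nz by (auto simp: matrix_inv_cramer B_def)
  qed
  then obtain D where D: "\<And>k l. ((\<lambda>y. matrix_inv (J y) $ k $ l) has_derivative D k l) (at x)"
    by metis
  define L where "L = (\<lambda>h. \<chi> k l. D k l h)"
  have L: "((\<lambda>y. matrix_inv (J y)) has_derivative L) (at x)"
    using D by (auto simp: has_derivative_mat_iff L_def)
  have "((\<lambda>y. J y ** matrix_inv (J y)) has_derivative
      (\<lambda>h. J x ** L h + J' h ** matrix_inv (J x))) (at x)"
    by (rule has_derivative_mat_mult[OF J L])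
  then have "((\<lambda>y. mat 1 :: (complex, 'n) sqmat) has_derivative
      (\<lambda>h. J x ** L h + J' h ** matrix_inv (J x))) (at x)"
    by (rule has_derivative_transform_eventually)
      (use ev in \<open>auto elim!: eventually_mono simp: matrix_inv_mult(1) matrix_inv_mult(1)[OF inv] invertible_det_nz\<close>)
  then have "(\<lambda>h. J x ** L h + J' h ** matrix_inv (J x)) = (\<lambda>h. 0)"
    by (rule has_derivative_unique[OF _ has_derivative_const])
  then have eq: "J x ** L h + J' h ** matrix_inv (J x) = 0" for h
    by (rule fun_cong)
  have "J x ** L h = - (J' h ** matrix_inv (J x))" for h
    using eq[of h] by (simp only: eq_neg_iff_add_eq_0)
  then have "L h = matrix_inv (J x) ** - (J' h ** matrix_inv (J x))" for h
    by (rule matrix_eq_sandwich[OF inv])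
  then have "L = (\<lambda>h. - (matrix_inv (J x) ** J' h ** matrix_inv (J x)))"
    by (simp add: fun_eq_iff matrix_minus_right matrix_mul_assoc)
  then show ?thesis using L by (simp only:)
qed

section \<open>The action on the half space\<close>

definition imat :: "(complex, 'n::finite) sqmat \<Rightarrow> (real, 'n) sqmat" where
  "imat Z = (\<chi> i j. Im (Z $ i $ j))"

definition mcnj :: "(complex, 'n::finite) sqmat \<Rightarrow> (complex, 'n) sqmat" where
  "mcnj Z = (\<chi> i j. cnj (Z $ i $ j))"

definition vcnj :: "complex ^ 'n::finite \<Rightarrow> complex ^ 'n" where
  "vcnj v = (\<chi> i. cnj (v $ i))"

text \<open>Bilinear, without conjugation: \<open>vcnj\<close> is written out wherever a hermitian
  form is meant.\<close>

definition cdot :: "complex ^ 'n::finite \<Rightarrow> complex ^ 'n \<Rightarrow> complex" where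
  "cdot v w = (\<Sum>i\<in>UNIV. v $ i * w $ i)"

definition numer :: "(int, 'n::finite + 'n) sqmat \<Rightarrow> (complex, 'n) sqmat \<Rightarrow> (complex, 'n) sqmat" where
  "numer \<gamma> Z = blkA \<gamma> ** Z + blkB \<gamma>"

lemma siegel_iff:
  "Z \<in> siegel \<longleftrightarrow> transpose Z = Z \<and> (\<forall>v. v \<noteq> 0 \<longrightarrow> 0 < v \<bullet> (imat Z *v v))"
  by (simp add: siegel_def imat_def)

lemma siegel_sym: "Z \<in> siegel \<Longrightarrow> Z $ i $ j = Z $ j $ i"
  unfolding siegel_iff by (metis transpose_def vec_lambda_beta)

lemma cdot_transpose: "cdot v (transpose M *v w) = cdot (M *v v) w"
  by (simp add: cdot_def matrix_vector_mult_def transpose_def sum_distrib_left sum_distrib_right mult_ac)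
    (rule sum.swap)

lemma vcnj_mult: "vcnj (M *v v) = mcnj M *v vcnj v"
  by (simp add: vcnj_def mcnj_def matrix_vector_mult_def vec_eq_iff)

lemma mcnj_mult: "mcnj (A ** B) = mcnj A ** mcnj B"
  by (simp add: mcnj_def matrix_matrix_mult_def vec_eq_iff)

lemma mcnj_add: "mcnj (A + B) = mcnj A + mcnj B"
  by (simp add: mcnj_def vec_eq_iff)

lemma mcnj_transpose: "mcnj (transpose A) = transpose (mcnj A)"
  by (simp add: mcnj_def transpose_def vec_eq_iff)

lemma mcnj_blk [simp]: "mcnj (blkA \<gamma>) = blkA \<gamma>" "mcnj (blkB \<gamma>) = blkB \<gamma>"
    "mcnj (blkC \<gamma>) = blkC \<gamma>" "mcnj (blkD \<gamma>) = blkD \<gamma>"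
  by (simp_all add: mcnj_def blkA_def blkB_def blkC_def blkD_def vec_eq_iff)

lemma cdot_diff_right: "cdot v ((A - B) *v w) = cdot v (A *v w) - cdot v (B *v w)"
  by (simp add: cdot_def matrix_vector_mult_def algebra_simps sum_subtractf)

text \<open>With \<open>v = a + i b\<close> and \<open>Y = imat Z\<close>, the imaginary part is
  twice \<open>a^t Y a + b^t Y b\<close>.\<close>

lemma cdot_mcnj_imat:
  fixes v :: "complex ^ 'n::finite"
  assumes "Z \<in> siegel" "v \<noteq> 0"
  shows "0 < Im (cdot (vcnj v) ((Z - mcnj Z) *v v))"
proof -
  define a b where "a = (\<chi> i. Re (v $ i))" and "b = (\<chi> i. Im (v $ i))"
  have "cdot (vcnj v) ((Z - mcnj Z) *v v) =
      2 * \<i> * (\<Sum>i\<in>UNIV. \<Sum>j\<in>UNIV. of_real (Im (Z $ i $ j)) * (cnj (v $ i) * v $ j))"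
    by (simp add: cdot_def vcnj_def mcnj_def matrix_vector_mult_def sum_distrib_left
        complex_diff_cnj mult_ac)
  moreover have "Re (\<Sum>i\<in>UNIV. \<Sum>j\<in>UNIV. of_real (Im (Z $ i $ j)) * (cnj (v $ i) * v $ j))
      = a \<bullet> (imat Z *v a) + b \<bullet> (imat Z *v b)"
    by (simp add: inner_vec_def matrix_vector_mult_def imat_def a_def b_def
        sum_distrib_left algebra_simps sum.distrib)
  moreover have "0 < a \<bullet> (imat Z *v a) + b \<bullet> (imat Z *v b)"
  proof -
    have pos: "0 < u \<bullet> (imat Z *v u)" if "u \<noteq> 0" for u
      using assms(1) that by (simp add: siegel_iff)
    have "a \<noteq> 0 \<or> b \<noteq> 0" using assms(2) by (auto simp: a_def b_def vec_eq_iff complex_eq_iff)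
    moreover have "0 \<le> u \<bullet> (imat Z *v u)" for u using pos[of u] by (cases "u = 0") auto
    ultimately show ?thesis using pos add_pos_nonneg add_nonneg_pos by blast
  qed
  ultimately show ?thesis by simp
qed

lemma Sp_iff:
  "\<gamma> \<in> Sp \<longleftrightarrow> (\<forall>x y. (\<Sum>i\<in>UNIV. \<gamma> $ Inl i $ x * \<gamma> $ Inr i $ y) -
      (\<Sum>i\<in>UNIV. \<gamma> $ Inr i $ x * \<gamma> $ Inl i $ y) = sympl_J $ x $ y)"
proof -
  have "(transpose \<gamma> ** sympl_J ** \<gamma>) $ x $ y =
      (\<Sum>i\<in>UNIV. \<gamma> $ Inl i $ x * \<gamma> $ Inr i $ y) - (\<Sum>i\<in>UNIV. \<gamma> $ Inr i $ x * \<gamma> $ Inl i $ y)" for x y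
  proof -
    have "(transpose \<gamma> ** sympl_J ** \<gamma>) $ x $ y =
        (\<Sum>b\<in>UNIV. (\<Sum>a\<in>UNIV. \<gamma> $ a $ x * sympl_J $ a $ b) * \<gamma> $ b $ y)"
      by (simp add: matrix_matrix_mult_def transpose_def)
    also have "\<dots> = (\<Sum>i\<in>UNIV. \<gamma> $ Inl i $ x * \<gamma> $ Inr i $ y) - (\<Sum>i\<in>UNIV. \<gamma> $ Inr i $ x * \<gamma> $ Inl i $ y)"
      by (simp add: UNIV_Plus_UNIV[symmetric] sum.Plus sympl_J_def if_distrib[of "(*) _"] sum_negf
          del: UNIV_Plus_UNIV cong: if_cong)
    finally show ?thesis .
  qed
  then show ?thesis by (simp add: Sp_def vec_eq_iff)
qed

lemma Sp_blocks:
  assumes "\<gamma> \<in> Sp"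
  shows "transpose (blkC \<gamma>) ** blkA \<gamma> = transpose (blkA \<gamma>) ** blkC \<gamma>"
    and "transpose (blkD \<gamma>) ** blkB \<gamma> = transpose (blkB \<gamma>) ** blkD \<gamma>"
    and "transpose (blkD \<gamma>) ** blkA \<gamma> = transpose (blkB \<gamma>) ** blkC \<gamma> + mat 1"
    and "transpose (blkC \<gamma>) ** blkB \<gamma> = transpose (blkA \<gamma>) ** blkD \<gamma> - mat 1"
proof -
  have *: "(\<Sum>i\<in>UNIV. complex_of_int (\<gamma> $ Inl i $ x) * of_int (\<gamma> $ Inr i $ y)) -
      (\<Sum>i\<in>UNIV. of_int (\<gamma> $ Inr i $ x) * of_int (\<gamma> $ Inl i $ y)) = of_int (sympl_J $ x $ y)" for x y
    using assms[unfolded Sp_iff, rule_format, of x y, symmetric] by simp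
  note defs = vec_eq_iff matrix_matrix_mult_def transpose_def blkA_def blkB_def blkC_def blkD_def mat_def
  show "transpose (blkC \<gamma>) ** blkA \<gamma> = transpose (blkA \<gamma>) ** blkC \<gamma>"
    using *[of "Inl _" "Inl _"] by (simp add: defs sympl_J_def)
  show "transpose (blkD \<gamma>) ** blkB \<gamma> = transpose (blkB \<gamma>) ** blkD \<gamma>"
    using *[of "Inr _" "Inr _"] by (simp add: defs sympl_J_def)
  show "transpose (blkD \<gamma>) ** blkA \<gamma> = transpose (blkB \<gamma>) ** blkC \<gamma> + mat 1"
    using *[of "Inr _" "Inl _"] by (simp add: defs sympl_J_def algebra_simps split: if_splits)
      
  show "transpose (blkC \<gamma>) ** blkB \<gamma> = transpose (blkA \<gamma>) ** blkD \<gamma> - mat 1"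
    using *[of "Inl _" "Inr _"] by (simp add: defs sympl_J_def algebra_simps split: if_splits)
qed

text \<open>Polarised in \<open>Z\<close> and \<open>W\<close>: equal arguments give the symmetry of
  \<open>act \<gamma> Z\<close>, and the conjugate of \<open>Z\<close> as first argument gives the
  hermitian identity behind positivity.\<close>

lemma Sp_numer_cocycle:
  assumes "\<gamma> \<in> Sp"
  shows "transpose (cocycle \<gamma> Z) ** numer \<gamma> W - transpose (numer \<gamma> Z) ** cocycle \<gamma> W = W - transpose Z"
proof -
  note r = Sp_blocks[OF assms]
  have 1: "M ** transpose (blkC \<gamma>) ** blkA \<gamma> = M ** transpose (blkA \<gamma>) ** blkC \<gamma>"
    and 2: "M ** transpose (blkC \<gamma>) ** blkB \<gamma> = M ** transpose (blkA \<gamma>) ** blkD \<gamma> - M" for M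
    using r(1,4) by (simp_all add: matrix_mul_assoc[symmetric] matrix_diff_ldistrib)
  show ?thesis
    by (simp add: cocycle_def numer_def mat_ring transpose_add matrix_transpose_mul r 1 2)
qed

lemma act_numer: "act \<gamma> Z = numer \<gamma> Z ** matrix_inv (cocycle \<gamma> Z)"
  by (simp add: act_def numer_def)

lemma mcnj_cocycle: "mcnj (cocycle \<gamma> Z) = cocycle \<gamma> (mcnj Z)"
  and mcnj_numer: "mcnj (numer \<gamma> Z) = numer \<gamma> (mcnj Z)"
  by (simp_all add: cocycle_def numer_def mcnj_add mcnj_mult)

lemma hermitian_numer_cocycle:
  assumes "\<gamma> \<in> Sp" "Z \<in> siegel"
  shows "transpose (mcnj (cocycle \<gamma> Z)) ** numer \<gamma> Z - transpose (mcnj (numer \<gamma> Z)) ** cocycle \<gamma> Z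
    = Z - mcnj Z"
proof -
  have "transpose (mcnj Z) = mcnj Z"
    using assms(2) by (metis mcnj_transpose siegel_iff)
  then show ?thesis
    unfolding mcnj_cocycle mcnj_numer Sp_numer_cocycle[OF assms(1)] by simp
qed

text \<open>On a kernel vector of \<open>C Z + D\<close> the hermitian identity makes the form of
  \<open>Z - mcnj Z\<close> vanish, against \<open>cdot_mcnj_imat\<close>.\<close>

lemma invertible_cocycle:
  assumes "\<gamma> \<in> Sp" "Z \<in> siegel"
  shows "invertible (cocycle \<gamma> Z)"
proof -
  let ?P = "numer \<gamma> Z" and ?Q = "cocycle \<gamma> Z"
  have "v = 0" if v: "?Q *v v = 0" for v
  proof (rule ccontr)
    assume "v \<noteq> 0"
    have "cdot (vcnj v) ((Z - mcnj Z) *v v) =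
        cdot (mcnj ?Q *v vcnj v) (?P *v v) - cdot (mcnj ?P *v vcnj v) (?Q *v v)"
      unfolding hermitian_numer_cocycle[OF assms, symmetric] cdot_diff_right
        matrix_vector_mul_assoc[symmetric] cdot_transpose ..
    also have "\<dots> = cdot (vcnj (?Q *v v)) (?P *v v) - cdot (mcnj ?P *v vcnj v) (?Q *v v)"
      by (simp add: vcnj_mult)
    also have "\<dots> = 0" unfolding v by (simp add: cdot_def vcnj_def)
    finally show False using cdot_mcnj_imat[OF assms(2) \<open>v \<noteq> 0\<close>] by simp
  qed
  then show ?thesis
    unfolding invertible_left_inverse matrix_left_invertible_ker by blast
qed

lemma act_sym:
  assumes "\<gamma> \<in> Sp" "Z \<in> siegel"
  shows "transpose (act \<gamma> Z) = act \<gamma> Z"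
proof -
  let ?P = "numer \<gamma> Z" and ?Q = "cocycle \<gamma> Z"
  note inv = matrix_inv_mult[OF invertible_cocycle[OF assms]]
  have "transpose ?Q ** ?P = transpose ?P ** ?Q"
    using Sp_numer_cocycle[OF assms(1), of Z Z] assms(2) by (simp add: siegel_iff)
  then have "transpose (matrix_inv ?Q) ** (transpose ?Q ** ?P) ** matrix_inv ?Q
      = transpose (matrix_inv ?Q) ** (transpose ?P ** ?Q) ** matrix_inv ?Q" by simp
  moreover have "transpose (matrix_inv ?Q) ** transpose ?Q = mat 1"
    by (simp add: matrix_transpose_mul[symmetric] inv transpose_mat)
  ultimately have "?P ** matrix_inv ?Q = transpose (matrix_inv ?Q) ** transpose ?P"
    by (metis inv(1) matrix_mul_assoc matrix_mul_lid matrix_mul_rid)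
  then show ?thesis by (simp add: act_numer matrix_transpose_mul)
qed

text \<open>With \<open>W\<close> the image point and \<open>J = C Z + D\<close>, the form of
  \<open>Z - mcnj Z\<close> at \<open>w\<close> is that of \<open>W - mcnj W\<close> at
  \<open>J w\<close>. As \<open>J\<close> is invertible, every real vector is some
  \<open>J w\<close>, so positivity passes to \<open>W\<close>.\<close>

lemma act_siegel:
  assumes "\<gamma> \<in> Sp" "Z \<in> siegel"
  shows "act \<gamma> Z \<in> siegel"
proof -
  let ?P = "numer \<gamma> Z" and ?Q = "cocycle \<gamma> Z" and ?W = "act \<gamma> Z"
  note inv = matrix_inv_mult[OF invertible_cocycle[OF assms]]
  have WQ: "?W ** ?Q = ?P" by (simp add: act_numer matrix_mul_assoc[symmetric] inv)
  have "transpose (mcnj ?Q) ** mcnj ?W = transpose (mcnj ?P)"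
    using WQ act_sym[OF assms] by (metis matrix_transpose_mul mcnj_mult mcnj_transpose)
  then have herm: "transpose (mcnj ?Q) ** (?W - mcnj ?W) ** ?Q = Z - mcnj Z"
    using hermitian_numer_cocycle[OF assms]
    by (simp add: mat_ring) (simp add: matrix_mul_assoc[symmetric] WQ)
  have pos: "0 < v \<bullet> (imat ?W *v v)" if v: "v \<noteq> 0" for v
  proof -
    define vc where "vc = (\<chi> i. complex_of_real (v $ i))"
    define w where "w = matrix_inv ?Q *v vc"
    have Qw: "?Q *v w = vc" by (simp add: w_def matrix_vector_mul_assoc inv)
    have "vc \<noteq> 0" using v by (auto simp: vc_def vec_eq_iff)
    then have "w \<noteq> 0" using Qw by auto
    have "vcnj vc = vc" by (simp add: vc_def vcnj_def)
    define q where "q = (\<lambda>w. cdot (vcnj w) ((Z - mcnj Z) *v w))"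
    have "q w = cdot (mcnj ?Q *v vcnj w) ((?W - mcnj ?W) *v (?Q *v w))"
      unfolding q_def herm[symmetric]
      unfolding matrix_vector_mul_assoc[symmetric] cdot_transpose ..
    also have "\<dots> = cdot vc ((?W - mcnj ?W) *v vc)"
      using Qw \<open>vcnj vc = vc\<close> by (simp add: vcnj_mult[symmetric])
    also have "\<dots> = 2 * \<i> * of_real (v \<bullet> (imat ?W *v v))"
      by (simp add: cdot_def vc_def mcnj_def matrix_vector_mult_def sum_distrib_left inner_vec_def
          imat_def complex_diff_cnj mult_ac)
    finally have "q w = 2 * \<i> * of_real (v \<bullet> (imat ?W *v v))" .
    moreover have "Im (q w) > 0"
      unfolding q_def by (rule cdot_mcnj_imat[OF assms(2) \<open>w \<noteq> 0\<close>])
    ultimately show ?thesis by simp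
  qed
  then show ?thesis using act_sym[OF assms] by (simp add: siegel_iff)
qed

section \<open>Holomorphic functions on the half space\<close>

lemma idx_eq_iff: "idx i j = idx k l \<longleftrightarrow> (i = k \<and> j = l) \<or> (i = l \<and> j = k)"
  by (auto simp: idx_def Abs_idx_inject min_def max_def split: if_splits)

text \<open>An off-diagonal index comes from two ordered pairs, hence the weight 1/2. It is passed
  as a ring element \<open>h\<close> because such sums occur over the complex numbers and in the
  algebra of forms.\<close>

lemma sum_idx:
  fixes g :: "'n::{finite,linorder} idx \<Rightarrow> 'a::comm_ring_1"
  assumes h: "h + h = 1"
  shows "(\<Sum>i\<in>UNIV. \<Sum>j\<in>UNIV. (if i = j then 1 else h) * g (idx i j)) = (\<Sum>I\<in>UNIV. g I)"
proof -
  define w :: "'n \<times> 'n \<Rightarrow> 'a" where "w = (\<lambda>(i, j). if i = j then 1 else h)"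
  have "(\<Sum>i\<in>UNIV. \<Sum>j\<in>UNIV. (if i = j then 1 else h) * g (idx i j))
      = (\<Sum>p\<in>UNIV. w p * g (case_prod idx p))"
    by (simp add: sum.cartesian_product w_def case_prod_beta' flip: UNIV_Times_UNIV)
  also have "\<dots> = (\<Sum>I\<in>UNIV. \<Sum>p | case_prod idx p = I. w p * g (case_prod idx p))"
    using sum.group[of "UNIV :: ('n \<times> 'n) set" "UNIV :: 'n idx set" "case_prod idx"
        "\<lambda>p. w p * g (case_prod idx p)"] by simp
  also have "\<dots> = (\<Sum>I\<in>UNIV. g I)"
  proof (rule sum.cong)
    fix I :: "'n idx"
    obtain a b where I: "I = idx a b" using idx_Rep by metis
    have fib: "{p. case_prod idx p = I} = {(a, b), (b, a)}"
      by (auto simp: I idx_eq_iff)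
    show "(\<Sum>p | case_prod idx p = I. w p * g (case_prod idx p)) = g I"
    proof (cases "a = b")
      case True
      then show ?thesis unfolding fib by (simp add: w_def I)
    next
      case False
      then have "(\<Sum>p | case_prod idx p = I. w p * g (case_prod idx p)) = (h + h) * g I"
        unfolding fib by (simp add: w_def I idx_sym[of b a] algebra_simps)
      then show ?thesis using h by simp
    qed
  qed simp
  finally show ?thesis .
qed

lemma symm_nth: "symm z $ i $ j = z $ idx i j"
  by (simp add: symm_def)

lemma symm_sym [simp]: "transpose (symm z) = symm z"
  by (simp add: transpose_def symm_def vec_eq_iff idx_sym)

lemma symm_chart: "z \<in> siegel_chart \<Longrightarrow> symm z \<in> siegel"
  by (simp add: siegel_chart_def)

lemma symm_coords_siegel: "Z \<in> siegel \<Longrightarrow> symm (coords Z) = Z"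
  by (simp add: symm_coords siegel_iff)

lemma coords_chart: "Z \<in> siegel \<Longrightarrow> coords Z \<in> siegel_chart"
  by (simp add: siegel_chart_def symm_coords_siegel)

lemma coords_idx: "transpose X = X \<Longrightarrow> coords X $ idx i j = X $ i $ j"
  by (metis symm_coords symm_nth)

lemma has_derivative_symm: "(symm has_derivative symm) (at z within S)"
  unfolding has_derivative_mat_iff symm_nth
  by (intro allI bounded_linear_imp_has_derivative bounded_linear_vec_nth)

lemma has_derivative_coords:
  assumes "(F has_derivative F') (at x within S)"
  shows "((\<lambda>x. coords (F x)) has_derivative (\<lambda>h. coords (F' h))) (at x within S)"
  using assms
  by (simp add: has_derivative_mat_iff has_derivative_vec_iff[of "\<lambda>x. coords (F x)"]) (simp add: coords_def)

lemma fn_eqI: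
  assumes "\<And>Z. Z \<in> siegel \<Longrightarrow> fn f Z = fn g Z"
  shows "f = g"
proof -
  have "fn f Z = fn g Z" for Z
    using assms[of Z] fn[of f] fn[of g] by (cases "Z \<in> siegel") auto
  then show ?thesis by (simp add: fn_inject[symmetric] fun_eq_iff)
qed

lemma fn_simps:
  "fn (f + g) Z = fn f Z + fn g Z" "fn (f - g) Z = fn f Z - fn g Z"
  "fn (f * g) Z = fn f Z * fn g Z" "fn (- f) Z = - fn f Z" "fn 0 Z = 0"
  by (simp_all add: plus_cinf.rep_eq minus_cinf.rep_eq times_cinf.rep_eq uminus_cinf.rep_eq zero_cinf.rep_eq)

lemma fn_consts:
  assumes "Z \<in> siegel"
  shows "fn 1 Z = 1" "fn (cconst c) Z = c" "fn (of_nat k) Z = of_nat k" "fn (of_int m) Z = of_int m"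
proof -
  show 1: "fn 1 Z = 1" using assms by (simp add: one_cinf.rep_eq)
  show "fn (cconst c) Z = c" using assms by (simp add: cconst.rep_eq)
  show nat: "fn (of_nat k) Z = of_nat k" for k by (induction k) (simp_all add: fn_simps 1)
  show "fn (of_int m) Z = of_int m"
    by (cases m rule: int_cases2) (simp_all add: nat fn_simps)
qed

lemma fn_sum: "fn (sum f A) Z = (\<Sum>a\<in>A. fn (f a) Z)"
  by (induction A rule: infinite_finite_induct) (simp_all add: fn_simps)

lemma fn_prod: "Z \<in> siegel \<Longrightarrow> fn (prod f A) Z = (\<Prod>a\<in>A. fn (f a) Z)"
  by (induction A rule: infinite_finite_induct) (simp_all add: fn_simps fn_consts)

lemma fn_det: "Z \<in> siegel \<Longrightarrow> fn (det M) Z = det (mat_at M Z)"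
  by (simp add: det_def fn_sum fn_simps fn_consts fn_prod mat_at_def)

lemma fn_differentiable:
  assumes "z \<in> siegel_chart"
  shows "((\<lambda>z. fn f (symm z)) has_derivative frechet_derivative (\<lambda>z. fn f (symm z)) (at z)) (at z)"
proof -
  have "Ck_on 1 siegel_chart (fn f \<circ> symm)"
    using fn[of f] by (simp add: siegel_smooth_def smooth_on_def del: One_nat_def)
  then show ?thesis
    using assms by (simp add: o_def frechet_derivative_works)
qed

lemma fn_continuous: "continuous_on siegel_chart (\<lambda>z. fn f (symm z))"
proof -
  have "Ck_on 0 siegel_chart (fn f \<circ> symm)"
    using fn[of f] by (simp add: siegel_smooth_def smooth_on_def del: Ck_on.simps)
  then show ?thesis by (simp add: o_def)
qed

lemma fn_pd:
  assumes "z \<in> siegel_chart"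
  shows "fn (pd I f) (symm z) = wirtinger I (\<lambda>z. fn f (symm z)) z"
  using assms by (simp add: pd.rep_eq symm_chart o_def)

lemma wirtinger_eq:
  assumes "(F has_derivative F') (at z)"
  shows "wirtinger I F z = (F' (axis I 1) - \<i> * F' (axis I \<i>)) / 2"
  using frechet_derivative_at[OF assms] by (simp add: wirtinger_def)

lemma axis_smult: "axis I (c * d) = c *s axis I (d::complex)"
  by (simp add: axis_def vec_eq_iff)

lemma wirtinger_holomorphic:
  assumes "(F has_derivative F') (at z)" "\<And>c v. F' (c *s v) = c * F' v"
  shows "wirtinger I F z = F' (axis I 1)"
proof -
  have "F' (axis I \<i>) = \<i> * F' (axis I 1)"
    using assms(2)[of \<i> "axis I 1"] axis_smult[of I \<i> 1] by simp
  then show ?thesis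
    unfolding wirtinger_eq[OF assms(1)] by (simp add: mult.assoc[symmetric])
qed

lemma complex_linear_expand:
  fixes F' :: "complex ^ 'm::finite \<Rightarrow> complex"
  assumes "linear F'" "\<And>c v. F' (c *s v) = c * F' v"
  shows "F' v = (\<Sum>I\<in>UNIV. v $ I * F' (axis I 1))"
proof -
  have "v = (\<Sum>I\<in>UNIV. v $ I *s axis I 1)"
    by (simp add: vec_eq_iff axis_def if_distrib[of "(*) _"] cong: if_cong)
  then have "F' v = F' (\<Sum>I\<in>UNIV. v $ I *s axis I 1)" by simp
  then show ?thesis by (simp add: linear_sum[OF assms(1)] assms(2))
qed

lemma holomorphic_has_derivative:
  assumes "siegel_holomorphic f" "z \<in> siegel_chart"
  shows "((\<lambda>z. fn f (symm z)) has_derivative (\<lambda>v. \<Sum>I\<in>UNIV. v $ I * fn (pd I f) (symm z))) (at z)"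
proof -
  obtain F' where F': "((\<lambda>z. fn f (symm z)) has_derivative F') (at z)" "\<And>c v. F' (c *s v) = c * F' v"
    using assms by (auto simp: siegel_holomorphic_def o_def)
  have "F' v = (\<Sum>I\<in>UNIV. v $ I * fn (pd I f) (symm z))" for v
    unfolding fn_pd[OF assms(2)] wirtinger_holomorphic[OF F']
    by (rule complex_linear_expand[OF has_derivative_linear[OF F'(1)] F'(2)])
  then have "F' = (\<lambda>v. \<Sum>I\<in>UNIV. v $ I * fn (pd I f) (symm z))" by blast
  then show ?thesis using F'(1) by simp
qed

lemma siegel_holomorphicI:
  assumes "\<And>z. z \<in> siegel_chart \<Longrightarrow> ((\<lambda>z. fn f (symm z)) has_derivative F' z) (at z)"
    "\<And>z c v. z \<in> siegel_chart \<Longrightarrow> F' z (c *s v) = c * F' z v"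
  shows "siegel_holomorphic f"
  unfolding siegel_holomorphic_def o_def using assms by blast

lemma siegel_holomorphic_add:
  assumes "siegel_holomorphic f" "siegel_holomorphic g"
  shows "siegel_holomorphic (f + g)"
  by (rule siegel_holomorphicI, unfold fn_simps,
      rule has_derivative_add[OF assms[THEN holomorphic_has_derivative]])
    (simp_all add: sum_distrib_left algebra_simps)

lemma siegel_holomorphic_mult:
  assumes "siegel_holomorphic f" "siegel_holomorphic g"
  shows "siegel_holomorphic (f * g)"
  by (rule siegel_holomorphicI, unfold fn_simps,
      rule has_derivative_mult[OF assms[THEN holomorphic_has_derivative]])
    (simp_all add: sum_distrib_left algebra_simps)

lemma siegel_holomorphic_cconst: "siegel_holomorphic (cconst c)"
proof (rule siegel_holomorphicI)
  fix z :: "complex ^ 'a idx" assume z: "z \<in> siegel_chart"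
  show "((\<lambda>z. fn (cconst c) (symm z)) has_derivative (\<lambda>_. 0)) (at z)"
    by (rule has_derivative_transform_within_open[OF has_derivative_const[of c] open_siegel_chart z])
      (simp add: fn_consts symm_chart)
qed simp

lemma cconst_of_int: "of_int m = cconst (of_int m)" 
  by (rule fn_eqI) (simp add: fn_consts)

lemma cconst_1: "1 = cconst 1" 
  by (rule fn_eqI) (simp add: fn_consts)

lemma cconst_0: "0 = cconst 0" 
  by (rule fn_eqI) (simp add: fn_consts fn_simps)

lemma siegel_holomorphic_uminus: 
  assumes "siegel_holomorphic f" shows "siegel_holomorphic (- f)"
proof -
  have "- f = cconst (- 1) * f" by (rule fn_eqI) (simp add: fn_consts fn_simps)
  then show ?thesis using assms siegel_holomorphic_mult siegel_holomorphic_cconst by metis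
qed

lemma siegel_holomorphic_diff:
  assumes "siegel_holomorphic f" "siegel_holomorphic g"
  shows "siegel_holomorphic (f - g)"
  using siegel_holomorphic_add[OF assms(1) siegel_holomorphic_uminus[OF assms(2)]] by simp

lemma siegel_holomorphic_sum: 
  "(\<And>a. a \<in> A \<Longrightarrow> siegel_holomorphic (f a)) \<Longrightarrow> siegel_holomorphic (sum f A)"
  by (induction A rule: infinite_finite_induct)
    (simp_all add: siegel_holomorphic_add cconst_0 siegel_holomorphic_cconst)

lemma siegel_holomorphic_prod: 
  "(\<And>a. a \<in> A \<Longrightarrow> siegel_holomorphic (f a)) \<Longrightarrow> siegel_holomorphic (prod f A)"
  by (induction A rule: infinite_finite_induct)
    (simp_all add: siegel_holomorphic_mult cconst_1 siegel_holomorphic_cconst)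

lemma siegel_holomorphic_det:
  "(\<And>i j. siegel_holomorphic (M $ i $ j)) \<Longrightarrow> siegel_holomorphic (det M)"
  unfolding det_def cconst_of_int
  by (intro siegel_holomorphic_sum siegel_holomorphic_mult siegel_holomorphic_prod siegel_holomorphic_cconst)

section \<open>Partial derivatives of holomorphic functions are holomorphic\<close>

lemma norm_smult: "norm (c *s v) = cmod c * norm (v :: complex ^ 'm::finite)"
  by (simp add: norm_vec_def norm_mult L2_set_right_distrib)

lemma has_derivative_smult_left: "((\<lambda>t. z + t *s w) has_derivative (\<lambda>t. t *s w)) (at t)"
  for w :: "complex ^ 'm::finite"
  by (auto simp: has_derivative_vec_iff intro!: derivative_eq_intros)

text \<open>\<open>t \<mapsto> G (z + t w)\<close> is a locally uniform limit of difference quotients of \<open>F\<close>, hence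
  holomorphic.\<close>

lemma directional_derivative_complex_linear:
  fixes F G :: "complex ^ 'm::finite \<Rightarrow> complex"
  assumes S: "open S" "z \<in> S"
    and F: "\<And>x. x \<in> S \<Longrightarrow> (F has_derivative F' x) (at x)"
    and lin: "\<And>x c v. x \<in> S \<Longrightarrow> F' x (c *s v) = c * F' x v"
    and G: "\<And>x. x \<in> S \<Longrightarrow> G x = F' x e" "continuous_on S G"
    and G': "(G has_derivative G') (at z)"
  shows "G' (c *s w) = c * G' w"
proof -
  obtain r where r: "r > 0" "cball z r \<subseteq> S" using S open_contains_cball by blast
  \<comment> \<open>Keeps \<open>z + t w + s e\<close> in the ball of radius \<open>r\<close> for
    \<open>|t|, |s| \<le> d\<close>; the summand 1 keeps the quotient meaningful when
    \<open>w\<close> and \<open>e\<close> vanish.\<close>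
  define d where "d = r / (norm w + norm e + 1)"
  have pos: "0 < norm w + norm e + 1" by (smt (verit) norm_ge_zero)
  have d: "d > 0" using r(1) pos by (simp add: d_def)
  have in_ball: "z + t *s w + s *s e \<in> cball z r" if "cmod t \<le> d" "cmod s \<le> d" for t s
  proof -
    have "norm (t *s w + s *s e) \<le> d * norm w + d * norm e"
      using norm_triangle_ineq[of "t *s w" "s *s e"]
        mult_right_mono[OF that(1) norm_ge_zero[of w]] mult_right_mono[OF that(2) norm_ge_zero[of e]]
      by (simp add: norm_smult)
    also have "\<dots> \<le> d * (norm w + norm e + 1)" using d by (simp add: algebra_simps)
    also have "\<dots> = r" using pos by (simp add: d_def)
    finally show ?thesis
      unfolding mem_cball dist_norm norm_minus_commute[of z] by (simp add: add.assoc)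
  qed
  define h where "h = (\<lambda>n::nat. d / of_nat (Suc n))"
  have h: "0 < h n" "h n \<le> d" for n using d by (simp_all add: h_def divide_simps)
  define q where "q = (\<lambda>n t. (F (z + t *s w + complex_of_real (h n) *s e) - F (z + t *s w)) / h n)"
  have cd: "\<exists>D. ((\<lambda>t. F (y + t *s w)) has_field_derivative D) (at t)" if "y + t *s w \<in> S" for y t
  proof -
    have "((\<lambda>t. F (y + t *s w)) has_derivative (\<lambda>s. F' (y + t *s w) (s *s w))) (at t)"
      by (rule has_derivative_compose[OF has_derivative_smult_left F[OF that]])
    then have "((\<lambda>t. F (y + t *s w)) has_derivative (*) (F' (y + t *s w) w)) (at t)"
      by (rule has_derivative_eq_rhs) (simp add: fun_eq_iff lin[OF that])
    then show ?thesis by (auto simp: has_field_derivative_def)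
  qed
  have holq: "q n holomorphic_on ball 0 d" for n
    unfolding q_def
  proof (intro holomorphic_on_divide holomorphic_on_diff holomorphic_on_const)
    show "(\<lambda>t. F (z + t *s w + complex_of_real (h n) *s e)) holomorphic_on ball 0 d"
    proof (rule holomorphic_onI, rule field_differentiable_at_within)
      fix t :: complex assume t: "t \<in> ball 0 d"
      have "z + complex_of_real (h n) *s e + t *s w \<in> S"
        using in_ball[of t "h n"] h[of n] r(2) t by (auto simp: add_ac)
      from cd[OF this] show "(\<lambda>t. F (z + t *s w + complex_of_real (h n) *s e)) field_differentiable at t"
        by (auto simp: field_differentiable_def add_ac)
    qed
    show "(\<lambda>t. F (z + t *s w)) holomorphic_on ball 0 d"
    proof (rule holomorphic_onI, rule field_differentiable_at_within)
      fix t :: complex assume t: "t \<in> ball 0 d"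
      have "z + t *s w \<in> S"
        using in_ball[of t 0] r(2) t d by auto
      from cd[OF this] show "(\<lambda>t. F (z + t *s w)) field_differentiable at t"
        by (auto simp: field_differentiable_def)
    qed
  qed (use h(1)[of n] in auto)
  have ul: "uniform_limit (ball 0 d) q (\<lambda>t. G (z + t *s w)) sequentially"
  proof (rule uniform_limitI)
    fix \<epsilon> :: real assume \<epsilon>: "\<epsilon> > 0"
    have "uniformly_continuous_on (cball z r) G"
      by (intro compact_uniformly_continuous continuous_on_subset[OF G(2) r(2)]) simp
    then obtain \<delta> where \<delta>: "\<delta> > 0"
      "\<And>x y. x \<in> cball z r \<Longrightarrow> y \<in> cball z r \<Longrightarrow> dist y x < \<delta> \<Longrightarrow> dist (G y) (G x) < \<epsilon> / 2"
      using \<epsilon> unfolding uniformly_continuous_on_def by (metis half_gt_zero)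
    have "(\<lambda>n. h n * norm e) \<longlonglongrightarrow> 0"
      unfolding h_def by real_asymp
    then have "\<forall>\<^sub>F n in sequentially. h n * norm e < \<delta>"
      using \<delta>(1) order_tendstoD(2) by blast
    then show "\<forall>\<^sub>F n in sequentially. \<forall>t\<in>ball 0 d. dist (q n t) (G (z + t *s w)) < \<epsilon>"
    proof eventually_elim
      case (elim n)
      show ?case
      proof
        fix t :: complex assume t: "t \<in> ball 0 d"
        define x where "x = z + t *s w"
        have x: "x + complex_of_real s *s e \<in> cball z r" if "s \<in> {0..h n}" for s
          unfolding x_def by (rule in_ball) (use t that h[of n] in auto)
        have x0: "x \<in> cball z r" using x[of 0] h(1)[of n] by simp
        \<comment> \<open>The mean value inequality for \<open>F (x + s e) - s G x\<close>: its
          derivative \<open>G (x + s e) - G x\<close> is small by uniform continuity, independently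
          of \<open>t\<close>.\<close>
        have "cmod ((F (x + complex_of_real (h n) *s e) - h n * G x)
            - (F (x + complex_of_real 0 *s e) - complex_of_real 0 * G x)) \<le> \<epsilon> / 2 * norm (h n - 0)"
        proof (rule differentiable_bound[of "{0..h n}" "\<lambda>s. F (x + complex_of_real s *s e) - s * G x"
              "\<lambda>s v. v * G (x + complex_of_real s *s e) - v * G x"])
          fix s assume s: "s \<in> {0..h n}"
          have xs: "x + complex_of_real s *s e \<in> S" using x[OF s] r(2) by blast
          have "((\<lambda>s. x + complex_of_real s *s e) has_derivative (\<lambda>v. complex_of_real v *s e)) (at s within {0..h n})"
            by (auto simp: has_derivative_vec_iff intro!: derivative_eq_intros)
          from has_derivative_compose[OF this F[OF xs]]
          have "((\<lambda>s. F (x + complex_of_real s *s e)) has_derivative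
              (\<lambda>v. v * G (x + complex_of_real s *s e))) (at s within {0..h n})"
            by (simp add: lin[OF xs] G(1)[OF xs])
          then show "((\<lambda>s. F (x + complex_of_real s *s e) - s * G x) has_derivative
              (\<lambda>v. v * G (x + complex_of_real s *s e) - v * G x)) (at s within {0..h n})"
            by (auto intro!: derivative_eq_intros)
          show "onorm (\<lambda>v::real. v * G (x + complex_of_real s *s e) - v * G x) \<le> \<epsilon> / 2"
          proof (rule onorm_bound)
            fix v :: real
            have "dist (x + complex_of_real s *s e) x = s * norm e"
              using s by (simp add: dist_norm norm_smult)
            also have "\<dots> < \<delta>" using s elim mult_right_mono[of s "h n" "norm e"] by simp
            finally have "dist (G (x + complex_of_real s *s e)) (G x) < \<epsilon> / 2"
              using \<delta>(2) x0 x[OF s] by blast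
            then have "norm v * cmod (G (x + complex_of_real s *s e) - G x) \<le> norm v * (\<epsilon> / 2)"
              by (intro mult_left_mono) (simp_all add: dist_norm)
            then show "norm (v * G (x + complex_of_real s *s e) - v * G x) \<le> \<epsilon> / 2 * norm v"
              unfolding right_diff_distrib[symmetric] norm_mult norm_of_real by (simp add: mult.commute)
          qed (use \<epsilon> in simp)
        qed (use h(1)[of n] in auto)
        then have "cmod (F (x + complex_of_real (h n) *s e) - F x - h n * G x) \<le> \<epsilon> / 2 * h n"
          using h(1)[of n] by (simp add: algebra_simps)
        moreover have "q n t - G x = (F (x + complex_of_real (h n) *s e) - F x - h n * G x) / h n"
          using h(1)[of n] by (simp add: q_def x_def field_simps)
        ultimately have "cmod (q n t - G x) \<le> \<epsilon> / 2"
          using h(1)[of n] by (simp add: norm_divide divide_le_eq)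
        then show "dist (q n t) (G (z + t *s w)) < \<epsilon>"
          using \<epsilon> by (simp add: dist_norm x_def)
      qed
    qed
  qed
  have "(\<lambda>t. G (z + t *s w)) holomorphic_on ball 0 d"
  proof (rule holomorphic_uniform_sequence[OF open_ball holq])
    fix x :: complex assume "x \<in> ball 0 d"
    then obtain \<delta> where "\<delta> > 0" "cball x \<delta> \<subseteq> ball 0 d" using open_contains_cball open_ball by blast
    then show "\<exists>\<delta>>0. cball x \<delta> \<subseteq> ball 0 d \<and> uniform_limit (cball x \<delta>) q (\<lambda>t. G (z + t *s w)) sequentially"
      using uniform_limit_on_subset[OF ul] by blast
  qed
  then have "(\<lambda>t. G (z + t *s w)) field_differentiable at 0"
    using d holomorphic_on_imp_differentiable_at[OF _ open_ball] by simp
  then obtain D where "((\<lambda>t. G (z + t *s w)) has_field_derivative D) (at 0)"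
    by (auto simp: field_differentiable_def)
  then have "((\<lambda>t. G (z + t *s w)) has_derivative (*) D) (at 0)"
    by (simp add: has_field_derivative_def)
  moreover have "((\<lambda>t. G (z + t *s w)) has_derivative (\<lambda>t. G' (t *s w))) (at 0)"
    by (rule has_derivative_compose[OF has_derivative_smult_left]) (simp add: G')
  ultimately have "(\<lambda>t. G' (t *s w)) = (*) D" by (rule has_derivative_unique[rotated])
  then have "G' (t *s w) = D * t" for t by (rule fun_cong)
  from this[of c] this[of 1] show ?thesis by simp
qed

text \<open>Real differentiability of \<open>pd I f\<close> is part of its smoothness; what has to
  be shown is that the derivative is complex linear.\<close>

lemma siegel_holomorphic_pd:
  assumes "siegel_holomorphic f"
  shows "siegel_holomorphic (pd I f)"
proof (rule siegel_holomorphicI)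
  show der: "((\<lambda>z. fn (pd I f) (symm z)) has_derivative
      frechet_derivative (\<lambda>z. fn (pd I f) (symm z)) (at z)) (at z)" if "z \<in> siegel_chart" for z
    by (rule fn_differentiable[OF that])
  show "frechet_derivative (\<lambda>z. fn (pd I f) (symm z)) (at z) (c *s v) =
      c * frechet_derivative (\<lambda>z. fn (pd I f) (symm z)) (at z) v" if z: "z \<in> siegel_chart" for z c v
    by (rule directional_derivative_complex_linear[OF open_siegel_chart z
          holomorphic_has_derivative[OF assms] _ _ fn_continuous der[OF z], where e = "axis I 1"])
      (simp_all add: sum_distrib_left axis_def mult.assoc, simp add: if_distrib[of "\<lambda>x. x * _"] cong: if_cong)
qed

section \<open>The operator on modular forms\<close>

definition mscale :: "complex \<Rightarrow> (complex, 'n::finite) sqmat \<Rightarrow> (complex, 'n) sqmat" where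
  "mscale c A = (\<chi> i j. c * A $ i $ j)"

lemma mscale_mult [simp]: "mscale c A ** B = mscale c (A ** B)" "A ** mscale c B = mscale c (A ** B)"
  by (simp_all add: mscale_def matrix_matrix_mult_def vec_eq_iff sum_distrib_left mult_ac)

lemma mscale_add: "mscale c (A + B) = mscale c A + mscale c B"
  and mscale_diff: "mscale c (A - B) = mscale c A - mscale c B"
  and mscale_mscale [simp]: "mscale c (mscale d A) = mscale (c * d) A"
  and transpose_mscale: "transpose (mscale c A) = mscale c (transpose A)"
  and scaleR_mscale: "r *\<^sub>R A = mscale (complex_of_real r) A"
  by (simp_all add: mscale_def transpose_def vec_eq_iff algebra_simps scaleR_conv_of_real[symmetric])

lemma trace_mscale: "trace (mscale c A) = c * trace A"
  by (simp add: mscale_def trace_def sum_distrib_left)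

lemma det_mscale: "det (mscale c A) = c ^ CARD('n) * det (A :: (complex, 'n::finite) sqmat)"
  using det_rows_mul[of "\<lambda>_. c" "\<lambda>i. A $ i"] by (simp add: mscale_def vector_scalar_mult_def)

lemma matrix_mul_zero [simp]: "A ** 0 = (0 :: ('a::semiring_1, 'n::finite) sqmat)" "0 ** A = (0 :: ('a, 'n) sqmat)"
  by (simp_all add: matrix_matrix_mult_def vec_eq_iff)

text \<open>The differential of \<open>act \<gamma>\<close> at \<open>Z\<close>, applied to a
  tangent vector \<open>X\<close>.\<close>

definition rho :: "(int, 'n::finite + 'n) sqmat \<Rightarrow> (complex, 'n) sqmat \<Rightarrow> (complex, 'n) sqmat \<Rightarrow> (complex, 'n) sqmat" where
  "rho \<gamma> Z X = transpose (matrix_inv (cocycle \<gamma> Z)) ** X ** matrix_inv (cocycle \<gamma> Z)"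

lemma rho_sym: "transpose X = X \<Longrightarrow> transpose (rho \<gamma> Z X) = rho \<gamma> Z X"
  by (simp add: rho_def matrix_transpose_mul matrix_mul_assoc)

lemma rho_sandwich:
  assumes "\<gamma> \<in> Sp" "Z \<in> siegel"
  shows "transpose (cocycle \<gamma> Z) ** rho \<gamma> Z X ** cocycle \<gamma> Z = X"
proof -
  note inv = matrix_inv_mult[OF invertible_cocycle[OF assms]]
  have t: "transpose (cocycle \<gamma> Z) ** transpose (matrix_inv (cocycle \<gamma> Z)) = mat 1"
    by (simp add: matrix_transpose_mul[symmetric] inv transpose_mat)
  show ?thesis
    unfolding rho_def by (simp add: matrix_mul_assoc t) (simp add: matrix_mul_assoc[symmetric] inv)
qed

lemma has_derivative_affine_symm:
  fixes A B :: "(complex, 'n::{finite,linorder}) sqmat"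
  shows "((\<lambda>z. A ** symm z + B) has_derivative (\<lambda>v. A ** symm v)) (at z)"
  by (rule has_derivative_eq_rhs[OF has_derivative_add[OF has_derivative_mat_mult[OF
        has_derivative_const has_derivative_symm] has_derivative_const]]) simp

lemma has_derivative_cocycle:
  "((\<lambda>z. cocycle \<gamma> (symm z)) has_derivative (\<lambda>v. blkC \<gamma> ** symm v)) (at z)"
  unfolding cocycle_def by (rule has_derivative_affine_symm)

lemma has_derivative_inv_cocycle:
  assumes "\<gamma> \<in> Sp" "z \<in> siegel_chart"
  shows "((\<lambda>z. matrix_inv (cocycle \<gamma> (symm z))) has_derivative
    (\<lambda>v. - (matrix_inv (cocycle \<gamma> (symm z)) ** (blkC \<gamma> ** symm v) ** matrix_inv (cocycle \<gamma> (symm z))))) (at z)"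
  by (rule has_derivative_matrix_inv[OF has_derivative_cocycle])
    (rule invertible_cocycle[OF assms(1) symm_chart[OF assms(2)]])

text \<open>With \<open>W\<close> the image point, the product rule gives
  \<open>(A - W C) X J^-1\<close>, and the symplectic relations together with the symmetry of
  \<open>W\<close> give \<open>A - W C = J^-t\<close>.\<close>

lemma has_derivative_act:
  assumes \<gamma>: "\<gamma> \<in> Sp" and z: "z \<in> siegel_chart"
  shows "((\<lambda>z. act \<gamma> (symm z)) has_derivative (\<lambda>v. rho \<gamma> (symm z) (symm v))) (at z)"
proof -
  note Z = symm_chart[OF z]
  let ?P = "numer \<gamma> (symm z)" and ?Q = "cocycle \<gamma> (symm z)" and ?W = "act \<gamma> (symm z)"
  let ?Qi = "matrix_inv ?Q"
  note inv = matrix_inv_mult[OF invertible_cocycle[OF \<gamma> Z]]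
  have "((\<lambda>z. numer \<gamma> (symm z) ** matrix_inv (cocycle \<gamma> (symm z))) has_derivative
      (\<lambda>v. ?P ** - (?Qi ** (blkC \<gamma> ** symm v) ** ?Qi) + (blkA \<gamma> ** symm v) ** ?Qi)) (at z)"
    unfolding numer_def
    by (rule has_derivative_mat_mult[OF has_derivative_affine_symm has_derivative_inv_cocycle[OF \<gamma> z]])
  moreover have "?P ** - (?Qi ** (blkC \<gamma> ** X) ** ?Qi) + (blkA \<gamma> ** X) ** ?Qi = rho \<gamma> (symm z) X" for X
  proof -
    note r = Sp_blocks[OF \<gamma>]
    have "M ** transpose (blkC \<gamma>) ** blkA \<gamma> = M ** transpose (blkA \<gamma>) ** blkC \<gamma>" for M
      using r(1) by (simp add: matrix_mul_assoc[symmetric])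
    then have "transpose ?Q ** blkA \<gamma> - transpose ?P ** blkC \<gamma> = mat 1"
      by (simp add: cocycle_def numer_def mat_ring transpose_add matrix_transpose_mul r)
    then have "transpose ?Qi ** (transpose ?Q ** blkA \<gamma> - transpose ?P ** blkC \<gamma>) = transpose ?Qi"
      by simp
    moreover have "transpose ?Qi ** transpose ?Q = mat 1"
      by (simp add: matrix_transpose_mul[symmetric] inv transpose_mat)
    moreover have "transpose ?Qi ** transpose ?P = ?W"
      using act_sym[OF \<gamma> Z] by (simp add: act_numer matrix_transpose_mul)
    ultimately have A: "blkA \<gamma> - ?W ** blkC \<gamma> = transpose ?Qi"
      by (simp add: mat_ring)
    show ?thesis
      unfolding rho_def A[symmetric] by (simp add: mat_ring act_numer)
  qed
  ultimately show ?thesis by (simp add: act_numer)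
qed

text \<open>The factor \<open>(1 + \<delta>) / 2\<close> compensates for the two occurrences of each
  off-diagonal coordinate in the trace; this is why the total differential is the trace against the
  matrix of the \<open>\<partial>_ij\<close>.\<close>

lemma trace_pairing:
  assumes "transpose X = X" "\<And>i j. M $ i $ j = (1 + (if i = j then 1 else 0)) / 2 * c (idx i j)"
  shows "trace (M ** X) = (\<Sum>I\<in>UNIV. coords X $ I * (c I :: complex))"
proof -
  have "trace (M ** X) = (\<Sum>i\<in>UNIV. \<Sum>j\<in>UNIV. (if i = j then 1 else 1/2) * (coords X $ idx i j * c (idx i j)))"
    unfolding trace_def matrix_matrix_mult_def
  proof (simp add: assms(2), intro sum.cong refl)
    fix i j
    show "(1 + (if i = j then 1 else 0)) * c (idx i j) * X $ j $ i / 2 =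
        (if i = j then 1 else 1 / 2) * (coords X $ idx i j * c (idx i j))"
      using coords_idx[OF assms(1), of j i] by (simp add: idx_sym[of i j])
  qed
  also have "\<dots> = (\<Sum>I\<in>UNIV. coords X $ I * c I)"
    by (rule sum_idx) simp
  finally show ?thesis .
qed

lemma trace_ddZ:
  assumes "Z \<in> siegel" "transpose X = X"
  shows "trace (mat_at (ddZ f) Z ** X) = (\<Sum>I\<in>UNIV. coords X $ I * fn (pd I f) Z)"
  by (rule trace_pairing[OF assms(2)]) (simp add: mat_at_def ddZ_def fn_simps fn_consts[OF assms(1)])

lemma symmetric_eqI:
  assumes A: "transpose A = A" and B: "transpose B = (B :: (complex, 'n::{finite,linorder}) sqmat)"
    and eq: "\<And>v. trace (A ** symm v) = trace (B ** symm v)"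
  shows "A = B"
proof -
  \<comment> \<open>The multiplicity of a coordinate in a symmetric matrix, inverse to the factor in
    \<open>trace_pairing\<close>.\<close>
  define d :: "'n idx \<Rightarrow> complex" where "d = (\<lambda>I. if fst (Rep_idx I) = snd (Rep_idx I) then 1 else 2)"
  have d: "d (idx i j) = (if i = j then 1 else 2)" for i j
    using idx_Rep[of "idx i j"] by (auto simp: d_def idx_eq_iff)
  have tr: "trace (M ** symm v) = (\<Sum>I\<in>UNIV. v $ I * (d I * coords M $ I))" if M: "transpose M = M" for M v
  proof -
    have "trace (M ** symm v) = (\<Sum>I\<in>UNIV. coords (symm v) $ I * (d I * coords M $ I))"
      by (rule trace_pairing) (simp_all add: d coords_idx[OF M])
    then show ?thesis by simp
  qed
  have "coords A $ I = coords B $ I" for I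
    using eq[of "axis I 1"] unfolding tr[OF A] tr[OF B]
    by (simp add: axis_def if_distrib[of "\<lambda>x. x * _"] cong: if_cong) (simp add: d_def split: if_splits)
  then show ?thesis using symm_coords[OF A] symm_coords[OF B] by (metis vec_eq_iff)
qed

lemma mat_at_transpose: "transpose G = G \<Longrightarrow> transpose (mat_at G Z) = mat_at G Z"
  by (simp add: mat_at_def transpose_def vec_eq_iff)

lemma ddZ_sym: "transpose (ddZ f) = ddZ f"
  by (auto simp: ddZ_def transpose_def vec_eq_iff idx_sym)

lemma G_transforms_sandwich:
  assumes "G_transforms G" and \<gamma>: "\<gamma> \<in> Sp" and Z: "Z \<in> siegel"
  defines "Qi \<equiv> matrix_inv (cocycle \<gamma> Z)"
  shows "Qi ** mat_at G (act \<gamma> Z) ** transpose Qi = mat_at G Z + mscale 2 (transpose (blkC \<gamma>) ** transpose Qi)"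
proof -
  note inv = matrix_inv_mult[OF invertible_cocycle[OF \<gamma> Z]]
  have t: "transpose (cocycle \<gamma> Z) ** transpose Qi = mat 1"
    unfolding Qi_def by (simp add: matrix_transpose_mul[symmetric] inv transpose_mat)
  have "Qi ** mat_at G (act \<gamma> Z) = mat_at G Z ** transpose (cocycle \<gamma> Z) + mscale 2 (transpose (blkC \<gamma>))"
    using assms(1) \<gamma> Z by (simp add: G_transforms_def Qi_def scaleR_mscale)
  then show ?thesis by (simp add: mat_ring) (simp add: matrix_mul_assoc[symmetric] t)
qed

text \<open>\<open>G\<close> itself supplies this symmetry: all other terms of its transformation
  formula are symmetric. It amounts to \<open>C D^t = D C^t\<close>, a relation for the transposed
  matrix that is not among \<open>Sp_blocks\<close>.\<close>

lemma inv_cocycle_blkC_sym: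
  fixes G :: "('n::{finite,linorder} cinf, 'n) sqmat" and Z :: "(complex, 'n) sqmat"
  assumes "G_transforms G" "transpose G = G" and \<gamma>: "\<gamma> \<in> Sp" and Z: "Z \<in> siegel"
  defines "Qi \<equiv> matrix_inv (cocycle \<gamma> Z)"
  shows "transpose (blkC \<gamma>) ** transpose Qi = Qi ** blkC \<gamma>"
proof -
  let ?L = "Qi ** mat_at G (act \<gamma> Z) ** transpose Qi"
  have eq: "?L = mat_at G Z + mscale 2 (transpose (blkC \<gamma>) ** transpose Qi)"
    unfolding Qi_def by (rule G_transforms_sandwich[OF assms(1) \<gamma> Z])
  have "transpose ?L = ?L"
    by (simp add: matrix_transpose_mul mat_at_transpose[OF assms(2)] matrix_mul_assoc)
  then have "mscale 2 (Qi ** blkC \<gamma>) = mscale 2 (transpose (blkC \<gamma>) ** transpose Qi)"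
    unfolding eq by (simp add: transpose_add transpose_mscale matrix_transpose_mul mat_at_transpose[OF assms(2)])
  then show ?thesis by (simp add: mscale_def vec_eq_iff)
qed

lemma mat_at_nabla:
  assumes "Z \<in> siegel"
  shows "mat_at (nabla k G f) Z = mat_at (ddZ f) Z - mscale (of_nat k * fn f Z) (mat_at G Z)"
  by (simp add: mat_at_def nabla_def fn_simps fn_consts[OF assms] mscale_def vec_eq_iff mult_ac)

text \<open>Differentiate \<open>f (\<gamma> Z) = det J ^ w * f Z\<close> along \<open>X\<close>.
  The last term is \<open>w\<close> times the logarithmic derivative \<open>tr (J^-1 C X)\<close> of
  \<open>det J\<close>.\<close>

lemma modular_form_derivative:
  assumes f: "f \<in> smooth_modular_forms w" "siegel_holomorphic f"
    and \<gamma>: "\<gamma> \<in> Sp" and Z: "Z \<in> siegel" and X: "transpose X = X"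
  shows "trace (mat_at (ddZ f) (act \<gamma> Z) ** rho \<gamma> Z X) =
    det (cocycle \<gamma> Z) ^ w * (trace (mat_at (ddZ f) Z ** X)
      + of_nat w * fn f Z * trace (matrix_inv (cocycle \<gamma> Z) ** blkC \<gamma> ** X))"
proof -
  define z where "z = coords Z"
  have z: "z \<in> siegel_chart" "symm z = Z"
    using Z by (simp_all add: z_def coords_chart symm_coords_siegel)
  define v where "v = coords X"
  have v: "symm v = X" using X by (simp add: v_def symm_coords)
  let ?J = "cocycle \<gamma> Z"
  note inv = matrix_inv_mult[OF invertible_cocycle[OF \<gamma> Z]]
  have W: "act \<gamma> Z \<in> siegel" using act_siegel[OF \<gamma> Z] .
  have dl: "((\<lambda>z. fn f (symm (coords (act \<gamma> (symm z))))) has_derivative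
      (\<lambda>v. \<Sum>I\<in>UNIV. coords (rho \<gamma> (symm z) (symm v)) $ I * fn (pd I f) (act \<gamma> Z))) (at z)"
  proof -
    have "((\<lambda>z. coords (act \<gamma> (symm z))) has_derivative (\<lambda>v. coords (rho \<gamma> (symm z) (symm v)))) (at z)"
      by (rule has_derivative_coords[OF has_derivative_act[OF \<gamma> z(1)]])
    from has_derivative_compose[OF this holomorphic_has_derivative[OF f(2)]] show ?thesis
      using coords_chart[OF W] by (simp add: z symm_coords_siegel[OF W])
  qed
  have ddet: "((\<lambda>z. det (cocycle \<gamma> (symm z))) has_derivative
      (\<lambda>v. trace (matrix_inv ?J ** blkC \<gamma> ** symm v) * det ?J)) (at z)"
  proof (rule has_derivative_eq_rhs[OF has_derivative_det[OF has_derivative_cocycle]], rule ext)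
    fix v
    have "(blkC \<gamma> ** symm v ** matrix_inv ?J) ** ?J = blkC \<gamma> ** symm v"
      by (simp add: matrix_mul_assoc[symmetric] inv)
    then have "(\<Sum>r\<in>UNIV. det (\<chi> i. if i = r then (blkC \<gamma> ** symm v) $ r else ?J $ i))
        = trace (blkC \<gamma> ** symm v ** matrix_inv ?J) * det ?J"
      using sum_det_replace_row_mult[of "blkC \<gamma> ** symm v ** matrix_inv ?J" ?J] by (simp only:)
    then show "(\<Sum>r\<in>UNIV. det (\<chi> i. if i = r then (blkC \<gamma> ** symm v) $ r else cocycle \<gamma> (symm z) $ i))
        = trace (matrix_inv ?J ** blkC \<gamma> ** symm v) * det ?J"
      unfolding z(2) by (simp add: trace_mul_sym[of _ "matrix_inv ?J"] matrix_mul_assoc)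
  qed
  have dr: "((\<lambda>z. det (cocycle \<gamma> (symm z)) ^ w * fn f (symm z)) has_derivative
      (\<lambda>v. det (cocycle \<gamma> (symm z)) ^ w * (\<Sum>I\<in>UNIV. v $ I * fn (pd I f) (symm z)) +
        of_nat w * (trace (matrix_inv ?J ** blkC \<gamma> ** symm v) * det ?J)
          * det (cocycle \<gamma> (symm z)) ^ (w - 1) * fn f (symm z))) (at z)"
    by (rule has_derivative_mult[OF has_derivative_power[OF ddet] holomorphic_has_derivative[OF f(2) z(1)]])
  have "((\<lambda>z. fn f (symm (coords (act \<gamma> (symm z))))) has_derivative
      (\<lambda>v. det (cocycle \<gamma> (symm z)) ^ w * (\<Sum>I\<in>UNIV. v $ I * fn (pd I f) (symm z)) +
        of_nat w * (trace (matrix_inv ?J ** blkC \<gamma> ** symm v) * det ?J)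
          * det (cocycle \<gamma> (symm z)) ^ (w - 1) * fn f (symm z))) (at z)"
    by (rule has_derivative_transform_within_open[OF dr open_siegel_chart z(1)])
      (use f(1) \<gamma> in \<open>simp add: smooth_modular_forms_def symm_chart act_siegel symm_coords_siegel\<close>)
  from fun_cong[OF has_derivative_unique[OF dl this], of v]
  have "(\<Sum>I\<in>UNIV. coords (rho \<gamma> Z X) $ I * fn (pd I f) (act \<gamma> Z)) =
      det ?J ^ w * (\<Sum>I\<in>UNIV. v $ I * fn (pd I f) Z) +
      of_nat w * (trace (matrix_inv ?J ** blkC \<gamma> ** X) * det ?J) * det ?J ^ (w - 1) * fn f Z"
    by (simp add: z v)
  then show ?thesis
    by (cases w) (simp_all add: trace_ddZ[OF W rho_sym[OF X]] trace_ddZ[OF Z X] v_def algebra_simps)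
qed

text \<open>Apart from the common power of \<open>det J\<close>, the derivative of
  \<open>det J ^ (2 k)\<close> contributes \<open>2 k f J^-1 C\<close>; the inhomogeneous term
  \<open>2 J^-1 C\<close> of \<open>G\<close>, multiplied by \<open>k f\<close>, cancels exactly
  this.\<close>

lemma nabla_transform:
  assumes G: "transpose G = G" "G_transforms G"
    and f: "f \<in> smooth_modular_forms (2 * k)" "siegel_holomorphic f"
    and \<gamma>: "\<gamma> \<in> Sp" and Z: "Z \<in> siegel"
  defines "Qi \<equiv> matrix_inv (cocycle \<gamma> Z)"
  shows "Qi ** mat_at (nabla k G f) (act \<gamma> Z) ** transpose Qi =
    mscale (det (cocycle \<gamma> Z) ^ (2 * k)) (mat_at (nabla k G f) Z)"
proof -
  let ?d = "det (cocycle \<gamma> Z) ^ (2 * k)"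
  note W = act_siegel[OF \<gamma> Z]
  have C: "transpose (blkC \<gamma>) ** transpose Qi = Qi ** blkC \<gamma>"
    unfolding Qi_def by (rule inv_cocycle_blkC_sym[OF G(2,1) \<gamma> Z])
  have "Qi ** mat_at (ddZ f) (act \<gamma> Z) ** transpose Qi =
      mscale ?d (mat_at (ddZ f) Z + mscale (of_nat (2 * k) * fn f Z) (Qi ** blkC \<gamma>))"
  proof (rule symmetric_eqI)
    fix v
    have "trace (Qi ** mat_at (ddZ f) (act \<gamma> Z) ** transpose Qi ** symm v)
        = trace (mat_at (ddZ f) (act \<gamma> Z) ** rho \<gamma> Z (symm v))"
      unfolding rho_def Qi_def[symmetric]
      by (simp add: trace_mul_sym[of _ Qi] matrix_mul_assoc[symmetric])
        (simp add: matrix_mul_assoc trace_mul_sym[of _ Qi])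
    also have "\<dots> = ?d * (trace (mat_at (ddZ f) Z ** symm v)
        + of_nat (2 * k) * fn f Z * trace (Qi ** blkC \<gamma> ** symm v))"
      unfolding Qi_def by (rule modular_form_derivative[OF f \<gamma> Z symm_sym])
    also have "\<dots> = trace (mscale ?d (mat_at (ddZ f) Z + mscale (of_nat (2 * k) * fn f Z) (Qi ** blkC \<gamma>)) ** symm v)"
      by (simp only: mscale_mult trace_mscale matrix_add_rdistrib trace_add mult.assoc)
    finally show "trace (Qi ** mat_at (ddZ f) (act \<gamma> Z) ** transpose Qi ** symm v) = \<dots>" .
  next
    show "transpose (Qi ** mat_at (ddZ f) (act \<gamma> Z) ** transpose Qi) =
        Qi ** mat_at (ddZ f) (act \<gamma> Z) ** transpose Qi"
      by (simp add: matrix_transpose_mul mat_at_transpose[OF ddZ_sym] matrix_mul_assoc)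
    have "transpose (Qi ** blkC \<gamma>) = Qi ** blkC \<gamma>"
      using C by (simp add: matrix_transpose_mul)
    then show "transpose (mscale ?d (mat_at (ddZ f) Z + mscale (of_nat (2 * k) * fn f Z) (Qi ** blkC \<gamma>)))
        = mscale ?d (mat_at (ddZ f) Z + mscale (of_nat (2 * k) * fn f Z) (Qi ** blkC \<gamma>))"
      by (simp only: transpose_mscale transpose_add mat_at_transpose[OF ddZ_sym])
  qed
  moreover have "Qi ** mat_at G (act \<gamma> Z) ** transpose Qi = mat_at G Z + mscale 2 (Qi ** blkC \<gamma>)"
    using G_transforms_sandwich[OF G(2) \<gamma> Z] C by (simp add: Qi_def)
  moreover have "fn f (act \<gamma> Z) = ?d * fn f Z"
    using f(1) \<gamma> Z by (simp add: smooth_modular_forms_def)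
  ultimately show ?thesis
    by (simp add: mat_at_nabla[OF W] mat_at_nabla[OF Z] mat_ring mscale_diff mscale_add mult_ac)
qed

text \<open>Under \<open>det\<close> the scalar factor in \<open>nabla_transform\<close> is raised
  to the power \<open>CARD('n)\<close>, and the two factors \<open>J\<close>, \<open>J^t\<close>
  account for the added weight 2.\<close>

lemma det_nabla_modular:
  fixes f :: "('n::{finite,linorder}) cinf"
  assumes G: "transpose G = G" "G_transforms G"
    and f: "f \<in> smooth_modular_forms (2 * k)" "siegel_holomorphic f"
  shows "det (nabla k G f) \<in> smooth_modular_forms (2 * k * CARD('n) + 2)"
  unfolding smooth_modular_forms_def
proof (intro CollectI ballI)
  fix \<gamma> :: "(int, 'n + 'n) sqmat" and Z :: "(complex, 'n) sqmat"
  assume \<gamma>: "\<gamma> \<in> Sp" and Z: "Z \<in> siegel"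
  note W = act_siegel[OF \<gamma> Z]
  let ?J = "cocycle \<gamma> Z"
  have 1: "det ?J * det (matrix_inv ?J) = 1"
    using matrix_inv_mult(1)[OF invertible_cocycle[OF \<gamma> Z]] by (metis det_I det_mul)
  have "det (matrix_inv ?J) * det (mat_at (nabla k G f) (act \<gamma> Z)) * det (matrix_inv ?J)
      = (det ?J ^ (2 * k)) ^ CARD('n) * det (mat_at (nabla k G f) Z)"
    using arg_cong[OF nabla_transform[OF G f \<gamma> Z], of det] by (simp add: det_mul det_mscale)
  then have "(det ?J * det (matrix_inv ?J)) * det (mat_at (nabla k G f) (act \<gamma> Z)) * (det ?J * det (matrix_inv ?J))
      = det ?J ^ 2 * (det ?J ^ (2 * k)) ^ CARD('n) * det (mat_at (nabla k G f) Z)"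
    by (simp add: power2_eq_square mult_ac)
  then show "fn (det (nabla k G f)) (act \<gamma> Z) =
      det ?J ^ (2 * k * CARD('n) + 2) * fn (det (nabla k G f)) Z"
    unfolding 1 by (simp add: fn_det[OF W] fn_det[OF Z] power_mult power_add power2_eq_square power_mult_distrib mult_ac)
qed

lemma det_nabla_holomorphic:
  fixes f :: "('n::{finite,linorder}) cinf"
  assumes "\<And>i j. siegel_holomorphic (G $ i $ j)" "siegel_holomorphic f"
  shows "siegel_holomorphic (det (nabla k G f))"
proof (rule siegel_holomorphic_det)
  fix i j
  have "(of_nat k :: 'n cinf) = cconst (of_nat k)" by (rule fn_eqI) (simp add: fn_consts)
  then show "siegel_holomorphic (nabla k G f $ i $ j)"
    using assms by (simp add: nabla_def ddZ_def siegel_holomorphic_diff siegel_holomorphic_mult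
        siegel_holomorphic_cconst siegel_holomorphic_pd)
qed

section \<open>The connection coefficients\<close>

definition unit_mat :: "'n idx \<Rightarrow> ('n::{finite,linorder} cinf, 'n) sqmat" where
  "unit_mat I = (\<chi> i j. if idx i j = I then 1 else 0)"

text \<open>Symmetrised in \<open>I\<close> and \<open>J\<close>, so that for symmetric
  \<open>G\<close> the matrix is symmetric and loses nothing when only its entries with
  \<open>i \<le> j\<close> are read off.\<close>

definition conn_coeff ::
    "('n::{finite,linorder} cinf, 'n) sqmat \<Rightarrow> 'n idx \<Rightarrow> 'n idx \<Rightarrow> 'n idx \<Rightarrow> 'n cinf" where
  "conn_coeff G I J K = cconst (1/2) *
     (unit_mat I ** G ** unit_mat J + unit_mat J ** G ** unit_mat I) $ fst (Rep_idx K) $ snd (Rep_idx K)"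

abbreviation esym :: "'n idx \<Rightarrow> (complex, 'n::{finite,linorder}) sqmat" where
  "esym I \<equiv> symm (axis I 1)"

lemma mat_at_mult: "mat_at (A ** B) Z = mat_at A Z ** mat_at B Z"
  by (simp add: mat_at_def matrix_matrix_mult_def vec_eq_iff fn_sum fn_simps)

lemma mat_at_unit_mat: "Z \<in> siegel \<Longrightarrow> mat_at (unit_mat I) Z = esym I"
  by (auto simp: mat_at_def unit_mat_def vec_eq_iff symm_nth axis_def fn_simps fn_consts)

lemma fn_conn_coeff:
  assumes "Z \<in> siegel"
  shows "fn (conn_coeff G I J K) Z =
    coords (mscale (1/2) (esym I ** mat_at G Z ** esym J + esym J ** mat_at G Z ** esym I)) $ K"
proof -
  have "fn ((A + B) $ i $ j) Z = (mat_at A Z + mat_at B Z) $ i $ j" for A B :: "('a cinf, 'a) sqmat" and i j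
    by (simp add: mat_at_def fn_simps)
  then show ?thesis
    using assms by (simp add: conn_coeff_def fn_simps fn_consts mat_at_mult mat_at_unit_mat coords_def mscale_def)
qed

lemma symm_expand_nth: "(\<Sum>K\<in>UNIV. v $ K * esym K $ a $ b) = symm v $ a $ b"
  by (simp add: symm_nth axis_def if_distrib[of "(*) _"] cong: if_cong)

lemma sandwich_expand:
  assumes "transpose X = X"
  shows "(\<Sum>K\<in>UNIV. coords X $ K * (P ** esym K ** Q) $ i $ j) = (P ** X ** Q) $ i $ j"
proof -
  have X: "X $ a $ b = (\<Sum>K\<in>UNIV. coords X $ K * esym K $ a $ b)" for a b
    by (simp add: symm_expand_nth symm_coords[OF assms])
  have "(P ** X ** Q) $ i $ j = (\<Sum>b\<in>UNIV. \<Sum>a\<in>UNIV. \<Sum>K\<in>UNIV. coords X $ K * (P $ i $ a * esym K $ a $ b * Q $ b $ j))"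
    by (simp add: matrix_matrix_mult_def X sum_distrib_left sum_distrib_right mult_ac)
  also have "\<dots> = (\<Sum>b\<in>UNIV. \<Sum>K\<in>UNIV. \<Sum>a\<in>UNIV. coords X $ K * (P $ i $ a * esym K $ a $ b * Q $ b $ j))"
    by (intro sum.cong refl sum.swap)
  also have "\<dots> = (\<Sum>K\<in>UNIV. \<Sum>b\<in>UNIV. \<Sum>a\<in>UNIV. coords X $ K * (P $ i $ a * esym K $ a $ b * Q $ b $ j))"
    by (rule sum.swap)
  also have "\<dots> = (\<Sum>K\<in>UNIV. coords X $ K * (P ** esym K ** Q) $ i $ j)"
    by (simp add: matrix_matrix_mult_def sum_distrib_left sum_distrib_right mult_ac)
  finally show ?thesis ..
qed

lemma bilinear_expand:
  assumes "transpose X = X" "transpose Y = Y"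
  shows "(\<Sum>K\<in>UNIV. \<Sum>N\<in>UNIV. coords X $ K * (coords Y $ N * (esym K ** G ** esym N) $ i $ j)) = (X ** G ** Y) $ i $ j"
proof -
  have "(\<Sum>N\<in>UNIV. coords Y $ N * (esym K ** G ** esym N) $ i $ j) = (esym K ** G ** Y) $ i $ j" for K
    using sandwich_expand[OF assms(2), of "esym K ** G" "mat 1" i j] by (simp add: matrix_mul_assoc)
  moreover have "(\<Sum>K\<in>UNIV. coords X $ K * (esym K ** G ** Y) $ i $ j) = (X ** G ** Y) $ i $ j"
    using sandwich_expand[OF assms(1), of "mat 1" "G ** Y" i j] by (simp add: matrix_mul_assoc)
  ultimately show ?thesis by (simp add: sum_distrib_left[symmetric])
qed

lemma cocycle_transpose:
  assumes "Z \<in> siegel"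
  shows "Z ** transpose (blkC \<gamma>) + transpose (blkD \<gamma>) = transpose (cocycle \<gamma> Z)"
  using assms by (simp add: cocycle_def transpose_add matrix_transpose_mul siegel_iff)

lemma Smat_row:
  assumes "\<gamma> \<in> Sp" "Z \<in> siegel"
  shows "Smat \<gamma> Z $ I = coords (rho \<gamma> Z (esym I))"
  by (simp add: Smat_def cocycle_transpose[OF assms(2)] matrix_inv_transpose[OF invertible_cocycle[OF assms]] rho_def)

text \<open>The inverse of \<open>X \<mapsto> J^-t X J^-1\<close> is
  \<open>X \<mapsto> J^t X J\<close>, whose matrix in coordinates is \<open>T\<close>.\<close>

lemma Smat_invertible:
  assumes \<gamma>: "\<gamma> \<in> Sp" and Z: "Z \<in> siegel"
  shows "invertible (Smat \<gamma> Z)"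
proof -
  let ?J = "cocycle \<gamma> Z"
  define T where "T = (\<chi> I. coords (transpose ?J ** esym I ** ?J))"
  have "(Smat \<gamma> Z ** T) $ I $ L = mat 1 $ I $ L" for I L
  proof -
    have "(Smat \<gamma> Z ** T) $ I $ L = (\<Sum>K\<in>UNIV. coords (rho \<gamma> Z (esym I)) $ K *
        (transpose ?J ** esym K ** ?J) $ fst (Rep_idx L) $ snd (Rep_idx L))"
      by (simp add: matrix_matrix_mult_def[of "Smat \<gamma> Z"] Smat_row[OF \<gamma> Z] T_def)
        (simp add: coords_def)
    also have "\<dots> = (transpose ?J ** rho \<gamma> Z (esym I) ** ?J) $ fst (Rep_idx L) $ snd (Rep_idx L)"
      by (rule sandwich_expand) (simp add: rho_sym)
    also have "\<dots> = coords (esym I) $ L"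
      unfolding rho_sandwich[OF \<gamma> Z] by (simp add: coords_def)
    finally show ?thesis by (simp add: axis_def mat_def eq_commute)
  qed
  then have "Smat \<gamma> Z ** T = mat 1" by (simp add: vec_eq_iff)
  then show ?thesis by (auto simp: invertible_right_inverse)
qed

lemma symm_mscale: "symm (c *s v) = mscale c (symm v)"
  by (simp add: symm_def mscale_def vec_eq_iff)

lemma coords_mscale: "coords (mscale c X) = c *s coords X"
  by (simp add: coords_def mscale_def vec_eq_iff)

lemma coords_add: "coords (X + Y) = coords X + coords Y"
  and coords_diff: "coords (X - Y) = coords X - coords Y"
  and coords_uminus: "coords (- X) = - coords X"
  by (simp_all add: coords_def vec_eq_iff)

lemma transpose_uminus: "transpose (- X) = - transpose (X :: (complex, 'n::finite) sqmat)"
  by (simp add: transpose_def vec_eq_iff)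

text \<open>\<open>J^-t E J^-1\<close> contains \<open>J^-1\<close> twice; the symmetry of
  \<open>J^-1 C\<close> brings both terms of the product rule into the form of \<open>rho\<close>
  applied to one symmetric matrix.\<close>

lemma dS_row:
  assumes \<gamma>: "\<gamma> \<in> Sp" and Z: "Z \<in> siegel"
  defines "Qi \<equiv> matrix_inv (cocycle \<gamma> Z)"
  assumes C: "transpose (blkC \<gamma>) ** transpose Qi = Qi ** blkC \<gamma>"
  shows "dS \<gamma> M Z $ I = - coords (rho \<gamma> Z (esym M ** Qi ** blkC \<gamma> ** esym I + esym I ** Qi ** blkC \<gamma> ** esym M))"
proof -
  define z where "z = coords Z"
  have z: "z \<in> siegel_chart" "symm z = Z"
    using Z by (simp_all add: z_def coords_chart symm_coords_siegel)
  have Qi: "Qi = matrix_inv (cocycle \<gamma> (symm z))" by (simp add: Qi_def z)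
  note dQ = has_derivative_inv_cocycle[OF \<gamma> z(1), folded Qi]
  define R where "R = (\<lambda>z. coords (transpose (matrix_inv (cocycle \<gamma> (symm z))) ** esym I ** matrix_inv (cocycle \<gamma> (symm z))))"
  define R' where "R' = (\<lambda>v. - coords (rho \<gamma> Z (symm v ** Qi ** blkC \<gamma> ** esym I + esym I ** Qi ** blkC \<gamma> ** symm v)))"
  have dR: "(R has_derivative R') (at z)"
    unfolding R_def
  proof (rule has_derivative_eq_rhs[OF has_derivative_coords[OF has_derivative_mat_mult[OF
          has_derivative_mat_mult[OF has_derivative_transpose[OF dQ] has_derivative_const] dQ]]], rule ext)
    fix v
    have "transpose (Qi ** (blkC \<gamma> ** symm v) ** Qi) = transpose Qi ** symm v ** (transpose (blkC \<gamma>) ** transpose Qi)"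
      by (simp add: matrix_transpose_mul matrix_mul_assoc)
    then have t: "transpose (- (Qi ** (blkC \<gamma> ** symm v) ** Qi)) = - (transpose Qi ** symm v ** Qi ** blkC \<gamma>)"
      by (simp add: C transpose_uminus matrix_mul_assoc)
    show "coords (transpose (matrix_inv (cocycle \<gamma> (symm z))) ** esym I ** - (Qi ** (blkC \<gamma> ** symm v) ** Qi) +
        (transpose (matrix_inv (cocycle \<gamma> (symm z))) ** 0 + transpose (- (Qi ** (blkC \<gamma> ** symm v) ** Qi)) ** esym I) **
         matrix_inv (cocycle \<gamma> (symm z))) = R' v"
      unfolding t Qi[symmetric]
      by (simp add: R'_def rho_def Qi_def[symmetric] mat_ring coords_add coords_uminus coords_diff)
  qed
  \<comment> \<open>Complex linearity lets the Wirtinger derivative be read off as the value on the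
    real unit vector.\<close>
  have lin: "R' (c *s v) = c *s R' v" for c v
    by (simp add: R'_def symm_mscale mscale_add[symmetric] rho_def coords_mscale)
      
  have "dS \<gamma> M Z $ I $ L = R' (axis M 1) $ L" for L
  proof -
    have "((\<lambda>z. R z $ L) has_derivative (\<lambda>v. R' v $ L)) (at z)"
      using dR by (simp add: has_derivative_vec_iff[of R])
    then have "((\<lambda>z. Smat \<gamma> (symm z) $ I $ L) has_derivative (\<lambda>v. R' v $ L)) (at z)"
      by (rule has_derivative_transform_within_open[OF _ open_siegel_chart z(1)])
        (simp add: R_def Smat_row[OF \<gamma> symm_chart] rho_def)
    then have "wirtinger M (\<lambda>z. Smat \<gamma> (symm z) $ I $ L) z = R' (axis M 1) $ L"
      by (rule wirtinger_holomorphic) (simp add: lin)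
    then show ?thesis by (simp add: dS_def z_def)
  qed
  then show ?thesis by (simp add: vec_eq_iff R'_def)
qed

text \<open>With \<open>B\<^sub>Z(X, Y) = (X G Y + Y G X) / 2\<close> and \<open>\<rho>(X) = (C Z + D)\<^sup>-\<^sup>t X (C Z + D)\<^sup>-\<^sup>1\<close>, the
  transformation law of the coefficients says that
  \<open>B\<^bsub>\<gamma>Z\<^esub>(\<rho> X, \<rho> Y) = \<rho>(B\<^sub>Z(X, Y)) - (d\<rho>)(X)\<close>, where \<open>d\<rho>\<close> is taken in direction \<open>Y\<close>.\<close>

lemma conn_coeff_modular:
  fixes G :: "('n::{finite,linorder} cinf, 'n) sqmat"
  assumes G: "transpose G = G" "G_transforms G"
  shows "modular_connection_coeff (conn_coeff G)"
  unfolding modular_connection_coeff_def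
proof (intro ballI allI)
  fix \<gamma> :: "(int, 'n + 'n) sqmat" and Z :: "(complex, 'n) sqmat" and M :: "'n idx"
  assume \<gamma>: "\<gamma> \<in> Sp" and Z: "Z \<in> siegel"
  define Qi where "Qi = matrix_inv (cocycle \<gamma> Z)"
  define S where "S = Smat \<gamma> Z"
  define G1 where "G1 = mat_at G (act \<gamma> Z)"
  define G0 where "G0 = mat_at G Z"
  note W = act_siegel[OF \<gamma> Z]
  have C: "transpose (blkC \<gamma>) ** transpose Qi = Qi ** blkC \<gamma>"
    unfolding Qi_def by (rule inv_cocycle_blkC_sym[OF G(2,1) \<gamma> Z])
  have G1: "Qi ** G1 ** transpose Qi = G0 + mscale 2 (Qi ** blkC \<gamma>)"
    using G_transforms_sandwich[OF G(2) \<gamma> Z] C by (simp add: Qi_def G1_def G0_def)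
  \<comment> \<open>The law multiplied from the left by \<open>S\<close>, which keeps its inverse
    out of the computation.\<close>
  have main: "S ** omega_act \<gamma> (conn_coeff G) M Z = - dS \<gamma> M Z + omega_at (conn_coeff G) M Z ** S"
  proof (subst vec_eq_iff, subst vec_eq_iff, intro allI)
    fix I L :: "'n idx"
    define i j where "i = fst (Rep_idx L)" and "j = snd (Rep_idx L)"
    let ?X = "esym I" and ?Y = "esym M"
    let ?rX = "rho \<gamma> Z ?X" and ?rY = "rho \<gamma> Z ?Y"
    have rs: "transpose ?rX = ?rX" "transpose ?rY = ?rY" by (simp_all add: rho_sym)
    have "(S ** omega_act \<gamma> (conn_coeff G) M Z) $ I $ L =
        (\<Sum>K\<in>UNIV. coords ?rX $ K * (\<Sum>N\<in>UNIV. coords ?rY $ N * fn (conn_coeff G K N L) (act \<gamma> Z)))"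
      by (simp add: matrix_matrix_mult_def S_def omega_act_def Smat_row[OF \<gamma> Z])
    also have "\<dots> = 1/2 * ((\<Sum>K\<in>UNIV. \<Sum>N\<in>UNIV. coords ?rX $ K * (coords ?rY $ N * (esym K ** G1 ** esym N) $ i $ j)) +
        (\<Sum>K\<in>UNIV. \<Sum>N\<in>UNIV. coords ?rX $ K * (coords ?rY $ N * (esym N ** G1 ** esym K) $ i $ j)))"
      by (simp add: fn_conn_coeff[OF W] coords_def[of "vec_lambda _"] mscale_def G1_def i_def j_def
          sum_distrib_left sum.distrib[symmetric] algebra_simps)
    also have "(\<Sum>K\<in>UNIV. \<Sum>N\<in>UNIV. coords ?rX $ K * (coords ?rY $ N * (esym N ** G1 ** esym K) $ i $ j))
        = (\<Sum>N\<in>UNIV. \<Sum>K\<in>UNIV. coords ?rY $ N * (coords ?rX $ K * (esym N ** G1 ** esym K) $ i $ j))"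
      by (subst sum.swap) (simp add: mult.left_commute)
    also have "\<dots> = (?rY ** G1 ** ?rX) $ i $ j"
      by (rule bilinear_expand[OF rs(2,1)])
    also have "(\<Sum>K\<in>UNIV. \<Sum>N\<in>UNIV. coords ?rX $ K * (coords ?rY $ N * (esym K ** G1 ** esym N) $ i $ j))
        = (?rX ** G1 ** ?rY) $ i $ j"
      by (rule bilinear_expand[OF rs])
    finally have lhs: "(S ** omega_act \<gamma> (conn_coeff G) M Z) $ I $ L =
        1/2 * ((?rX ** G1 ** ?rY) $ i $ j + (?rY ** G1 ** ?rX) $ i $ j)" .
    \<comment> \<open>The inhomogeneous term of \<open>G\<close> enters here. Its factor 2 cancels
      against the 1/2 of the symmetrisation, and what remains is \<open>- dS\<close>.\<close>
    have sand: "rho \<gamma> Z A ** G1 ** rho \<gamma> Z B = rho \<gamma> Z (A ** G0 ** B) + mscale 2 (rho \<gamma> Z (A ** Qi ** blkC \<gamma> ** B))" for A B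
    proof -
      have "rho \<gamma> Z A ** G1 ** rho \<gamma> Z B = transpose Qi ** A ** (Qi ** G1 ** transpose Qi) ** B ** Qi"
        by (simp add: rho_def Qi_def matrix_mul_assoc)
      then show ?thesis
        unfolding G1 by (simp add: rho_def Qi_def[symmetric] mat_ring)
    qed
    let ?B = "mscale (1/2) (?X ** G0 ** ?Y + ?Y ** G0 ** ?X)"
    have B: "transpose ?B = ?B"
      by (simp add: transpose_mscale transpose_add matrix_transpose_mul G0_def
          mat_at_transpose[OF G(1)] matrix_mul_assoc add.commute)
    have cr: "coords (rho \<gamma> Z A) $ L = (transpose Qi ** A ** Qi) $ i $ j" for A
      by (simp add: coords_def i_def j_def) (simp add: rho_def Qi_def)
    have "(omega_at (conn_coeff G) M Z ** S) $ I $ L = (\<Sum>K\<in>UNIV. coords ?B $ K * coords (rho \<gamma> Z (esym K)) $ L)"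
      unfolding matrix_matrix_mult_def[of "omega_at (conn_coeff G) M Z"]
      by (simp add: S_def omega_at_def Smat_row[OF \<gamma> Z]
          fn_conn_coeff[OF Z] G0_def)
    also have "\<dots> = (\<Sum>K\<in>UNIV. coords ?B $ K * (transpose Qi ** esym K ** Qi) $ i $ j)"
      by (simp only: cr)
    also have "\<dots> = rho \<gamma> Z ?B $ i $ j"
      unfolding sandwich_expand[OF B] by (simp add: rho_def Qi_def)
    finally have om: "(omega_at (conn_coeff G) M Z ** S) $ I $ L = rho \<gamma> Z ?B $ i $ j" .
    have ds: "dS \<gamma> M Z $ I $ L = - rho \<gamma> Z (?Y ** Qi ** blkC \<gamma> ** ?X + ?X ** Qi ** blkC \<gamma> ** ?Y) $ i $ j"
      using dS_row[OF \<gamma> Z, of M I] C by (simp add: Qi_def[symmetric] coords_def i_def j_def)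
    have rho_add: "rho \<gamma> Z (A + B) = rho \<gamma> Z A + rho \<gamma> Z B" for A B
      by (simp add: rho_def mat_ring)
    have rho_mscale: "rho \<gamma> Z (mscale c A) = mscale c (rho \<gamma> Z A)" for c A
      by (simp add: rho_def)
    show "(S ** omega_act \<gamma> (conn_coeff G) M Z) $ I $ L =
        (- dS \<gamma> M Z + omega_at (conn_coeff G) M Z ** S) $ I $ L"
      unfolding lhs vector_add_component vector_uminus_component ds om sand rho_mscale rho_add
      by (simp add: mscale_def algebra_simps)
  qed
  note invS = matrix_inv_mult[OF Smat_invertible[OF \<gamma> Z], folded S_def]
  have "omega_act \<gamma> (conn_coeff G) M Z = matrix_inv S ** (- dS \<gamma> M Z + omega_at (conn_coeff G) M Z ** S)"
    unfolding main[symmetric] by (simp add: matrix_mul_assoc invS)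
  then show "omega_act \<gamma> (conn_coeff G) M Z = - (matrix_inv (Smat \<gamma> Z) ** dS \<gamma> M Z)
      + matrix_inv (Smat \<gamma> Z) ** omega_at (conn_coeff G) M Z ** Smat \<gamma> Z"
    by (simp add: S_def[symmetric] mat_ring)
qed

section \<open>The algebra of forms\<close>

lemma pd_add: "pd I (f + g) = pd I f + pd I g"
proof (rule fn_eqI)
  fix Z :: "(complex, 'a) sqmat" assume Z: "Z \<in> siegel"
  define z where "z = coords Z"
  have z: "z \<in> siegel_chart" "symm z = Z"
    using Z by (simp_all add: z_def coords_chart symm_coords_siegel)
  note d = fn_differentiable[OF z(1)]
  note s = has_derivative_add[OF d[of f] d[of g]]
  have "wirtinger I (\<lambda>z. fn (f + g) (symm z)) z = wirtinger I (\<lambda>z. fn f (symm z)) z + wirtinger I (\<lambda>z. fn g (symm z)) z"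
    unfolding fn_simps wirtinger_eq[OF d] wirtinger_eq[OF s] by (simp add: field_simps)
  then show "fn (pd I (f + g)) Z = fn (pd I f + pd I g) Z"
    using fn_pd[OF z(1)] z(2) by (simp add: fn_simps)
qed

lemma pd_mult: "pd I (f * g) = pd I f * g + f * pd I g"
proof (rule fn_eqI)
  fix Z :: "(complex, 'a) sqmat" assume Z: "Z \<in> siegel"
  define z where "z = coords Z"
  have z: "z \<in> siegel_chart" "symm z = Z"
    using Z by (simp_all add: z_def coords_chart symm_coords_siegel)
  note d = fn_differentiable[OF z(1)]
  note s = has_derivative_mult[OF d[of f] d[of g]]
  have "wirtinger I (\<lambda>z. fn (f * g) (symm z)) z =
      wirtinger I (\<lambda>z. fn f (symm z)) z * fn g Z + fn f Z * wirtinger I (\<lambda>z. fn g (symm z)) z"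
    unfolding fn_simps wirtinger_eq[OF d] wirtinger_eq[OF s] by (simp add: field_simps z)
  then show "fn (pd I (f * g)) Z = fn (pd I f * g + f * pd I g) Z"
    using fn_pd[OF z(1)] z(2) by (simp add: fn_simps)
qed

lemma pd_cconst: "pd I (cconst c) = 0"
proof (rule fn_eqI)
  fix Z :: "(complex, 'a) sqmat" assume Z: "Z \<in> siegel"
  define z where "z = coords Z"
  have z: "z \<in> siegel_chart" "symm z = Z"
    using Z by (simp_all add: z_def coords_chart symm_coords_siegel)
  have "((\<lambda>z. fn (cconst c) (symm z)) has_derivative (\<lambda>_. 0)) (at z)"
    by (rule has_derivative_transform_within_open[OF has_derivative_const[of c] open_siegel_chart z(1)])
      (simp add: fn_consts symm_chart)
  from wirtinger_eq[OF this, of I] show "fn (pd I (cconst c)) Z = fn 0 Z"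
    using fn_pd[OF z(1), of I "cconst c"] z(2) by (simp add: fn_simps)
qed

lemma cf_add: "cf (f + g) = cf f + cf g"
  and cf_mult: "cf (f * g) = cf f * cf g"
  and cf_0 [simp]: "cf 0 = 0"
  and cf_1 [simp]: "cf 1 = 1"
  and cf_diff: "cf (f - g) = cf f - cf g"
  by (simp_all add: cf_def single_add mult_single single_diff)

lemma cf_sum: "cf (sum f A) = (\<Sum>a\<in>A. cf (f a))"
  by (induction A rule: infinite_finite_induct) (simp_all add: cf_add)

lemma cf_of_nat: "cf (of_nat n) = of_nat n"
  by (simp add: cf_def)

lemma dfun_add: "dfun (f + g) = dfun f + dfun g"
  by (simp add: dfun_def pd_add cf_add algebra_simps sum.distrib)

lemma dfun_mult: "dfun (f * g) = dfun f * cf g + cf f * dfun g"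
  by (simp add: dfun_def pd_mult cf_add cf_mult algebra_simps sum.distrib sum_distrib_left)

lemma dfun_cconst: "dfun (cconst c) = 0"
  by (simp add: dfun_def pd_cconst)

lemma dfun_0 [simp]: "dfun 0 = 0"
  unfolding cconst_0 by (rule dfun_cconst)

lemma dfun_1 [simp]: "dfun 1 = 0"
  unfolding cconst_1 by (rule dfun_cconst)

section \<open>Monomials in the \<open>dZ I\<close>, and derivations\<close>

definition mon :: "('n idx \<Rightarrow>\<^sub>0 nat) \<Rightarrow> 'n::{finite,linorder} form" where
  "mon m = Poly_Mapping.single m 1"

lemma mono_add: "mon (m + n) = mon m * mon n"
  by (simp add: mon_def mult_single)

lemma mon_0 [simp]: "mon 0 = 1"
  by (simp add: mon_def)

lemma single_cf_mono: "Poly_Mapping.single m c = cf c * mon m"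
  by (simp add: cf_def mon_def mult_single)

lemma form_expand: "(p :: 'n::{finite,linorder} form) = (\<Sum>m\<in>Poly_Mapping.keys p. cf (Poly_Mapping.lookup p m) * mon m)"
proof (rule poly_mapping_eqI)
  fix k
  show "Poly_Mapping.lookup p k = Poly_Mapping.lookup (\<Sum>m\<in>Poly_Mapping.keys p. cf (Poly_Mapping.lookup p m) * mon m) k"
    by (simp add: single_cf_mono[symmetric] lookup_sum lookup_single when_def in_keys_iff)
qed

lemma form_induct [case_names mono add]:
  fixes p :: "'n::{finite,linorder} form"
  assumes "\<And>c m. P (cf c * mon m)" "\<And>p q. P p \<Longrightarrow> P q \<Longrightarrow> P (p + q)"
  shows "P p"
proof -
  have "P (\<Sum>m\<in>A. cf (Poly_Mapping.lookup p m) * mon m)" if "finite A" for A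
    using that
  proof (induction A)
    case empty
    then show ?case using assms(1)[of 0 0] by simp
  next
    case (insert m A)
    then show ?case by (simp add: assms)
  qed
  from this[OF finite_keys[of p]] show ?thesis using form_expand[of p] by simp
qed

lemma dZ_mono: "dZ K = mon (Poly_Mapping.single K 1)"
  by (simp add: dZ_def mon_def)

text \<open>Links exponent vectors with the index lists in which the Leibniz rule of
  \<open>associated_connection\<close> is phrased. One variable is split off at a time, by induction
  on the total degree.\<close>

lemma mono_eq_prod_list:
  obtains Ks where "mon m = prod_list (map dZ Ks)"
proof -
  have "\<exists>Ks. mon m = prod_list (map dZ Ks)"
  proof (induction "\<Sum>K\<in>UNIV. Poly_Mapping.lookup m K" arbitrary: m)
    case 0
    then have "m = 0" by (intro poly_mapping_eqI) simp
    then show ?case by (intro exI[of _ "[]"]) simp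
  next
    case (Suc n)
    then obtain K where K: "Poly_Mapping.lookup m K \<noteq> 0"
      by (metis (no_types, lifting) sum.neutral Zero_neq_Suc)
    define m' where "m' = m - Poly_Mapping.single K 1"
    have m: "m = Poly_Mapping.single K 1 + m'"
      using K by (intro poly_mapping_eqI) (auto simp: m'_def lookup_add lookup_minus lookup_single when_def)
    have "(\<Sum>L\<in>UNIV. Poly_Mapping.lookup m L) = 1 + (\<Sum>L\<in>UNIV. Poly_Mapping.lookup m' L)"
      by (subst m) (simp add: lookup_add sum.distrib lookup_single when_def)
    then obtain Ks where "mon m' = prod_list (map dZ Ks)"
      using Suc.hyps by fastforce
    then show ?case
      by (intro exI[of _ "K # Ks"]) (subst m, simp add: mono_add dZ_mono)
  qed
  then show ?thesis using that by blast
qed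

text \<open>Only additivity and the product rule, so that the formulas for powers and determinants
  do not depend on how the operator is built.\<close>

locale derivation =
  fixes \<D> :: "'n::{finite,linorder} form \<Rightarrow> 'n form"
  assumes add: "\<D> (p + q) = \<D> p + \<D> q"
    and mult: "\<D> (p * q) = \<D> p * q + p * \<D> q"
begin

lemma one [simp]: "\<D> 1 = 0"
  using mult[of 1 1] by simp

lemma zero [simp]: "\<D> 0 = 0"
  using add[of 0 0] by simp

lemma uminus: "\<D> (- p) = - \<D> p"
  using add[of p "- p"] by (simp add: eq_neg_iff_add_eq_0 add.commute)

lemma sum: "\<D> (sum f A) = (\<Sum>a\<in>A. \<D> (f a))"
  by (induction A rule: infinite_finite_induct) (simp_all add: add)

lemma of_nat [simp]: "\<D> (of_nat n) = 0"
  by (induction n) (simp_all add: add)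

lemma of_int [simp]: "\<D> (of_int n) = 0"
  by (cases n rule: int_cases2) (simp_all add: uminus)

lemma prod: "finite A \<Longrightarrow> \<D> (prod f A) = (\<Sum>a\<in>A. \<D> (f a) * prod f (A - {a}))"
proof (induction A rule: finite_induct)
  case (insert b A)
  have "(\<Sum>a\<in>A. \<D> (f a) * prod f (insert b A - {a})) = f b * (\<Sum>a\<in>A. \<D> (f a) * prod f (A - {a}))"
    unfolding sum_distrib_left
  proof (rule sum.cong)
    fix a assume a: "a \<in> A"
    then have "insert b A - {a} = insert b (A - {a})" using insert by auto
    then show "\<D> (f a) * prod f (insert b A - {a}) = f b * (\<D> (f a) * prod f (A - {a}))"
      using insert by (simp add: mult_ac)
  qed simp
  then show ?case using insert by (simp add: mult)
qed simp

lemma power: "\<D> (p ^ k) = of_nat k * \<D> p * p ^ (k - 1)"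
proof (induction k)
  case (Suc k)
  then show ?case by (cases k) (simp_all add: mult algebra_simps)
qed simp

lemma det: "\<D> (det M) = (\<Sum>r\<in>UNIV. det (\<chi> i. if i = r then (\<chi> j. \<D> (M $ r $ j)) else M $ i))"
  unfolding det_replace_row
  by (subst sum.swap) (simp add: det_def sum mult prod sum_distrib_left)

lemma prod_list: "\<D> (prod_list (map f Ks)) =
   (\<Sum>i<length Ks. prod_list (map f (take i Ks)) * \<D> (f (Ks ! i)) * prod_list (map f (drop (Suc i) Ks)))"
proof (induction Ks)
  case (Cons K Ks)
  then show ?case
    by (simp add: mult sum.lessThan_Suc_shift sum_distrib_left mult_ac del: sum.lessThan_Suc)
qed simp

end

text \<open>If \<open>K\<close> does not occur in \<open>m\<close>, the truncated difference is
  \<open>m\<close> itself, and the factor \<open>lookup m K = 0\<close> removes the term.\<close>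

definition mono_deriv ::
    "('n idx \<Rightarrow> 'n form) \<Rightarrow> ('n idx \<Rightarrow>\<^sub>0 nat) \<Rightarrow> 'n::{finite,linorder} form" where
  "mono_deriv \<delta> m = (\<Sum>K\<in>UNIV. of_nat (Poly_Mapping.lookup m K) * mon (m - Poly_Mapping.single K 1) * \<delta> K)"

text \<open>The derivation with prescribed values \<open>\<delta> K\<close> on the generators and
  \<open>dfun\<close> on the coefficients.\<close>

definition form_deriv :: "('n idx \<Rightarrow> 'n form) \<Rightarrow> 'n form \<Rightarrow> 'n::{finite,linorder} form" where
  "form_deriv \<delta> p = (\<Sum>m\<in>Poly_Mapping.keys p. dfun (Poly_Mapping.lookup p m) * mon m + cf (Poly_Mapping.lookup p m) * mono_deriv \<delta> m)"

lemma mono_deriv_add: "mono_deriv \<delta> (m + n) = mono_deriv \<delta> m * mon n + mon m * mono_deriv \<delta> n"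
proof -
  have *: "of_nat (Poly_Mapping.lookup m K) * mon (m + n - Poly_Mapping.single K 1) =
      of_nat (Poly_Mapping.lookup m K) * (mon (m - Poly_Mapping.single K 1) * mon n)" for m n and K :: "'a idx"
  proof (cases "Poly_Mapping.lookup m K = 0")
    case False
    then have "m + n - Poly_Mapping.single K 1 = (m - Poly_Mapping.single K 1) + n"
      by (intro poly_mapping_eqI) (auto simp: lookup_add lookup_minus lookup_single when_def)
    then show ?thesis by (simp add: mono_add)
  qed simp
  show ?thesis
    using *[of m _ n] *[of n _ m]
    by (simp add: mono_deriv_def lookup_add algebra_simps sum.distrib sum_distrib_left)
qed

lemma form_deriv_add: "form_deriv \<delta> (p + q) = form_deriv \<delta> p + form_deriv \<delta> q"
  unfolding form_deriv_def
  by (rule setsum_keys_plus_distrib) (simp_all add: dfun_add cf_add algebra_simps)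

lemma form_deriv_mono: "form_deriv \<delta> (cf c * mon m) = dfun c * mon m + cf c * mono_deriv \<delta> m"
  by (cases "c = 0") (simp_all add: single_cf_mono[symmetric] form_deriv_def)

text \<open>Both sides of the product rule are additive in \<open>p\<close> and in \<open>q\<close>,
  so monomials suffice.\<close>

lemma derivation_form_deriv: "derivation (form_deriv \<delta>)"
proof
  show "form_deriv \<delta> (p + q) = form_deriv \<delta> p + form_deriv \<delta> q" for p q
    by (rule form_deriv_add)
  show "form_deriv \<delta> (p * q) = form_deriv \<delta> p * q + p * form_deriv \<delta> q" for p q
  proof (induction p rule: form_induct)
    case (mono c m)
    show ?case
    proof (induction q rule: form_induct)
      case (mono d n)
      have "form_deriv \<delta> (cf c * mon m * (cf d * mon n)) = form_deriv \<delta> (cf (c * d) * mon (m + n))"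
        by (simp add: cf_mult mono_add mult_ac)
      then show ?case
        unfolding form_deriv_mono
        by (simp add: mono_deriv_add dfun_mult cf_mult mono_add algebra_simps)
    qed (simp add: form_deriv_add algebra_simps)
  qed (simp add: form_deriv_add algebra_simps)
qed

lemma form_deriv_cf: "form_deriv \<delta> (cf f) = dfun f"
  using form_deriv_mono[of \<delta> f 0] by (simp add: mono_deriv_def)

lemma form_deriv_dZ: "form_deriv \<delta> (dZ K) = \<delta> K"
proof -
  have "mono_deriv \<delta> (Poly_Mapping.single K 1) =
      (\<Sum>L\<in>UNIV. if L = K then mon (Poly_Mapping.single K 1 - Poly_Mapping.single L 1) * \<delta> L else 0)"
    unfolding mono_deriv_def by (rule sum.cong) (auto simp: lookup_single when_def)
  then have "mono_deriv \<delta> (Poly_Mapping.single K 1) = \<delta> K" by simp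
  then show ?thesis
    using form_deriv_mono[of \<delta> 1 "Poly_Mapping.single K 1"]
    by (simp add: dZ_mono)
qed

definition conn_gen ::
    "('n idx \<Rightarrow> 'n idx \<Rightarrow> 'n idx \<Rightarrow> 'n cinf) \<Rightarrow> 'n idx \<Rightarrow> 'n::{finite,linorder} form" where
  "conn_gen \<Gamma> K = - (\<Sum>I\<in>UNIV. \<Sum>J\<in>UNIV. cf (\<Gamma> I J K) * dZ I * dZ J)"

lemma associated_form_deriv: "associated_connection \<Gamma> (form_deriv (conn_gen \<Gamma>))"
proof -
  interpret derivation "form_deriv (conn_gen \<Gamma>)" by (rule derivation_form_deriv)
  show ?thesis
    unfolding associated_connection_def
  proof (intro conjI allI)
    show "form_deriv (conn_gen \<Gamma>) (cf (cconst c) * p) = cf (cconst c) * form_deriv (conn_gen \<Gamma>) p" for c p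
      by (simp add: mult form_deriv_cf dfun_cconst)
    show "form_deriv (conn_gen \<Gamma>) (dZ K) = - (\<Sum>I\<in>UNIV. \<Sum>J\<in>UNIV. cf (\<Gamma> I J K) * dZ I * dZ J)" for K
      by (simp add: form_deriv_dZ conn_gen_def)
    show "form_deriv (conn_gen \<Gamma>) (cf f * prod_list (map dZ Ks)) =
        dfun f * prod_list (map dZ Ks) +
        (\<Sum>i<length Ks. cf f * prod_list (map dZ (take i Ks)) * form_deriv (conn_gen \<Gamma>) (dZ (Ks ! i))
           * prod_list (map dZ (drop (Suc i) Ks)))" for f Ks
      by (simp add: mult prod_list form_deriv_cf sum_distrib_left mult.assoc)
  qed (rule add)
qed

text \<open>\<open>\<Gamma>\<close> and \<open>\<Gamma>'\<close> may differ: the \<open>dZ I\<close>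
  commute, so an operator determines only the symmetrised coefficients. Uniqueness is therefore
  phrased by the values on generators.\<close>

lemma associated_unique:
  assumes "associated_connection \<Gamma> \<D>" "associated_connection \<Gamma>' \<D>'"
    and eq: "\<And>K. \<D> (dZ K) = \<D>' (dZ K)"
  shows "\<D> = \<D>'"
proof (rule ext)
  fix p
  show "\<D> p = \<D>' p"
  proof (induction p rule: form_induct)
    case (mono c m)
    obtain Ks where "mon m = prod_list (map dZ Ks)" by (rule mono_eq_prod_list)
    then show ?case using assms by (simp add: associated_connection_def)
  next
    case (add p q)
    then show ?case using assms by (simp add: associated_connection_def)
  qed
qed

section \<open>The connection of \<open>G\<close> in matrix notation\<close>

definition mcf :: "('n::{finite,linorder} cinf, 'n) sqmat \<Rightarrow> ('n form, 'n) sqmat" where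
  "mcf A = (\<chi> i j. cf (A $ i $ j))"

lemma dZmat_expand: "dZmat $ i $ j = (\<Sum>I\<in>UNIV. dZ I * mcf (unit_mat I) $ i $ j)"
  by (simp add: dZmat_def mcf_def unit_mat_def if_distrib[of cf] if_distrib[of "(*) _"] cong: if_cong)

lemma cf_half: "cf (cconst (1/2)) + cf (cconst (1/2)) = (1 :: 'n::{finite,linorder} form)"
proof -
  have "cconst (1/2) + cconst (1/2) = (1 :: 'n cinf)"
    by (rule fn_eqI) (simp only: fn_simps fn_consts, simp)
  then show ?thesis by (simp only: cf_add[symmetric] cf_1)
qed

lemma dfun_ddZ: "dfun f = trace (mcf (ddZ f) ** dZmat)"
proof -
  have one: "cconst 1 = (1 :: 'a cinf)" by (simp add: cconst_1)
  have "trace (mcf (ddZ f) ** dZmat) = (\<Sum>i\<in>UNIV. \<Sum>j\<in>UNIV.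
      (if i = j then 1 else cf (cconst (1/2))) * (cf (pd (idx i j) f) * dZ (idx i j)))"
    unfolding trace_def matrix_matrix_mult_def
    by (simp, intro sum.cong refl) (auto simp: mcf_def ddZ_def dZmat_def one cf_mult mult.assoc idx_sym)
  also have "\<dots> = dfun f"
    unfolding dfun_def by (rule sum_idx[OF cf_half])
  finally show ?thesis ..
qed

lemma quadratic_expand:
  "(\<Sum>I\<in>UNIV. \<Sum>J\<in>UNIV. cf ((unit_mat I ** G ** unit_mat J) $ r $ s) * dZ I * dZ J) =
   (dZmat ** mcf G ** dZmat) $ r $ s"
proof -
  have "(dZmat ** mcf G ** dZmat) $ r $ s =
      (\<Sum>b\<in>UNIV. \<Sum>a\<in>UNIV. \<Sum>I\<in>UNIV. \<Sum>J\<in>UNIV. mcf (unit_mat I) $ r $ a * mcf G $ a $ b * mcf (unit_mat J) $ b $ s * (dZ I * dZ J))"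
    by (simp add: matrix_matrix_mult_def dZmat_expand sum_distrib_left sum_distrib_right mult_ac)
  also have "\<dots> = (\<Sum>b\<in>UNIV. \<Sum>I\<in>UNIV. \<Sum>a\<in>UNIV. \<Sum>J\<in>UNIV. mcf (unit_mat I) $ r $ a * mcf G $ a $ b * mcf (unit_mat J) $ b $ s * (dZ I * dZ J))"
    by (intro sum.cong refl sum.swap)
  also have "\<dots> = (\<Sum>I\<in>UNIV. \<Sum>b\<in>UNIV. \<Sum>J\<in>UNIV. \<Sum>a\<in>UNIV. mcf (unit_mat I) $ r $ a * mcf G $ a $ b * mcf (unit_mat J) $ b $ s * (dZ I * dZ J))"
    by (subst sum.swap) (intro sum.cong refl sum.swap)
  also have "\<dots> = (\<Sum>I\<in>UNIV. \<Sum>J\<in>UNIV. \<Sum>b\<in>UNIV. \<Sum>a\<in>UNIV. mcf (unit_mat I) $ r $ a * mcf G $ a $ b * mcf (unit_mat J) $ b $ s * (dZ I * dZ J))"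
    by (intro sum.cong refl sum.swap)
  also have "\<dots> = (\<Sum>I\<in>UNIV. \<Sum>J\<in>UNIV. cf ((unit_mat I ** G ** unit_mat J) $ r $ s) * dZ I * dZ J)"
    by (intro sum.cong refl) (simp add: matrix_matrix_mult_def mcf_def cf_sum cf_mult sum_distrib_right mult.assoc)
  finally show ?thesis ..
qed

lemma dZmat_mcf_sym:
  assumes "transpose G = G"
  shows "(dZmat ** mcf G ** dZmat) $ r $ s = (dZmat ** mcf G ** dZmat) $ s $ r"
proof -
  have G: "G $ a $ b = G $ b $ a" for a b
    using arg_cong[OF assms, of "\<lambda>M. M $ a $ b"] by (simp only: transpose_def vec_lambda_beta)
  have "transpose (dZmat ** mcf G ** dZmat) = dZmat ** mcf G ** dZmat"
  proof -
    have "transpose dZmat = (dZmat :: ('a form, 'a) sqmat)"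
      by (simp add: transpose_def dZmat_def vec_eq_iff idx_sym)
    moreover have "transpose (mcf G) = mcf G"
      using G by (simp add: transpose_def mcf_def vec_eq_iff)
    ultimately show ?thesis by (simp add: matrix_transpose_mul matrix_mul_assoc)
  qed
  then have "transpose (dZmat ** mcf G ** dZmat) $ s $ r = (dZmat ** mcf G ** dZmat) $ s $ r"
    by (simp only:)
  then show ?thesis by (simp only: transpose_def vec_lambda_beta)
qed

text \<open>The two halves of the symmetrised coefficient give the same quadratic expression,
  because the \<open>dZ I\<close> commute.\<close>

lemma conn_gen_coeff:
  assumes "transpose G = G"
  shows "conn_gen (conn_coeff G) (idx r s) = - (dZmat ** mcf G ** dZmat) $ r $ s"
proof -
  \<comment> \<open>The pair stored in \<open>idx r s\<close> may be \<open>(s, r)\<close>; the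
    symmetry of the matrix makes up for it.\<close>
  define a b where "a = fst (Rep_idx (idx r s))" and "b = snd (Rep_idx (idx r s))"
  let ?q = "dZmat ** mcf G ** dZmat"
  have "idx a b = idx r s" unfolding a_def b_def by (rule idx_Rep)
  then have ab: "?q $ a $ b = ?q $ r $ s"
    using dZmat_mcf_sym[OF assms, of r s] by (auto simp: idx_eq_iff)
  have "(\<Sum>I\<in>UNIV. \<Sum>J\<in>UNIV. cf (conn_coeff G I J (idx r s)) * dZ I * dZ J) =
      cf (cconst (1/2)) * (\<Sum>I\<in>UNIV. \<Sum>J\<in>UNIV. cf ((unit_mat I ** G ** unit_mat J) $ a $ b) * dZ I * dZ J)
      + cf (cconst (1/2)) * (\<Sum>I\<in>UNIV. \<Sum>J\<in>UNIV. cf ((unit_mat J ** G ** unit_mat I) $ a $ b) * dZ I * dZ J)"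
  proof -
    have "cf (conn_coeff G I J (idx r s)) * dZ I * dZ J =
        cf (cconst (1/2)) * (cf ((unit_mat I ** G ** unit_mat J) $ a $ b) * dZ I * dZ J)
        + cf (cconst (1/2)) * (cf ((unit_mat J ** G ** unit_mat I) $ a $ b) * dZ I * dZ J)" for I J
      by (simp add: conn_coeff_def a_def[symmetric] b_def[symmetric] cf_mult cf_add algebra_simps)
    then show ?thesis by (simp only: sum.distrib sum_distrib_left)
  qed
  also have "(\<Sum>I\<in>UNIV. \<Sum>J\<in>UNIV. cf ((unit_mat J ** G ** unit_mat I) $ a $ b) * dZ I * dZ J) = ?q $ a $ b"
    unfolding quadratic_expand[symmetric] by (subst sum.swap) (simp add: mult_ac)
  also have "cf (cconst (1/2)) * (\<Sum>I\<in>UNIV. \<Sum>J\<in>UNIV. cf ((unit_mat I ** G ** unit_mat J) $ a $ b) * dZ I * dZ J)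
      + cf (cconst (1/2)) * ?q $ a $ b = (cf (cconst (1/2)) + cf (cconst (1/2))) * ?q $ a $ b"
    unfolding quadratic_expand by (simp only: distrib_right)
  finally show ?thesis by (simp add: conn_gen_def cf_half ab)
qed

lemma connection_det:
  assumes G: "transpose G = G"
  defines "\<D> \<equiv> form_deriv (conn_gen (conn_coeff G))"
  shows "\<D> (cf f * det dZmat ^ k) = trace ((\<chi> i j. cf (nabla k G f $ i $ j)) ** dZmat) * det dZmat ^ k"
proof -
  interpret derivation \<D> unfolding \<D>_def by (rule derivation_form_deriv)
  let ?N = "- (dZmat ** mcf G)"
  have row: "(\<chi> j. \<D> (dZmat $ r $ j)) = (?N ** dZmat) $ r" for r
    by (simp add: vec_eq_iff matrix_minus_left)
      (simp add: \<D>_def dZmat_def form_deriv_dZ conn_gen_coeff[OF G])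
  have "\<D> (det dZmat) = (\<Sum>r\<in>UNIV. det (\<chi> i. if i = r then (?N ** dZmat) $ r else dZmat $ i))"
    unfolding det row ..
  also have "\<dots> = trace ?N * det dZmat"
    by (rule sum_det_replace_row_mult)
  also have "trace ?N = - trace (mcf G ** dZmat)"
    by (simp add: trace_mul_sym[of "mcf G"]) (simp add: trace_def sum_negf)
  finally have dd: "\<D> (det dZmat) = - trace (mcf G ** dZmat) * det dZmat" .
  have nab: "trace ((\<chi> i j. cf (nabla k G f $ i $ j)) ** dZmat) =
      dfun f - of_nat k * cf f * trace (mcf G ** dZmat)"
    unfolding dfun_ddZ
    by (simp add: trace_def matrix_matrix_mult_def mcf_def nabla_def cf_diff cf_mult cf_of_nat
        algebra_simps sum_subtractf sum_distrib_left)
  have "\<D> (cf f) = dfun f" by (simp add: \<D>_def form_deriv_cf)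
  then show ?thesis
    unfolding nab by (cases k) (simp_all add: mult power dd del: power_Suc, simp_all add: algebra_simps)
qed

theorem connection_existence_uniqueness:
  fixes G :: "('n::{finite,linorder} cinf, 'n) sqmat"
  assumes G: "transpose G = G" "G_transforms G"
  shows "\<exists>!\<D>. modular_connection \<D> \<and>
        (\<forall>r s. \<D> (dZ (idx r s)) =
           - (\<Sum>i\<in>UNIV. \<Sum>j\<in>UNIV. cf (G $ i $ j) * dZ (idx s i) * dZ (idx r j))) \<and>
        (\<forall>f k. \<D> (cf f * det dZmat ^ k) =
           trace ((\<chi> i j. cf (nabla k G f $ i $ j)) ** dZmat) * det dZmat ^ k)"
proof (rule ex1I[of _ "form_deriv (conn_gen (conn_coeff G))"], intro conjI allI)
  show "modular_connection (form_deriv (conn_gen (conn_coeff G)))"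
    unfolding modular_connection_def
    using conn_coeff_modular[OF G] associated_form_deriv by blast
  show gen: "form_deriv (conn_gen (conn_coeff G)) (dZ (idx r s)) =
      - (\<Sum>i\<in>UNIV. \<Sum>j\<in>UNIV. cf (G $ i $ j) * dZ (idx s i) * dZ (idx r j))" for r s
  proof -
    have "(dZmat ** mcf G ** dZmat) $ s $ r = (\<Sum>i\<in>UNIV. \<Sum>j\<in>UNIV. cf (G $ i $ j) * dZ (idx s i) * dZ (idx r j))"
      unfolding matrix_matrix_mult_def dZmat_def mcf_def
      by (subst sum.swap) (simp add: sum_distrib_left mult_ac idx_sym[of _ r])
    then show ?thesis
      unfolding form_deriv_dZ conn_gen_coeff[OF G(1)] dZmat_mcf_sym[OF G(1), of r s] vector_uminus_component
      by (simp only:)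
  qed
  show "form_deriv (conn_gen (conn_coeff G)) (cf f * det dZmat ^ k) =
      trace ((\<chi> i j. cf (nabla k G f $ i $ j)) ** dZmat) * det dZmat ^ k" for f k
    by (rule connection_det[OF G(1)])
  fix \<D> :: "'n form \<Rightarrow> 'n form"
  assume D: "modular_connection \<D> \<and>
      (\<forall>r s. \<D> (dZ (idx r s)) = - (\<Sum>i\<in>UNIV. \<Sum>j\<in>UNIV. cf (G $ i $ j) * dZ (idx s i) * dZ (idx r j))) \<and>
      (\<forall>f k. \<D> (cf f * det dZmat ^ k) = trace ((\<chi> i j. cf (nabla k G f $ i $ j)) ** dZmat) * det dZmat ^ k)"
  then obtain \<Gamma> where "associated_connection \<Gamma> \<D>" by (auto simp: modular_connection_def)
  then show "\<D> = form_deriv (conn_gen (conn_coeff G))"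
  proof (rule associated_unique[OF _ associated_form_deriv])
    fix K :: "'n idx"
    have "\<D> (dZ (idx r s)) = form_deriv (conn_gen (conn_coeff G)) (dZ (idx r s))" for r s
      unfolding gen using D by blast
    from this[of "fst (Rep_idx K)" "snd (Rep_idx K)"]
    show "\<D> (dZ K) = form_deriv (conn_gen (conn_coeff G)) (dZ K)"
      by (simp only: idx_Rep)
  qed
qed

section \<open>Forms with values in symmetric matrices\<close>

text \<open>Periodicity confines the maximum to a compact rectangle. If it is attained in the
  interior, the maximum modulus principle makes \<open>g\<close> constant on the open strip, and
  continuity carries this value to the edge.\<close>

lemma strip_maximum:
  fixes g :: "complex \<Rightarrow> complex"
  assumes ab: "a < b" and T: "T > 0"
    and cont: "continuous_on {s. a \<le> Im s \<and> Im s \<le> b} g"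
    and hol: "g holomorphic_on {s. a < Im s \<and> Im s < b}"
    and per: "\<And>s. a \<le> Im s \<Longrightarrow> Im s \<le> b \<Longrightarrow> g (s + of_real T) = g s"
    and bd: "\<And>s. Im s = a \<or> Im s = b \<Longrightarrow> cmod (g s) \<le> M"
    and s: "a \<le> Im s" "Im s \<le> b"
  shows "cmod (g s) \<le> M"
proof -
  define K where "K = cbox (Complex 0 a) (Complex T b)"
  have K: "z \<in> K \<longleftrightarrow> 0 \<le> Re z \<and> Re z \<le> T \<and> a \<le> Im z \<and> Im z \<le> b" for z
    by (auto simp: K_def in_cbox_complex_iff)
  have "continuous_on K (\<lambda>z. cmod (g z))"
    by (intro continuous_on_norm continuous_on_subset[OF cont]) (auto simp: K)
  moreover have "compact K" "K \<noteq> {}"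
    using K[of "Complex 0 a"] ab T by (auto simp: K_def)
  ultimately obtain w where w: "w \<in> K" "\<And>z. z \<in> K \<Longrightarrow> cmod (g z) \<le> cmod (g w)"
    using continuous_attains_sup by metis
  have per_int: "g (z + of_real (T * of_int n)) = g z" if z: "a \<le> Im z" "Im z \<le> b" for z n
  proof -
    have nat: "g (z + of_real (T * of_nat k)) = g z" if "a \<le> Im z" "Im z \<le> b" for z k
      using that by (induction k) (use per[of "z + of_real (T * of_nat k)" for k] in \<open>auto simp: algebra_simps\<close>)
    show ?thesis
    proof (cases "n \<ge> 0")
      case True
      then show ?thesis using nat[OF z, of "nat n"] by simp
    next
      case False
      then show ?thesis using nat[of "z + of_real (T * of_int n)" "nat (- n)"] z by simp
    qed
  qed
  have all: "cmod (g z) \<le> cmod (g w)" if z: "a \<le> Im z" "Im z \<le> b" for z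
  proof -
    define n where "n = - \<lfloor>Re z / T\<rfloor>"
    have "of_int \<lfloor>Re z / T\<rfloor> \<le> Re z / T" "Re z / T < of_int \<lfloor>Re z / T\<rfloor> + 1" by linarith+
    then have "of_int \<lfloor>Re z / T\<rfloor> * T \<le> Re z" "Re z < (of_int \<lfloor>Re z / T\<rfloor> + 1) * T"
      using T by (simp_all only: pos_le_divide_eq pos_divide_less_eq)
    then have "z + of_real (T * of_int n) \<in> K"
      using z by (simp add: K n_def algebra_simps)
    from w(2)[OF this] show ?thesis using per_int[OF z] by simp
  qed
  have "cmod (g w) \<le> M"
  proof (cases "Im w = a \<or> Im w = b")
    case True
    then show ?thesis by (rule bd)
  next
    case False
    then have wi: "w \<in> {s. a < Im s \<and> Im s < b}" using w(1) by (auto simp: K)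
    have S: "{s. a < Im s \<and> Im s < b} = {s. a < Im s} \<inter> {s. Im s < b}" by auto
    have op: "open {s. a < Im s \<and> Im s < b}"
      unfolding S by (intro open_Int open_halfspace_Im_gt open_halfspace_Im_lt)
    have co: "connected {s. a < Im s \<and> Im s < b}"
      unfolding S by (intro convex_connected convex_Int convex_halfspace_Im_gt convex_halfspace_Im_lt)
    have "g constant_on {s. a < Im s \<and> Im s < b}"
      by (rule maximum_modulus_principle[OF hol op co op order_refl wi]) (use all in auto)
    then obtain c where c: "\<And>s. a < Im s \<Longrightarrow> Im s < b \<Longrightarrow> g s = c" by (auto simp: constant_on_def)
    have "((\<lambda>t. g (Complex 0 t)) \<longlongrightarrow> g (Complex 0 b)) (at b within {a..b})"
    proof -
      have "continuous_on {a..b} (\<lambda>t. g (Complex 0 t))"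
        by (rule continuous_on_compose2[OF cont])
          (auto intro!: continuous_intros simp: Complex_eq)
      then show ?thesis using ab by (auto simp: continuous_on_def)
    qed
    moreover have "((\<lambda>t. g (Complex 0 t)) \<longlongrightarrow> c) (at b within {a..b})"
    proof (rule Lim_transform_eventually[OF tendsto_const])
      show "\<forall>\<^sub>F t in at b within {a..b}. c = g (Complex 0 t)"
        unfolding eventually_at using ab c by (auto intro!: exI[of _ "b - a"] simp: dist_real_def)
    qed
    moreover have "at b within {a..b} \<noteq> bot"
      using ab by (simp add: at_within_Icc_at_left)
    ultimately have "g (Complex 0 b) = c" using tendsto_unique by blast
    then show ?thesis using bd[of "Complex 0 b"] c[of w] wi by simp
  qed
  then show ?thesis using all[OF s] by linarith
qed

section \<open>Outer products, shears and integral symplectic blocks\<close>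

definition outer :: "'a::comm_ring_1 ^ 'n \<Rightarrow> 'a ^ 'n \<Rightarrow> ('a, 'n::finite) sqmat" where
  "outer u v = (\<chi> i j. u $ i * v $ j)"

definition cmat :: "(real, 'n::finite) sqmat \<Rightarrow> (complex, 'n) sqmat" where
  "cmat A = (\<chi> i j. complex_of_real (A $ i $ j))"

definition cvec :: "real ^ 'n::finite \<Rightarrow> complex ^ 'n" where
  "cvec u = (\<chi> i. complex_of_real (u $ i))"

definition imatrix :: "(int, 'n::finite) sqmat \<Rightarrow> (complex, 'n) sqmat" where
  "imatrix A = (\<chi> i j. of_int (A $ i $ j))"

lemma imatrix_mult: "imatrix (A ** B) = imatrix A ** imatrix B"
  and imatrix_transpose: "imatrix (transpose A) = transpose (imatrix A)"
  and imatrix_mat: "imatrix (mat 1) = mat 1"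
  and imatrix_0: "imatrix 0 = 0"
  by (simp_all add: imatrix_def matrix_matrix_mult_def transpose_def vec_eq_iff mat_def)

lemma cmat_mult: "cmat (A ** B) = cmat A ** cmat B"
  and cmat_transpose: "cmat (transpose A) = transpose (cmat A)"
  and cmat_mat: "cmat (mat 1) = mat 1"
  by (simp_all add: cmat_def matrix_matrix_mult_def transpose_def vec_eq_iff mat_def)

lemma outer_sum_left: "outer (u + u') v = outer u v + outer u' v"
  and outer_sum_right: "outer u (v + v') = outer u v + outer u v'"
  by (simp_all add: outer_def vec_eq_iff algebra_simps)

lemma transpose_outer: "transpose (outer u v) = outer v u"
  by (simp add: outer_def transpose_def vec_eq_iff mult.commute)

lemma matrix_outer: "A ** outer u v = outer (A *v u) v"
  by (simp add: outer_def matrix_matrix_mult_def matrix_vector_mult_def vec_eq_iff sum_distrib_right mult.assoc)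

lemma outer_matrix: "outer u v ** A = outer u (transpose A *v v)"
  by (simp add: outer_def matrix_matrix_mult_def matrix_vector_mult_def transpose_def vec_eq_iff sum_distrib_left mult_ac)

lemma outer_outer: "outer u v ** outer x y = outer ((\<Sum>i\<in>UNIV. v $ i * x $ i) *s u) y"
  by (simp add: outer_def matrix_matrix_mult_def vec_eq_iff sum_distrib_left sum_distrib_right mult_ac)

text \<open>A transvection if \<open>b\<close> is orthogonal to \<open>u\<close>; its inverse is
  then \<open>shear u (- b)\<close>.\<close>

definition shear :: "'a::comm_ring_1 ^ 'n \<Rightarrow> 'a ^ 'n \<Rightarrow> ('a, 'n::finite) sqmat" where
  "shear u b = mat 1 + outer u b"

lemma shear_mult:
  assumes "(\<Sum>i\<in>UNIV. b $ i * u $ i) = 0"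
  shows "shear u b ** shear u c = shear u (b + c)"
proof -
  have "outer u b ** outer u c = 0"
    unfolding outer_outer assms by (simp add: outer_def vec_eq_iff)
  then show ?thesis
    by (simp add: shear_def matrix_add_ldistrib matrix_add_rdistrib outer_sum_right add_ac)
qed

lemma shear_0 [simp]: "shear u 0 = mat 1"
  by (simp add: shear_def outer_def vec_eq_iff)

definition posdef :: "(real, 'n::finite) sqmat \<Rightarrow> bool" where
  "posdef Y \<longleftrightarrow> (\<forall>v. v \<noteq> 0 \<longrightarrow> 0 < v \<bullet> (Y *v v))"

lemma siegel_posdef: "Z \<in> siegel \<longleftrightarrow> transpose Z = Z \<and> posdef (imat Z)"
  by (simp add: siegel_iff posdef_def)

lemma inner_transpose_mult: "u \<bullet> (transpose A *v v) = (A *v u) \<bullet> (v :: real ^ 'n::finite)"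
  by (simp add: dot_lmul_matrix inner_commute[of u] matrix_vector_mul_assoc)
    (metis dot_lmul_matrix inner_commute matrix_transpose_mul transpose_matrix_vector transpose_transpose)

lemma posdef_sandwich:
  fixes U Y :: "(real, 'n::finite) sqmat"
  assumes "posdef Y" "invertible U"
  shows "posdef (U ** Y ** transpose U)"
  unfolding posdef_def
proof (intro allI impI)
  fix v :: "real ^ 'n" assume "v \<noteq> 0"
  have "transpose (matrix_inv U) ** transpose U = mat 1"
    by (simp add: matrix_transpose_mul[symmetric] matrix_inv_mult[OF assms(2)] transpose_mat)
  then have "transpose U *v v \<noteq> 0"
    using \<open>v \<noteq> 0\<close> by (metis matrix_vector_mul_assoc matrix_vector_mul_lid matrix_vector_mult_0_right)
  moreover have "v \<bullet> ((U ** Y ** transpose U) *v v) = (transpose U *v v) \<bullet> (Y *v (transpose U *v v))"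
    using inner_transpose_mult[of v "transpose U"] by (simp add: matrix_vector_mul_assoc[symmetric])
  ultimately show "0 < v \<bullet> ((U ** Y ** transpose U) *v v)"
    using assms(1) by (simp add: posdef_def)
qed

lemma imat_add: "imat (A + B) = imat A + imat B"
  by (simp add: imat_def vec_eq_iff)

lemma imat_imatrix [simp]: "imat (imatrix S) = 0"
  by (simp add: imat_def imatrix_def vec_eq_iff)

lemma imat_sandwich: "imat (cmat A ** Z ** cmat B) = A ** imat Z ** B"
  by (simp add: imat_def cmat_def matrix_matrix_mult_def vec_eq_iff)

definition block :: "(int, 'n::finite) sqmat \<Rightarrow> (int, 'n) sqmat \<Rightarrow> (int, 'n) sqmat \<Rightarrow> (int, 'n) sqmat
    \<Rightarrow> (int, 'n + 'n) sqmat" where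
  "block A B C D = (\<chi> x y. case (x, y) of
      (Inl i, Inl j) \<Rightarrow> A $ i $ j | (Inl i, Inr j) \<Rightarrow> B $ i $ j
    | (Inr i, Inl j) \<Rightarrow> C $ i $ j | (Inr i, Inr j) \<Rightarrow> D $ i $ j)"

lemma blk_block [simp]: "blkA (block A B C D) = imatrix A" "blkB (block A B C D) = imatrix B"
    "blkC (block A B C D) = imatrix C" "blkD (block A B C D) = imatrix D"
  by (simp_all add: blkA_def blkB_def blkC_def blkD_def block_def imatrix_def vec_eq_iff)

lemma block_Sp:
  assumes "transpose A ** C = transpose C ** A" "transpose B ** D = transpose D ** B"
    "transpose A ** D = mat 1 + transpose C ** B"
  shows "block A B C D \<in> Sp"
proof -
  have 1: "(\<Sum>i\<in>UNIV. A $ i $ x * C $ i $ y) = (\<Sum>i\<in>UNIV. C $ i $ x * A $ i $ y)" for x y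
    using arg_cong[OF assms(1), of "\<lambda>M. M $ x $ y"] by (simp add: matrix_matrix_mult_def transpose_def)
  have 2: "(\<Sum>i\<in>UNIV. B $ i $ x * D $ i $ y) = (\<Sum>i\<in>UNIV. D $ i $ x * B $ i $ y)" for x y
    using arg_cong[OF assms(2), of "\<lambda>M. M $ x $ y"] by (simp add: matrix_matrix_mult_def transpose_def)
  have 3: "(\<Sum>i\<in>UNIV. A $ i $ x * D $ i $ y) = (if x = y then 1 else 0) + (\<Sum>i\<in>UNIV. C $ i $ x * B $ i $ y)" for x y
    using arg_cong[OF assms(3), of "\<lambda>M. M $ x $ y"] by (simp add: matrix_matrix_mult_def transpose_def mat_def)
  have 4: "(\<Sum>i\<in>UNIV. B $ i $ x * C $ i $ y) = (\<Sum>i\<in>UNIV. D $ i $ x * A $ i $ y) - (if x = y then 1 else 0)" for x y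
    using 3[of y x] by (simp add: mult.commute eq_commute[of y x])
  show ?thesis
    unfolding Sp_iff
  proof (intro allI)
    fix x y :: "'a + 'a"
    show "(\<Sum>i\<in>UNIV. block A B C D $ Inl i $ x * block A B C D $ Inr i $ y) -
        (\<Sum>i\<in>UNIV. block A B C D $ Inr i $ x * block A B C D $ Inl i $ y) = sympl_J $ x $ y"
      by (cases x; cases y) (simp_all add: block_def sympl_J_def 1 2 3 4)
  qed
qed

lemma act_eqI:
  assumes "\<gamma> \<in> Sp" "Z \<in> siegel" "W ** cocycle \<gamma> Z = numer \<gamma> Z"
  shows "act \<gamma> Z = W"
proof -
  have "W ** (cocycle \<gamma> Z ** matrix_inv (cocycle \<gamma> Z)) = act \<gamma> Z"
    using assms(3) by (simp add: act_numer matrix_mul_assoc)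
  then show ?thesis by (simp add: matrix_inv_mult[OF invertible_cocycle[OF assms(1,2)]])
qed

lemma transpose_zero: "transpose (0 :: ('a::zero, 'n::finite) sqmat) = 0"
  by (simp add: transpose_def vec_eq_iff)

lemma translation_in_Sp:
  assumes Z: "Z \<in> siegel" and S: "transpose S = S"
  defines "\<gamma> \<equiv> block (mat 1) S 0 (mat 1)"
  shows "\<gamma> \<in> Sp" "cocycle \<gamma> Z = mat 1" "act \<gamma> Z = Z + imatrix S"
proof -
  show g: "\<gamma> \<in> Sp"
    unfolding \<gamma>_def by (rule block_Sp) (simp_all add: S transpose_mat transpose_zero)
  show J: "cocycle \<gamma> Z = mat 1"
    by (simp add: \<gamma>_def cocycle_def imatrix_mat imatrix_0)
  show "act \<gamma> Z = Z + imatrix S"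
    by (rule act_eqI[OF g Z]) (simp add: J, simp add: \<gamma>_def numer_def imatrix_mat)
qed

locale sym2_form =
  fixes H :: "('n::{finite,linorder} cinf, 'n) sqmat"
  assumes sym: "transpose H = H"
    and hol: "siegel_holomorphic (H $ i $ j)"
    and law: "\<gamma> \<in> Sp \<Longrightarrow> Z \<in> siegel \<Longrightarrow>
      mat_at H (act \<gamma> Z) = cocycle \<gamma> Z ** mat_at H Z ** transpose (cocycle \<gamma> Z)"
begin

lemma translate:
  assumes Z: "Z \<in> siegel" and S: "transpose S = S"
  shows "mat_at H (Z + imatrix S) = mat_at H Z"
  using law[OF translation_in_Sp(1)[OF Z S] Z]
  by (simp add: translation_in_Sp(2,3)[OF Z S] transpose_mat)

text \<open>The inverse \<open>V\<close> is carried along explicitly, as the lower block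
  \<open>V^t\<close> of the symplectic matrix has to be integral.\<close>

lemma unimodular:
  assumes Z: "Z \<in> siegel" and UV: "U ** V = mat 1" "V ** U = (mat 1 :: (int, 'n) sqmat)"
  shows "mat_at H (imatrix U ** Z ** transpose (imatrix U)) =
    transpose (imatrix V) ** mat_at H Z ** imatrix V"
    and "imatrix U ** Z ** transpose (imatrix U) \<in> siegel"
proof -
  let ?g = "block U 0 0 (transpose V)"
  have UV': "transpose U ** transpose V = mat 1"
    by (simp add: matrix_transpose_mul[symmetric] UV transpose_mat)
  have g: "?g \<in> Sp"
    by (rule block_Sp) (simp_all add: transpose_zero UV')
  have J: "cocycle ?g Z = transpose (imatrix V)"
    by (simp add: cocycle_def imatrix_0 imatrix_transpose)
  have "transpose (imatrix U) ** transpose (imatrix V) = mat 1"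
    unfolding imatrix_transpose[symmetric] imatrix_mult[symmetric] UV' by (rule imatrix_mat)
  then have a: "act ?g Z = imatrix U ** Z ** transpose (imatrix U)"
    by (intro act_eqI[OF g Z]) (simp add: J numer_def imatrix_0 matrix_mul_assoc[symmetric])
  show "mat_at H (imatrix U ** Z ** transpose (imatrix U)) = transpose (imatrix V) ** mat_at H Z ** imatrix V"
    using law[OF g Z] a by (simp add: J)
  show "imatrix U ** Z ** transpose (imatrix U) \<in> siegel"
    using act_siegel[OF g Z] a by simp
qed

end

section \<open>Koecher's principle\<close>

lemma transpose_affine: "transpose A = A \<Longrightarrow> transpose B = B \<Longrightarrow> transpose (A + mscale s B) = A + mscale s B"
  by (simp add: transpose_add transpose_mscale)

lemma affine_continuous:
  fixes f :: "('n::{finite,linorder}) cinf"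
  assumes "\<And>s. s \<in> T \<Longrightarrow> A + mscale s B \<in> siegel"
  shows "continuous_on T (\<lambda>s. fn f (A + mscale s B))"
proof -
  have "continuous_on T (\<lambda>s. fn f (symm (coords (A + mscale s B))))"
  proof (rule continuous_on_compose2[OF fn_continuous])
    show "continuous_on T (\<lambda>s. coords (A + mscale s B))"
      unfolding coords_def mscale_def by (intro continuous_on_vec_lambda) (auto intro!: continuous_intros)
  qed (use assms coords_chart in blast)
  then show ?thesis
    by (rule continuous_on_eq) (use assms in \<open>simp add: symm_coords_siegel\<close>)
qed

lemma affine_holomorphic:
  fixes f :: "('n::{finite,linorder}) cinf"
  assumes f: "siegel_holomorphic f" and T: "open T"
    and A: "\<And>s. s \<in> T \<Longrightarrow> A + mscale s B \<in> siegel"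
  shows "(\<lambda>s. fn f (A + mscale s B)) holomorphic_on T"
proof (rule holomorphic_onI, rule field_differentiable_at_within)
  fix s assume s: "s \<in> T"
  let ?c = "\<lambda>s. coords (A + mscale s B)"
  have "(?c has_derivative (\<lambda>t. t *s coords B)) (at s)"
    unfolding has_derivative_vec_iff
    by (auto simp: coords_def mscale_def intro!: derivative_eq_intros)
  from has_derivative_compose[OF this holomorphic_has_derivative[OF f coords_chart[OF A[OF s]]]]
  have "((\<lambda>s. fn f (symm (?c s))) has_derivative
      (\<lambda>t. \<Sum>I\<in>UNIV. (t *s coords B) $ I * fn (pd I f) (symm (?c s)))) (at s)" .
  then have "((\<lambda>s. fn f (symm (?c s))) has_derivative
      (*) (\<Sum>I\<in>UNIV. coords B $ I * fn (pd I f) (symm (?c s)))) (at s)"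
    by (rule has_derivative_eq_rhs) (simp add: fun_eq_iff sum_distrib_left mult_ac)
  then have "((\<lambda>s. fn f (A + mscale s B)) has_derivative
      (*) (\<Sum>I\<in>UNIV. coords B $ I * fn (pd I f) (symm (?c s)))) (at s)"
    by (rule has_derivative_transform_within_open[OF _ T s]) (simp add: A symm_coords_siegel)
  then show "(\<lambda>s. fn f (A + mscale s B)) field_differentiable at s"
    by (auto simp: field_differentiable_def has_field_derivative_def)
qed

lemma shear_sandwich:
  fixes Y :: "('a::comm_ring_1, 'n::finite) sqmat"
  assumes "transpose Y = Y"
  shows "(shear u b ** Y ** transpose (shear u b)) $ i $ j = Y $ i $ j + u $ i * (Y *v b) $ j
    + (Y *v b) $ i * u $ j + (\<Sum>k\<in>UNIV. b $ k * (Y *v b) $ k) * (u $ i * u $ j)"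
proof -
  have t: "transpose (shear u b) = mat 1 + outer b u"
    by (simp add: shear_def transpose_add transpose_mat transpose_outer)
  have "shear u b ** Y ** transpose (shear u b) = Y + outer u (Y *v b) + (outer (Y *v b) u + outer u (Y *v b) ** outer b u)"
    unfolding t by (simp add: shear_def matrix_add_ldistrib matrix_add_rdistrib outer_matrix matrix_outer assms
        matrix_vector_mult_add_rdistrib outer_sum_left)
  then show ?thesis
    by (simp add: outer_outer) (simp add: outer_def mult_ac)
qed

lemma quadratic_add_outer:
  fixes Y :: "(real, 'n::finite) sqmat"
  shows "v \<bullet> ((Y + c *\<^sub>R outer u u) *v v) = v \<bullet> (Y *v v) + c * (u \<bullet> v)\<^sup>2"
  by (simp add: matrix_vector_mult_add_rdistrib inner_add_right)
    (simp add: inner_vec_def matrix_vector_mult_def outer_def power2_eq_square sum_distrib_left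
      sum_distrib_right mult_ac)

lemma posdef_add_outer:
  assumes "posdef Y" "0 \<le> c"
  shows "posdef (Y + c *\<^sub>R outer u u)"
  unfolding posdef_def
proof (intro allI impI)
  fix v :: "real ^ 'a" assume "v \<noteq> 0"
  have "v \<bullet> ((Y + c *\<^sub>R outer u u) *v v) = v \<bullet> (Y *v v) + c * (u \<bullet> v)\<^sup>2"
    by (rule quadratic_add_outer)
  moreover have "0 < v \<bullet> (Y *v v)" using assms(1) \<open>v \<noteq> 0\<close> by (simp add: posdef_def)
  ultimately show "0 < v \<bullet> ((Y + c *\<^sub>R outer u u) *v v)" using assms(2)
    by (simp add: add_pos_nonneg)
qed

lemma posdef_invertible:
  assumes "posdef (Y :: (real, 'n::finite) sqmat)"
  shows "invertible Y"
proof -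
  have "x = 0" if "Y *v x = 0" for x
    using assms that unfolding posdef_def by force
  then show ?thesis unfolding invertible_left_inverse matrix_left_invertible_ker by blast
qed

text \<open>The preimage of \<open>p\<close> under \<open>Y\<close> is corrected by a multiple of
  the preimage of \<open>l\<close> so as to be orthogonal to \<open>l\<close>. Shearing
  \<open>Y\<close> by \<open>\<sigma> \<beta>\<close> then moves it by
  \<open>\<sigma> (l p^t + p l^t)\<close> up to a multiple of \<open>l l^t\<close>.\<close>

lemma posdef_solve:
  fixes Y :: "(real, 'n::finite) sqmat"
  assumes Y: "posdef Y" and p: "p \<notin> range (\<lambda>c. c *\<^sub>R l)" "l \<noteq> 0"
  obtains \<beta> r where "\<beta> \<bullet> l = 0" "Y *v \<beta> = p + r *\<^sub>R l" "0 < \<beta> \<bullet> (Y *v \<beta>)"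
proof -
  define x where "x = matrix_inv Y *v p"
  define y where "y = matrix_inv Y *v l"
  have Yx: "Y *v x = p" and Yy: "Y *v y = l"
    by (simp_all add: x_def y_def matrix_vector_mul_assoc matrix_inv_mult[OF posdef_invertible[OF Y]])
  have "y \<noteq> 0" using Yy p(2) by auto
  then have ly: "0 < y \<bullet> l" using Y unfolding posdef_def by (metis Yy)
  define r where "r = - (x \<bullet> l) / (y \<bullet> l)"
  define \<beta> where "\<beta> = x + r *\<^sub>R y"
  have 1: "\<beta> \<bullet> l = 0" using ly by (simp add: \<beta>_def r_def inner_add_left inner_diff_left)
  have 2: "Y *v \<beta> = p + r *\<^sub>R l"
    by (simp add: \<beta>_def matrix_vector_right_distrib Yx Yy matrix_vector_mult_scaleR)
  have "\<beta> \<noteq> 0"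
  proof
    assume "\<beta> = 0"
    then have "p = (- r) *\<^sub>R l" using 2 by (simp add: eq_neg_iff_add_eq_0)
    then show False using p(1) by blast
  qed
  then have "0 < \<beta> \<bullet> (Y *v \<beta>)" using Y by (simp add: posdef_def)
  with 1 2 show ?thesis by (rule that)
qed

lemma imatrix_inject: "imatrix A = imatrix B \<longleftrightarrow> A = B"
  by (simp add: imatrix_def vec_eq_iff)

lemma Ints_imatrix:
  assumes "\<And>i j. A $ i $ j \<in> \<int>"
  obtains U where "imatrix U = cmat A"
proof -
  have "imatrix (\<chi> i j. \<lfloor>A $ i $ j\<rfloor>) = cmat A"
    using assms by (simp add: imatrix_def cmat_def vec_eq_iff complex_eq_iff)
  then show ?thesis by (rule that)
qed

lemma compact_shear_orbit:
  "compact ((\<lambda>f. shear l f ** Y ** transpose (shear l f)) ` {f :: real ^ 'n::finite. f \<bullet> l = 0 \<and> norm f \<le> R})"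
proof (rule compact_continuous_image)
  show "continuous_on {f. f \<bullet> l = 0 \<and> norm f \<le> R} (\<lambda>f. shear l f ** Y ** transpose (shear l f))"
    unfolding shear_def outer_def matrix_matrix_mult_def transpose_def plus_vec_def
    by (intro continuous_on_vec_lambda) (auto intro!: continuous_intros)
  have "{f. f \<bullet> l = 0 \<and> norm f \<le> R} = {f. f \<bullet> l = 0} \<inter> cball 0 R" by auto
  moreover have "closed {f. f \<bullet> l = 0}"
    by (intro closed_Collect_eq continuous_intros)
  ultimately show "compact {f. f \<bullet> l = 0 \<and> norm f \<le> R}"
    by (simp add: closed_Int_compact)
qed

context sym2_form
begin

text \<open>Integral translations bring the real parts into \<open>[0, 1]\<close>, which leaves a
  compact set of arguments.\<close>

lemma bounded_on_compact_imat:
  assumes K: "compact \<Y>" "\<And>Y. Y \<in> \<Y> \<Longrightarrow> posdef Y"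
  shows "\<exists>B\<ge>0. \<forall>Z. transpose Z = Z \<longrightarrow> imat Z \<in> \<Y> \<longrightarrow> (\<forall>i j. cmod (mat_at H Z $ i $ j) \<le> B)"
proof -
  define C :: "(complex ^ 'n idx) set"
    where "C = {z. (\<forall>I. 0 \<le> Re (z $ I) \<and> Re (z $ I) \<le> 1) \<and> imat (symm z) \<in> \<Y>}"
  have sub: "C \<subseteq> siegel_chart"
    using K(2) by (auto simp: C_def siegel_chart_def siegel_posdef)
  obtain R where R: "\<And>Y. Y \<in> \<Y> \<Longrightarrow> norm Y \<le> R"
    using compact_imp_bounded[OF K(1)] by (auto simp: bounded_iff)
  have "norm z \<le> (\<Sum>I::'n idx\<in>UNIV. 1 + R)" if "z \<in> C" for z
  proof -
    have "cmod (z $ I) \<le> 1 + R" for I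
    proof -
      define i j where "i = fst (Rep_idx I)" and "j = snd (Rep_idx I)"
      have I: "I = idx i j" by (simp add: i_def j_def idx_Rep)
      have "\<bar>Im (z $ I)\<bar> = norm (imat (symm z) $ i $ j)"
        unfolding I by (simp add: imat_def symm_nth)
      also have "\<dots> \<le> norm (imat (symm z))"
        by (rule order.trans[OF Finite_Cartesian_Product.norm_nth_le Finite_Cartesian_Product.norm_nth_le])
      also have "\<dots> \<le> R" using R that by (simp add: C_def)
      finally have "\<bar>Im (z $ I)\<bar> \<le> R" .
      moreover have "\<bar>Re (z $ I)\<bar> \<le> 1" using that by (simp add: C_def)
      ultimately show ?thesis using cmod_le[of "z $ I"] by linarith
    qed
    then have "(\<Sum>I\<in>UNIV. cmod (z $ I)) \<le> (\<Sum>I::'n idx\<in>UNIV. 1 + R)" by (intro sum_mono) auto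
    moreover have "norm z \<le> (\<Sum>I\<in>UNIV. cmod (z $ I))"
      unfolding norm_vec_def by (rule L2_set_le_sum) auto
    ultimately show ?thesis by linarith
  qed
  then have bC: "bounded C" by (auto simp: bounded_iff)
  have "continuous_on UNIV (\<lambda>z. imat (symm z) :: (real, 'n) sqmat)"
    unfolding imat_def symm_def by (intro continuous_on_vec_lambda) (auto intro!: continuous_intros)
  then have "closed ((\<lambda>z. imat (symm z)) -` \<Y>)"
    using continuous_closed_vimage compact_imp_closed[OF K(1)] continuous_on_eq_continuous_at open_UNIV by blast
  moreover have "closed {z :: complex ^ 'n idx. 0 \<le> Re (z $ I)}" "closed {z :: complex ^ 'n idx. Re (z $ I) \<le> 1}" for I
    by (intro closed_Collect_le continuous_intros)+
  moreover have "C = (\<Inter>I. {z. 0 \<le> Re (z $ I)} \<inter> {z. Re (z $ I) \<le> 1}) \<inter> ((\<lambda>z. imat (symm z)) -` \<Y>)"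
    by (auto simp: C_def)
  ultimately have "closed C" by (metis (no_types, lifting) closed_INT closed_Int)
  with bC have cC: "compact C" by (simp add: compact_eq_bounded_closed)
  have "\<exists>B. \<forall>z\<in>C. cmod (fn (H $ i $ j) (symm z)) \<le> B" for i j
  proof -
    have "compact ((\<lambda>z. fn (H $ i $ j) (symm z)) ` C)"
      by (rule compact_continuous_image[OF continuous_on_subset[OF fn_continuous sub] cC])
    then show ?thesis using compact_imp_bounded by (force simp: bounded_iff)
  qed
  then obtain b where b: "\<And>i j z. z \<in> C \<Longrightarrow> cmod (fn (H $ i $ j) (symm z)) \<le> b i j" by metis
  define B where "B = (\<Sum>i\<in>UNIV. \<Sum>j\<in>UNIV. \<bar>b i j\<bar>)"
  have B: "\<bar>b i j\<bar> \<le> B" for i j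
  proof -
    have "\<bar>b i j\<bar> \<le> (\<Sum>j\<in>UNIV. \<bar>b i j\<bar>)" by (intro member_le_sum) auto
    also have "\<dots> \<le> B" unfolding B_def
      by (rule member_le_sum[of i UNIV "\<lambda>i. \<Sum>j\<in>UNIV. \<bar>b i j\<bar>"]) (auto intro: sum_nonneg)
    finally show ?thesis .
  qed
  have "cmod (mat_at H Z $ i $ j) \<le> B" if Z: "transpose Z = Z" "imat Z \<in> \<Y>" for Z i j
  proof -
    have Zs: "Z \<in> siegel" using Z K(2) by (simp add: siegel_posdef)
    define S where "S = (\<chi> i j. - \<lfloor>Re (Z $ i $ j)\<rfloor>)"
    have S: "transpose S = S"
      using siegel_sym[OF Zs] by (simp add: S_def transpose_def vec_eq_iff)
    define Z' where "Z' = Z + imatrix S"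
    have Z': "transpose Z' = Z'"
      by (simp add: Z'_def transpose_add Z(1) imatrix_transpose[symmetric] S)
    have "coords Z' \<in> C"
    proof -
      have "Re (Z' $ i $ j) = frac (Re (Z $ i $ j))" for i j
        by (simp add: Z'_def S_def imatrix_def frac_def)
      then have "0 \<le> Re (Z' $ i $ j) \<and> Re (Z' $ i $ j) \<le> 1" for i j
        by (simp add: frac_lt_1 less_imp_le)
      moreover have "imat (symm (coords Z')) \<in> \<Y>"
        unfolding symm_coords[OF Z'] using Z(2) by (simp add: Z'_def imat_add)
      ultimately show ?thesis unfolding C_def by (simp add: coords_def)
    qed
    from b[OF this, of i j] B[of i j] have "cmod (fn (H $ i $ j) Z') \<le> B"
      by (simp add: symm_coords[OF Z'])
    then show ?thesis
      using translate[OF Zs S] by (simp add: Z'_def mat_at_def vec_eq_iff)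
  qed
  moreover have "0 \<le> B" unfolding B_def by (intro sum_nonneg) auto
  ultimately show ?thesis by blast
qed

text \<open>Reduction modulo the integral shears: \<open>\<sigma> \<beta>\<close> differs from an integral vector \<open>b\<close> by a
  bounded one, and \<open>shear l b\<close> acts with coefficients of size \<open>O(\<bar>\<sigma>\<bar>)\<close>.\<close>

lemma shear_growth:
  fixes l \<beta> :: "(real, 'n) vec" and Y :: "(real, 'n) sqmat"
  assumes la: "l $ a = 1" and N: "N > 0" "\<And>i. real N * l $ i \<in> \<int>"
    and Y: "posdef Y" and \<beta>: "\<beta> \<bullet> l = 0"
  shows "\<exists>C\<ge>0. \<forall>\<sigma> Z. transpose Z = Z \<longrightarrow>
    imat Z = shear l (\<sigma> *\<^sub>R \<beta>) ** Y ** transpose (shear l (\<sigma> *\<^sub>R \<beta>)) \<longrightarrow>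
    (\<forall>i k. cmod (mat_at H Z $ i $ k) \<le> C * (1 + \<bar>\<sigma>\<bar>)\<^sup>2)"
proof -
  \<comment> \<open>\<open>N ^ 2\<close> bounds each component of the remainder \<open>f\<close>
    except the one at \<open>a\<close>, and that one is recovered from
    \<open>f \<bullet> l = 0\<close> and \<open>l $ a = 1\<close>.\<close>
  define R where "R = (\<Sum>k::'n\<in>UNIV. real N ^ 2) + (\<Sum>k\<in>UNIV. \<bar>l $ k\<bar> * real N ^ 2)"
  have R0: "0 \<le> R" by (auto simp: R_def intro!: add_nonneg_nonneg sum_nonneg)
  define F where "F = {f :: (real, 'n) vec. f \<bullet> l = 0 \<and> norm f \<le> R}"
  define \<Y> where "\<Y> = (\<lambda>f. shear l f ** Y ** transpose (shear l f)) ` F"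
  have dot: "(\<Sum>i\<in>UNIV. f $ i * l $ i) = f \<bullet> l" for f by (simp add: inner_vec_def)
  have shear_inv: "shear l f ** shear l (- f) = mat 1" if "f \<bullet> l = 0" for f
    using shear_mult[of f l "- f"] that dot[of f] by simp
  have cY: "compact \<Y>" unfolding \<Y>_def F_def by (rule compact_shear_orbit)
  have pY: "posdef Y'" if Y': "Y' \<in> \<Y>" for Y'
  proof -
    obtain f where f: "f \<bullet> l = 0" "Y' = shear l f ** Y ** transpose (shear l f)"
      using Y' by (auto simp: \<Y>_def F_def)
    show ?thesis unfolding f(2)
      by (rule posdef_sandwich[OF Y]) (use shear_inv[OF f(1)] in \<open>auto simp: invertible_right_inverse\<close>)
  qed
  obtain B where B: "0 \<le> B"
    "\<And>Z i j. transpose Z = Z \<Longrightarrow> imat Z \<in> \<Y> \<Longrightarrow> cmod (mat_at H Z $ i $ j) \<le> B"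
    using bounded_on_compact_imat[OF cY pY] by blast
  \<comment> \<open>\<open>c * (1 + \<bar>\<sigma>\<bar>)\<close> will bound the entries of the
    integral shear; it acts on \<open>H\<close> from both sides, whence the square in the
    claim.\<close>
  define c where "c = 1 + norm l * (norm \<beta> + R)"
  have c: "0 \<le> c" using R0 by (simp add: c_def)
  define C where "C = (\<Sum>m::'n\<in>UNIV. \<Sum>n::'n\<in>UNIV. c * B * c)"
  have C: "0 \<le> C" unfolding C_def by (intro sum_nonneg mult_nonneg_nonneg c B)
  have "cmod (mat_at H Z $ i $ k) \<le> C * (1 + \<bar>\<sigma>\<bar>)\<^sup>2"
    if Z: "transpose Z = Z" "imat Z = shear l (\<sigma> *\<^sub>R \<beta>) ** Y ** transpose (shear l (\<sigma> *\<^sub>R \<beta>))" for \<sigma> Z i k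
  proof -
    \<comment> \<open>Multiples of \<open>N ^ 2\<close>, not of \<open>N\<close>: orthogonality to
      \<open>l\<close> makes \<open>b $ a\<close> a combination of the \<open>l $ k\<close>, so the
      entries \<open>l $ i * b $ a\<close> of the shear carry two denominators.\<close>
    define b0 where "b0 = (\<lambda>k. real N ^ 2 * of_int \<lfloor>\<sigma> * \<beta> $ k / real N ^ 2\<rfloor>)"
    define b :: "(real, 'n) vec" where "b = (\<chi> k. if k = a then - (\<Sum>k\<in>UNIV - {a}. b0 k * l $ k) else b0 k)"
    have bl: "b \<bullet> l = 0"
    proof -
      have "b \<bullet> l = b $ a * l $ a + (\<Sum>k\<in>UNIV - {a}. b $ k * l $ k)"
        unfolding dot[symmetric] by (subst sum.remove[of _ a]) auto
      also have "(\<Sum>k\<in>UNIV - {a}. b $ k * l $ k) = (\<Sum>k\<in>UNIV - {a}. b0 k * l $ k)"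
        by (rule sum.cong) (auto simp: b_def)
      finally show ?thesis by (simp add: b_def la)
    qed
    define f where "f = \<sigma> *\<^sub>R \<beta> - b"
    have fl: "f \<bullet> l = 0" by (simp add: f_def inner_diff_left \<beta> bl)
    have fk: "\<bar>f $ k\<bar> \<le> real N ^ 2" if "k \<noteq> a" for k
    proof -
      have "f $ k = real N ^ 2 * frac (\<sigma> * \<beta> $ k / real N ^ 2)"
        using that N(1) by (simp add: f_def b_def b0_def frac_def field_simps)
      moreover have "0 \<le> frac (\<sigma> * \<beta> $ k / real N ^ 2)" "frac (\<sigma> * \<beta> $ k / real N ^ 2) \<le> 1"
        by (auto intro: less_imp_le frac_lt_1)
      ultimately show ?thesis
        using N(1) by (simp add: abs_mult mult_left_le)
    qed
    have fa: "\<bar>f $ a\<bar> \<le> (\<Sum>k\<in>UNIV. \<bar>l $ k\<bar> * real N ^ 2)"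
    proof -
      have "f \<bullet> l = f $ a * l $ a + (\<Sum>k\<in>UNIV - {a}. f $ k * l $ k)"
        unfolding dot[symmetric] by (subst sum.remove[of _ a]) auto
      then have "f $ a = - (\<Sum>k\<in>UNIV - {a}. f $ k * l $ k)" using fl la by simp
      then have "\<bar>f $ a\<bar> \<le> (\<Sum>k\<in>UNIV - {a}. \<bar>f $ k * l $ k\<bar>)" by simp
      also have "\<dots> \<le> (\<Sum>k\<in>UNIV - {a}. \<bar>l $ k\<bar> * real N ^ 2)"
        unfolding abs_mult by (subst mult.commute, intro sum_mono mult_left_mono fk) auto
      also have "\<dots> \<le> (\<Sum>k\<in>UNIV. \<bar>l $ k\<bar> * real N ^ 2)"
        by (intro sum_mono2) auto
      finally show ?thesis .
    qed
    have nf: "norm f \<le> R"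
    proof -
      have "(\<Sum>k\<in>UNIV. \<bar>f $ k\<bar>) = \<bar>f $ a\<bar> + (\<Sum>k\<in>UNIV - {a}. \<bar>f $ k\<bar>)"
        by (subst sum.remove[of _ a]) auto
      also have "(\<Sum>k\<in>UNIV - {a}. \<bar>f $ k\<bar>) \<le> (\<Sum>k\<in>UNIV - {a}. real N ^ 2)"
        by (intro sum_mono fk) auto
      also have "\<dots> \<le> (\<Sum>k::'n\<in>UNIV. real N ^ 2)" by (intro sum_mono2) auto
      finally show ?thesis using norm_le_l1_cart[of f] fa by (simp add: R_def)
    qed
    have fF: "f \<in> F" by (simp add: F_def fl nf)
    have Nb: "(real N * x) * (real N * y) * of_int n \<in> \<int>" if "real N * x \<in> \<int>" "real N * y \<in> \<int>" for x y n
      by (rule Ints_mult[OF Ints_mult[OF that] Ints_of_int])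
    have lb: "l $ i * b $ k \<in> \<int>" for i k
    proof (cases "k = a")
      case True
      have "l $ i * b $ k = - (\<Sum>k\<in>UNIV - {a}. (real N * l $ i) * (real N * l $ k) * of_int \<lfloor>\<sigma> * \<beta> $ k / real N ^ 2\<rfloor>)"
        using True by (simp add: b_def b0_def sum_distrib_left power2_eq_square mult_ac)
      also have "\<dots> \<in> \<int>" by (intro Ints_minus Ints_sum Nb N)
      finally show ?thesis .
    next
      case False
      have "l $ i * b $ k = (real N * l $ i) * (real N * 1) * of_int \<lfloor>\<sigma> * \<beta> $ k / real N ^ 2\<rfloor>"
        using False by (simp add: b_def b0_def power2_eq_square mult_ac)
      also have "\<dots> \<in> \<int>" by (intro Nb N) auto
      finally show ?thesis .
    qed
    have shI: "shear l b $ i $ k \<in> \<int>" "shear l (- b) $ i $ k \<in> \<int>" for i k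
      using lb[of i k] by (auto simp: shear_def outer_def mat_def)
    obtain U where U: "imatrix U = cmat (shear l b)" by (rule Ints_imatrix[OF shI(1)])
    obtain V where V: "imatrix V = cmat (shear l (- b))" by (rule Ints_imatrix[OF shI(2)])
    have UV: "U ** V = mat 1" "V ** U = mat 1"
      unfolding imatrix_inject[symmetric] imatrix_mult imatrix_mat U V cmat_mult[symmetric]
      using shear_inv[of b] shear_inv[of "- b"] bl by (simp_all add: cmat_mat)
    define Z' where "Z' = imatrix V ** Z ** transpose (imatrix V)"
    have Z'sym: "transpose Z' = Z'" by (simp add: Z'_def matrix_transpose_mul Z(1) matrix_mul_assoc)
    have "imat Z' = shear l (- b) ** (shear l (\<sigma> *\<^sub>R \<beta>) ** Y ** transpose (shear l (\<sigma> *\<^sub>R \<beta>))) ** transpose (shear l (- b))"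
      unfolding Z'_def V cmat_transpose[symmetric] imat_sandwich Z(2) ..
    also have "\<dots> = (shear l (- b) ** shear l (\<sigma> *\<^sub>R \<beta>)) ** Y ** transpose (shear l (- b) ** shear l (\<sigma> *\<^sub>R \<beta>))"
      by (simp add: matrix_transpose_mul matrix_mul_assoc)
    also have "shear l (- b) ** shear l (\<sigma> *\<^sub>R \<beta>) = shear l f"
      using shear_mult[of "- b" l "\<sigma> *\<^sub>R \<beta>"] dot[of "- b"] bl by (simp add: f_def)
    finally have "imat Z' \<in> \<Y>" using fF by (simp add: \<Y>_def)
    then have Z's: "Z' \<in> siegel" using pY Z'sym by (simp add: siegel_posdef)
    have hB: "cmod (mat_at H Z' $ m $ n) \<le> B" for m n
      using B(2)[OF Z'sym \<open>imat Z' \<in> \<Y>\<close>] .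
    have "imatrix U ** Z' ** transpose (imatrix U) = (imatrix U ** imatrix V) ** Z ** transpose (imatrix U ** imatrix V)"
      by (simp add: Z'_def matrix_transpose_mul matrix_mul_assoc)
    then have ZZ': "imatrix U ** Z' ** transpose (imatrix U) = Z"
      by (simp add: imatrix_mult[symmetric] UV imatrix_mat transpose_mat)
    have hZ: "mat_at H Z = transpose (imatrix V) ** mat_at H Z' ** imatrix V"
      using unimodular(1)[OF Z's UV] unfolding ZZ' .
    have Vb: "cmod (imatrix V $ m $ n) \<le> c * (1 + \<bar>\<sigma>\<bar>)" for m n
    proof -
      have "\<bar>b $ n\<bar> \<le> \<bar>\<sigma>\<bar> * norm \<beta> + R"
      proof -
        have "b $ n = \<sigma> * \<beta> $ n - f $ n" by (simp add: f_def)
        then have "\<bar>b $ n\<bar> \<le> \<bar>\<sigma>\<bar> * \<bar>\<beta> $ n\<bar> + \<bar>f $ n\<bar>"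
          using abs_triangle_ineq4[of "\<sigma> * \<beta> $ n" "f $ n"] by (simp add: abs_mult)
        also have "\<dots> \<le> \<bar>\<sigma>\<bar> * norm \<beta> + norm f"
          by (intro add_mono mult_left_mono component_le_norm_cart) auto
        finally show ?thesis using nf by linarith
      qed
      also have "\<dots> \<le> (norm \<beta> + R) * (1 + \<bar>\<sigma>\<bar>)" using R0 by (simp add: algebra_simps)
      finally have bn: "\<bar>b $ n\<bar> \<le> (norm \<beta> + R) * (1 + \<bar>\<sigma>\<bar>)" .
      have "cmod (imatrix V $ m $ n) = \<bar>shear l (- b) $ m $ n\<bar>"
        unfolding V by (simp add: cmat_def)
      also have "\<dots> \<le> 1 + \<bar>l $ m\<bar> * \<bar>b $ n\<bar>"
        using abs_triangle_ineq4[of "mat 1 $ m $ n" "l $ m * b $ n"]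
        by (simp add: shear_def outer_def mat_def abs_mult split: if_splits)
      also have "\<dots> \<le> 1 + norm l * ((norm \<beta> + R) * (1 + \<bar>\<sigma>\<bar>))"
        by (intro add_left_mono mult_mono component_le_norm_cart bn) auto
      also have "\<dots> \<le> c * (1 + \<bar>\<sigma>\<bar>)"
        by (simp add: c_def algebra_simps)
      finally show ?thesis .
    qed
    have "mat_at H Z $ i $ k = (\<Sum>n\<in>UNIV. \<Sum>m\<in>UNIV. imatrix V $ m $ i * mat_at H Z' $ m $ n * imatrix V $ n $ k)"
      unfolding hZ by (simp add: matrix_matrix_mult_def transpose_def sum_distrib_right)
    also have "cmod \<dots> \<le> (\<Sum>n\<in>UNIV. \<Sum>m\<in>UNIV. cmod (imatrix V $ m $ i * mat_at H Z' $ m $ n * imatrix V $ n $ k))"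
      by (intro order.trans[OF norm_sum] sum_mono norm_sum)
    also have "\<dots> \<le> (\<Sum>n::'n\<in>UNIV. \<Sum>m::'n\<in>UNIV. (c * (1 + \<bar>\<sigma>\<bar>)) * B * (c * (1 + \<bar>\<sigma>\<bar>)))"
      unfolding norm_mult by (intro sum_mono mult_mono Vb hB) (auto intro!: mult_nonneg_nonneg c B(1))
    also have "\<dots> = C * (1 + \<bar>\<sigma>\<bar>)\<^sup>2"
      by (simp add: C_def power2_eq_square mult_ac)
    finally show ?thesis .
  qed
  then show ?thesis using C by blast
qed

text \<open>The strip \<open>s \<mapsto> Z + s (l p\<^sup>t + p l\<^sup>t)\<close>, periodic in \<open>Re s\<close>, has its boundary over the shear
  orbit of \<open>Y\<close>, where \<open>shear_growth\<close> applies; the maximum principle gives the bound inside.\<close>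

lemma koecher_growth:
  fixes l :: "(real, 'n) vec" and Y :: "(real, 'n) sqmat"
  assumes la: "l $ a = 1" and N: "N > 0" "\<And>i. real N * l $ i \<in> \<int>" and ja: "j \<noteq> a"
    and Y: "posdef Y" "transpose Y = Y"
  shows "\<exists>C\<ge>0. \<forall>\<eta>>0. \<forall>Z. transpose Z = Z \<longrightarrow> imat Z = Y + \<eta> *\<^sub>R outer l l \<longrightarrow>
    (\<forall>i k. cmod (mat_at H Z $ i $ k) \<le> C * (1 + \<eta>)\<^sup>2)"
proof -
  \<comment> \<open>A vector off the line of \<open>l\<close>, and integral, so that the strip has a
    period. It exists because there is a coordinate besides \<open>a\<close>.\<close>
  define p :: "(real, 'n) vec" where "p = axis j 1"
  have pa: "p $ a = 0" and pj: "p $ j = 1" using ja by (auto simp: p_def axis_def)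
  have "p \<noteq> c *\<^sub>R l" for c
  proof
    assume *: "p = c *\<^sub>R l"
    from arg_cong[OF *, of "\<lambda>v. v $ a"] have "c = 0" using pa la by simp
    with * pj show False by simp
  qed
  moreover have "l \<noteq> 0" using la by auto
  ultimately obtain \<beta> r where \<beta>: "\<beta> \<bullet> l = 0" "Y *v \<beta> = p + r *\<^sub>R l" "0 < \<beta> \<bullet> (Y *v \<beta>)"
    using posdef_solve[OF Y(1), of p l] by blast
  define \<kappa> where "\<kappa> = \<beta> \<bullet> (Y *v \<beta>)"
  have \<kappa>: "\<kappa> > 0" using \<beta>(3) by (simp add: \<kappa>_def)
  define D where "D = outer l p + outer p l"
  have sh: "shear l (\<sigma> *\<^sub>R \<beta>) ** Y ** transpose (shear l (\<sigma> *\<^sub>R \<beta>)) =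
      Y + \<sigma> *\<^sub>R D + (2 * r * \<sigma> + \<kappa> * \<sigma>\<^sup>2) *\<^sub>R outer l l" for \<sigma>
  proof -
    have q: "(\<Sum>k\<in>UNIV. (\<sigma> *\<^sub>R \<beta>) $ k * (Y *v (\<sigma> *\<^sub>R \<beta>)) $ k) = \<kappa> * \<sigma>\<^sup>2"
      by (simp add: \<kappa>_def inner_vec_def matrix_vector_mult_scaleR sum_distrib_left power2_eq_square mult_ac)
    have Yb: "(Y *v (\<sigma> *\<^sub>R \<beta>)) $ i = \<sigma> * (p $ i + r * l $ i)" for i
      by (simp add: matrix_vector_mult_scaleR \<beta>(2))
    show ?thesis
      unfolding vec_eq_iff shear_sandwich[OF Y(2)] q unfolding Yb
      by (simp add: D_def outer_def algebra_simps)
  qed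
  obtain C where C: "0 \<le> C" "\<And>\<sigma> Z i k. transpose Z = Z \<Longrightarrow>
      imat Z = shear l (\<sigma> *\<^sub>R \<beta>) ** Y ** transpose (shear l (\<sigma> *\<^sub>R \<beta>)) \<Longrightarrow>
      cmod (mat_at H Z $ i $ k) \<le> C * (1 + \<bar>\<sigma>\<bar>)\<^sup>2"
    using shear_growth[OF la N Y(1) \<beta>(1)] by blast
  have shear_pd: "posdef (Y + \<sigma> *\<^sub>R D + (2 * r * \<sigma> + \<kappa> * \<sigma>\<^sup>2) *\<^sub>R outer l l)" for \<sigma>
  proof -
    have "shear l (\<sigma> *\<^sub>R \<beta>) ** shear l (- (\<sigma> *\<^sub>R \<beta>)) = mat 1"
      by (subst shear_mult) (use \<beta>(1) in \<open>simp_all add: inner_vec_def sum_distrib_left[symmetric] mult.assoc\<close>)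
    then have "invertible (shear l (\<sigma> *\<^sub>R \<beta>))" by (auto simp: invertible_right_inverse)
    then show ?thesis unfolding sh[symmetric] by (rule posdef_sandwich[OF Y(1)])
  qed
  \<comment> \<open>Chosen so that \<open>1 + \<bar>\<sigma>\<bar> \<le> c * (1 + \<eta>)\<close> on
    the two edges of the strip.\<close>
  define c where "c = 2 + (1 + 2 * \<bar>r\<bar>) / \<kappa>"
  have c0: "c \<ge> 2" using \<kappa> by (simp add: c_def)
  have main: "cmod (mat_at H Z $ i $ k) \<le> C * c\<^sup>2 * (1 + \<eta>)\<^sup>2"
    if \<eta>: "\<eta> > 0" and Z: "transpose Z = Z" "imat Z = Y + \<eta> *\<^sub>R outer l l" for \<eta> Z i k
  proof -
    \<comment> \<open>The roots of \<open>\<kappa> \<sigma>^2 + 2 r \<sigma> = \<eta>\<close> are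
      \<open>s1 < 0 < s2\<close>. On these edges the imaginary part is exactly a shear of
      \<open>Y\<close>; between them it exceeds such a shear by a nonnegative multiple of
      \<open>l l^t\<close>.\<close>
    define q where "q = sqrt (r\<^sup>2 + \<kappa> * \<eta>)"
    have q2: "q\<^sup>2 = r\<^sup>2 + \<kappa> * \<eta>" using \<kappa> \<eta> by (simp add: q_def)
    have qr: "\<bar>r\<bar> < q"
      unfolding q_def by (rule real_less_rsqrt) (use \<kappa> \<eta> in simp)
    define s1 where "s1 = (- r - q) / \<kappa>"
    define s2 where "s2 = (- r + q) / \<kappa>"
    have s1: "s1 < 0" and s2: "0 < s2" using qr \<kappa> by (simp_all add: s1_def s2_def divide_neg_pos)
    have fac: "\<eta> - (2 * r * \<sigma> + \<kappa> * \<sigma>\<^sup>2) = \<kappa> * ((\<sigma> - s1) * (s2 - \<sigma>))" for \<sigma>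
    proof -
      have "\<kappa> * ((\<sigma> - s1) * (s2 - \<sigma>)) = (\<kappa> * \<sigma> - \<kappa> * s1) * (\<kappa> * s2 - \<kappa> * \<sigma>) / \<kappa>"
        using \<kappa> by (simp add: field_simps)
      also have "\<kappa> * s1 = - r - q" using \<kappa> by (simp add: s1_def)
      also have "\<kappa> * s2 = - r + q" using \<kappa> by (simp add: s2_def)
      also have "(\<kappa> * \<sigma> - (- r - q)) * (- r + q - \<kappa> * \<sigma>) = q\<^sup>2 - (\<kappa> * \<sigma> + r)\<^sup>2"
        by (simp add: power2_eq_square algebra_simps)
      also have "\<dots> / \<kappa> = \<eta> - (2 * r * \<sigma> + \<kappa> * \<sigma>\<^sup>2)"
        using \<kappa> unfolding q2 by (simp add: power2_eq_square field_simps)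
      finally show ?thesis by simp
    qed
    have bound_root: "\<bar>\<sigma>\<bar> \<le> 1 + (\<eta> + 2 * \<bar>r\<bar>) / \<kappa>" if "\<eta> = 2 * r * \<sigma> + \<kappa> * \<sigma>\<^sup>2" for \<sigma>
    proof (cases "\<bar>\<sigma>\<bar> \<le> 1")
      case True
      moreover have "0 \<le> (\<eta> + 2 * \<bar>r\<bar>) / \<kappa>" using \<eta> \<kappa> by simp
      ultimately show ?thesis by linarith
    next
      case False
      have "\<kappa> * (\<bar>\<sigma>\<bar> * \<bar>\<sigma>\<bar>) = \<eta> - 2 * r * \<sigma>" using that by (simp add: power2_eq_square)
      also have "\<dots> \<le> \<eta> * \<bar>\<sigma>\<bar> + 2 * \<bar>r\<bar> * \<bar>\<sigma>\<bar>"
      proof -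
        have "\<eta> \<le> \<eta> * \<bar>\<sigma>\<bar>" using False \<eta> by simp
        moreover have "- (r * \<sigma>) \<le> \<bar>r\<bar> * \<bar>\<sigma>\<bar>" by (metis abs_ge_minus_self abs_mult)
        ultimately show ?thesis by linarith
      qed
      finally have "(\<kappa> * \<bar>\<sigma>\<bar>) * \<bar>\<sigma>\<bar> \<le> (\<eta> + 2 * \<bar>r\<bar>) * \<bar>\<sigma>\<bar>" by (simp add: algebra_simps)
      then have "\<kappa> * \<bar>\<sigma>\<bar> \<le> \<eta> + 2 * \<bar>r\<bar>"
        using False mult_le_cancel_right_pos[of "\<bar>\<sigma>\<bar>"] by force
      then have "\<bar>\<sigma>\<bar> \<le> (\<eta> + 2 * \<bar>r\<bar>) / \<kappa>" using \<kappa> by (simp add: pos_le_divide_eq mult.commute)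
      then show ?thesis by simp
    qed
    have bound_c: "1 + \<bar>\<sigma>\<bar> \<le> c * (1 + \<eta>)" if "\<eta> = 2 * r * \<sigma> + \<kappa> * \<sigma>\<^sup>2" for \<sigma>
    proof -
      have "1 + \<bar>\<sigma>\<bar> \<le> 2 + (\<eta> + 2 * \<bar>r\<bar>) / \<kappa>" using bound_root[OF that] by simp
      also have "\<dots> \<le> 2 * (1 + \<eta>) + (1 + 2 * \<bar>r\<bar>) * (1 + \<eta>) / \<kappa>"
        by (intro add_mono divide_right_mono) (use \<eta> \<kappa> in \<open>auto simp: algebra_simps\<close>)
      finally show ?thesis by (simp add: c_def algebra_simps add_divide_distrib)
    qed
    let ?Z = "\<lambda>s. Z + mscale s (cmat D)"
    have Dsym: "transpose (cmat D) = cmat D"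
      by (simp add: cmat_transpose[symmetric] D_def transpose_add transpose_outer add.commute)
    have Zsym: "transpose (?Z s) = ?Z s" for s by (rule transpose_affine[OF Z(1) Dsym])
    have imZ: "imat (?Z s) = Y + Im s *\<^sub>R D + \<eta> *\<^sub>R outer l l" for s
      using Z(2) by (simp add: imat_def mscale_def cmat_def vec_eq_iff)
    have Zs: "?Z s \<in> siegel" if "s1 \<le> Im s" "Im s \<le> s2" for s
    proof -
      have "0 \<le> \<eta> - (2 * r * Im s + \<kappa> * (Im s)\<^sup>2)"
        unfolding fac using that \<kappa> by (intro mult_nonneg_nonneg) auto
      from posdef_add_outer[OF shear_pd this, of "Im s" l]
      have "posdef (Y + Im s *\<^sub>R D + \<eta> *\<^sub>R outer l l)"
        by (simp add: scaleR_left_diff_distrib add.assoc)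
      then show ?thesis by (simp add: siegel_posdef Zsym imZ)
    qed
    have "cmod (fn (H $ i $ k) (?Z 0)) \<le> C * (c * (1 + \<eta>))\<^sup>2"
    proof (rule strip_maximum[of s1 s2 "real N" "\<lambda>s. fn (H $ i $ k) (?Z s)" _ 0])
      show "s1 < s2" "0 < real N" "s1 \<le> Im 0" "Im 0 \<le> s2" using s1 s2 N by auto
      show "continuous_on {s. s1 \<le> Im s \<and> Im s \<le> s2} (\<lambda>s. fn (H $ i $ k) (?Z s))"
        by (rule affine_continuous) (use Zs in auto)
      have "{s. s1 < Im s \<and> Im s < s2} = {s. s1 < Im s} \<inter> {s. Im s < s2}" by auto
      then have "open {s. s1 < Im s \<and> Im s < s2}"
        by (simp add: open_Int open_halfspace_Im_gt open_halfspace_Im_lt)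
      then show "(\<lambda>s. fn (H $ i $ k) (?Z s)) holomorphic_on {s. s1 < Im s \<and> Im s < s2}"
        by (rule affine_holomorphic[OF hol]) (use Zs in auto)
      show "fn (H $ i $ k) (?Z (s + of_real (real N))) = fn (H $ i $ k) (?Z s)"
        if s: "s1 \<le> Im s" "Im s \<le> s2" for s
      proof -
        have "(real N *\<^sub>R D) $ x $ y \<in> \<int>" for x y
        proof -
          have "(real N *\<^sub>R D) $ x $ y = real N * l $ x * p $ y + p $ x * (real N * l $ y)"
            by (simp add: D_def outer_def algebra_simps)
          moreover have "p $ x \<in> \<int>" for x by (simp add: p_def axis_def)
          ultimately show ?thesis using N(2) by (auto intro!: Ints_add Ints_mult)
        qed
        then obtain S where S: "imatrix S = cmat (real N *\<^sub>R D)" using Ints_imatrix by blast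
        have SD: "imatrix S = mscale (of_real (real N)) (cmat D)"
          unfolding S by (simp add: cmat_def mscale_def vec_eq_iff)
        have "imatrix (transpose S) = imatrix S"
          unfolding imatrix_transpose SD by (simp add: transpose_mscale Dsym)
        then have Ssym: "transpose S = S" by (simp add: imatrix_inject)
        have "?Z (s + of_real (real N)) = ?Z s + imatrix S"
          unfolding SD by (simp add: mscale_def vec_eq_iff algebra_simps)
        then show ?thesis
          using arg_cong[OF translate[OF Zs[OF s] Ssym], of "\<lambda>M. M $ i $ k"] by (simp only: mat_at_def vec_lambda_beta)
      qed
      show "cmod (fn (H $ i $ k) (?Z s)) \<le> C * (c * (1 + \<eta>))\<^sup>2" if s: "Im s = s1 \<or> Im s = s2" for s
      proof -
        have e: "\<eta> = 2 * r * Im s + \<kappa> * (Im s)\<^sup>2" using fac[of "Im s"] s by auto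
        have "imat (?Z s) = shear l (Im s *\<^sub>R \<beta>) ** Y ** transpose (shear l (Im s *\<^sub>R \<beta>))"
          unfolding imZ sh e[symmetric] ..
        from C(2)[OF Zsym this, of i k]
        have "cmod (fn (H $ i $ k) (?Z s)) \<le> C * (1 + \<bar>Im s\<bar>)\<^sup>2" by (simp add: mat_at_def)
        also have "\<dots> \<le> C * (c * (1 + \<eta>))\<^sup>2"
          by (intro mult_left_mono power_mono bound_c[OF e] C(1)) auto
        finally show ?thesis .
      qed
    qed
    moreover have "?Z 0 = Z" by (simp add: mscale_def vec_eq_iff)
    ultimately show ?thesis by (simp add: mat_at_def power_mult_distrib mult.assoc)
  qed
  have "0 \<le> C * c\<^sup>2" using C(1) by simp
  with main show ?thesis by blast
qed

end

section \<open>Torsion leaves\<close>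

lemma sum_if_eq:
  fixes f g :: "'n::finite \<Rightarrow> 'a::comm_ring_1"
  shows "(\<Sum>m\<in>UNIV. f m * (if m = a then x else if m = k then 1 else 0)) = f a * x + (if k = a then 0 else f k)"
proof -
  have "(\<Sum>m\<in>UNIV. f m * (if m = a then x else if m = k then 1 else 0))
      = (\<Sum>m\<in>UNIV. (if m = a then f m * x else 0) + (if m = k then (if k = a then 0 else f k) else 0))"
    by (rule sum.cong) auto
  then show ?thesis by (simp add: sum.distrib)
qed

text \<open>The matrix \<open>C Z + D\<close> of the partial inversion, which acts like
  \<open>- 1 / \<tau>\<close> on the coordinate \<open>a\<close>.\<close>

definition inversion_cocycle :: "'n \<Rightarrow> (complex, 'n::finite) sqmat \<Rightarrow> (complex, 'n) sqmat" where
  "inversion_cocycle a Z = (\<chi> i k. if i = a then Z $ a $ k else if i = k then 1 else 0)"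

text \<open>The hypothesis is \<open>W J = A Z + B\<close> entry by entry, for
  \<open>A = D = 1 - E\<close>, \<open>C = E\<close>, \<open>B = - E\<close> with \<open>E\<close>
  the matrix unit at \<open>a\<close>. Thus a candidate \<open>W\<close> can be tested without
  inverting \<open>J\<close>.\<close>

lemma (in sym2_form) inversion:
  assumes Z: "Z \<in> siegel"
    and eq: "\<And>i k. W $ i $ a * Z $ a $ k + (if k = a then 0 else W $ i $ k) =
      (if i = a then (if k = a then - 1 else 0) else Z $ i $ k)"
  shows "mat_at H W = inversion_cocycle a Z ** mat_at H Z ** transpose (inversion_cocycle a Z)"
proof -
  define E :: "(int, 'n) sqmat" where "E = outer (axis a 1) (axis a 1)"
  have EE: "E ** E = E" and Et: "transpose E = E"
    by (simp_all add: E_def outer_outer transpose_outer axis_def if_distrib[of "(*) _"] cong: if_cong)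
  let ?g = "block (mat 1 - E) (- E) E (mat 1 - E)"
  have t: "transpose (mat 1 - E) = mat 1 - E" "transpose (- E) = - E"
    using Et by (simp_all add: transpose_def vec_eq_iff mat_def)
  have g: "?g \<in> Sp"
    by (rule block_Sp)
      (simp_all add: t Et EE matrix_diff_ldistrib matrix_diff_rdistrib matrix_minus_left matrix_minus_right)
  have Eik: "E $ i $ k = (if i = a \<and> k = a then 1 else 0)" for i k
    by (simp add: E_def outer_def axis_def)
  have Ec: "imatrix E $ i $ k = (if i = a \<and> k = a then 1 else 0)" for i k
    by (simp add: imatrix_def Eik)
  have EZ: "(imatrix E ** Z) $ i $ k = (if i = a then Z $ a $ k else 0)" for i k
    by (simp add: matrix_matrix_mult_def imatrix_def Eik if_distrib[of "\<lambda>x. x * _"] if_distrib[of of_int] cong: if_cong)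
  have i1: "imatrix (mat 1 - E) = mat 1 - imatrix E" "imatrix (- E) = - imatrix E"
    by (simp_all add: imatrix_def vec_eq_iff mat_def)
  have M: "(mat 1 :: (complex, 'n) sqmat) $ i $ k = (if i = k then 1 else 0)" for i k
    by (simp add: mat_def)
  have J: "cocycle ?g Z = inversion_cocycle a Z"
    by (auto simp: cocycle_def i1 vec_eq_iff EZ inversion_cocycle_def M Ec)
  have P: "numer ?g Z $ i $ k = (if i = a then (if k = a then - 1 else 0) else Z $ i $ k)" for i k
    by (auto simp: numer_def i1 matrix_diff_rdistrib EZ Ec)
  have "act ?g Z = W"
  proof (rule act_eqI[OF g Z])
    have "(W ** inversion_cocycle a Z) $ i $ k = W $ i $ a * Z $ a $ k + (if k = a then 0 else W $ i $ k)" for i k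
      by (simp add: matrix_matrix_mult_def inversion_cocycle_def sum_if_eq)
    then show "W ** cocycle ?g Z = numer ?g Z" by (simp add: vec_eq_iff J P eq)
  qed
  then show ?thesis using law[OF g Z] J by simp
qed

text \<open>For \<open>j \<noteq> a\<close>, row \<open>j\<close> of
  \<open>inversion_cocycle a Z\<close> is a unit vector.\<close>

lemma (in sym2_form) inversion_diag:
  assumes "Z \<in> siegel"
    and "\<And>i k. W $ i $ a * Z $ a $ k + (if k = a then 0 else W $ i $ k) =
      (if i = a then (if k = a then - 1 else 0) else Z $ i $ k)"
    and ja: "j \<noteq> a"
  shows "fn (H $ j $ j) W = fn (H $ j $ j) Z"
proof -
  have "fn (H $ j $ j) W = (inversion_cocycle a Z ** mat_at H Z ** transpose (inversion_cocycle a Z)) $ j $ j"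
    unfolding inversion[OF assms(1,2), symmetric] by (simp add: mat_at_def)
  also have "\<dots> = fn (H $ j $ j) Z"
    using ja by (simp add: matrix_matrix_mult_def transpose_def inversion_cocycle_def mat_at_def
        if_distrib[of "\<lambda>x. x * _"] if_distrib[of "(*) _"] cong: if_cong)
  finally show ?thesis .
qed

text \<open>The discs \<open>\<tau> \<mapsto> \<tau> u u\<^sup>t + e m\<^sup>t + m e\<^sup>t + W\<close> with \<open>u = e + l\<close> and \<open>e\<close> the \<open>a\<close>-th unit
  vector: the orbits \<open>z = l \<tau> + m\<close> of torsion type in the theory of Jacobi forms.\<close>

definition leaf :: "'n \<Rightarrow> complex \<Rightarrow> (real, 'n) vec \<Rightarrow> (real, 'n) vec \<Rightarrow> (complex, 'n::finite) sqmat
    \<Rightarrow> (complex, 'n) sqmat" where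
  "leaf a \<tau> l m W = (cmat (outer (axis a 1) m + outer m (axis a 1)) + W)
    + mscale \<tau> (cmat (outer (axis a 1 + l) (axis a 1 + l)))"

definition pd_off :: "'n \<Rightarrow> (complex, 'n::finite) sqmat \<Rightarrow> bool" where
  "pd_off a W \<longleftrightarrow> transpose W = W \<and> (\<forall>i. W $ a $ i = 0) \<and>
    (\<forall>v. v $ a = 0 \<longrightarrow> v \<noteq> 0 \<longrightarrow> 0 < v \<bullet> (imat W *v v))"

lemma pd_off_nth:
  assumes W: "pd_off a W"
  shows "W $ a $ i = 0" "W $ i $ a = 0"
proof -
  show 1: "W $ a $ i = 0" using W by (simp add: pd_off_def)
  have "transpose W $ i $ a = W $ i $ a" using W by (simp add: pd_off_def)
  then show "W $ i $ a = 0" using 1 by (simp add: transpose_def)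
qed

lemma leaf_nth:
  fixes \<tau> :: complex
  shows "leaf a \<tau> l m W $ i $ k =
    (if i = a then 1 else 0) * complex_of_real (m $ k) + complex_of_real (m $ i) * (if k = a then 1 else 0) + W $ i $ k
     + \<tau> * (((if i = a then 1 else 0) + complex_of_real (l $ i)) * ((if k = a then 1 else 0) + complex_of_real (l $ k)))"
  by (simp add: leaf_def cmat_def outer_def mscale_def axis_def)

lemma imat_cmat [simp]: "imat (cmat A) = 0"
  by (simp add: imat_def cmat_def vec_eq_iff)

lemma imat_mscale_cmat: "imat (mscale c (cmat A)) = Im c *\<^sub>R A"
  by (simp add: imat_def mscale_def cmat_def vec_eq_iff)

lemma imat_leaf: "imat (leaf a \<tau> l m W) = imat W + Im \<tau> *\<^sub>R outer (axis a 1 + l) (axis a 1 + l)"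
  by (simp add: leaf_def imat_add imat_mscale_cmat)

lemma imat_quadratic_off:
  assumes "\<And>i. W $ a $ i = 0" "\<And>i. W $ i $ a = 0"
  shows "v \<bullet> (imat W *v v) = (v - c *\<^sub>R axis a 1) \<bullet> (imat W *v (v - c *\<^sub>R axis a 1))"
proof -
  let ?w = "v - c *\<^sub>R axis a 1"
  have z: "imat W $ a $ i = 0" "imat W $ i $ a = 0" for i
    using assms[of i] by (simp_all add: imat_def)
  have "imat W $ i $ k * v $ k = imat W $ i $ k * ?w $ k" for i k
    using z by (cases "k = a") (auto simp: axis_def)
  then have Wv: "imat W *v v = imat W *v ?w"
    unfolding vec_eq_iff matrix_vector_mult_def vec_lambda_beta by (intro allI sum.cong refl)
  have "v $ i * (imat W *v ?w) $ i = ?w $ i * (imat W *v ?w) $ i" for i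
    using z by (cases "i = a") (auto simp: axis_def matrix_vector_mult_def)
  then show ?thesis unfolding Wv inner_vec_def inner_real_def by (intro sum.cong refl)
qed

text \<open>Split off the component of \<open>v\<close> at \<open>a\<close>. What remains is seen by
  \<open>W\<close>; if nothing remains, \<open>u $ a = 1\<close> makes the rank one term
  positive.\<close>

lemma posdef_off:
  assumes W: "pd_off a W" and c: "c > 0" and u: "u $ a = 1"
  shows "posdef (imat W + c *\<^sub>R outer u u)"
  unfolding posdef_def
proof (intro allI impI)
  fix v :: "(real, 'a) vec" assume v: "v \<noteq> 0"
  let ?w = "v - v $ a *\<^sub>R axis a 1"
  have "v \<bullet> ((imat W + c *\<^sub>R outer u u) *v v) = v \<bullet> (imat W *v v) + c * (u \<bullet> v)\<^sup>2"
    by (rule quadratic_add_outer)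
  also have "v \<bullet> (imat W *v v) = ?w \<bullet> (imat W *v ?w)" by (rule imat_quadratic_off) (rule pd_off_nth[OF W])+
  also have "0 < ?w \<bullet> (imat W *v ?w) + c * (u \<bullet> v)\<^sup>2"
  proof (cases "?w = 0")
    case True
    then have "v = v $ a *\<^sub>R axis a 1" by simp
    then have "u \<bullet> v = u \<bullet> (v $ a *\<^sub>R axis a 1)" by (rule arg_cong)
    then have uv: "u \<bullet> v = v $ a" using u by (simp add: inner_axis)
    have "v $ a \<noteq> 0" using True v by auto
    then show ?thesis using True uv c by simp
  next
    case False
    then have "0 < ?w \<bullet> (imat W *v ?w)" using W by (simp add: pd_off_def)
    then show ?thesis using c by (simp add: add_pos_nonneg)
  qed
  finally show "0 < v \<bullet> ((imat W + c *\<^sub>R outer u u) *v v)" .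
qed

lemma leaf_sym: "transpose W = W \<Longrightarrow> transpose (leaf a \<tau> l m W) = leaf a \<tau> l m W"
  unfolding leaf_def
  by (intro transpose_affine) (simp_all add: cmat_transpose[symmetric] transpose_add transpose_outer add.commute)

lemma leaf_siegel:
  assumes "pd_off a W" "0 < Im \<tau>" "l $ a = 0"
  shows "leaf a \<tau> l m W \<in> siegel"
  unfolding siegel_posdef imat_leaf
  using assms leaf_sym[of W] posdef_off[OF assms(1,2), of "axis a 1 + l"]
  by (simp add: pd_off_def axis_def)

lemma pd_off_add:
  assumes "pd_off a W" "transpose R = R" "\<And>i. R $ a $ i = 0"
  shows "pd_off a (W + cmat R)"
  using assms by (simp add: pd_off_def transpose_add cmat_transpose[symmetric] imat_add)
    (simp add: cmat_def)

context sym2_form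
begin

text \<open>In \<open>u u^t = e e^t + e l^t + l e^t + l l^t\<close> the first term is an integral
  translation, the mixed terms move \<open>m\<close> by \<open>l\<close>, and the last one moves
  \<open>W\<close>.\<close>

lemma leaf_T:
  assumes "pd_off a W" "0 < Im \<tau>" "l $ a = 0"
  shows "fn (H $ i $ k) (leaf a (\<tau> + 1) l m W) = fn (H $ i $ k) (leaf a \<tau> l (m + l) (W + cmat (outer l l)))"
proof -
  let ?S = "outer (axis a 1) (axis a 1) :: (int, 'n) sqmat"
  have pd: "pd_off a (W + cmat (outer l l))"
    by (rule pd_off_add[OF assms(1)]) (use assms(3) in \<open>simp_all add: transpose_outer, simp add: outer_def\<close>)
  have S: "transpose ?S = ?S" by (rule transpose_outer)
  have "leaf a (\<tau> + 1) l m W = leaf a \<tau> l (m + l) (W + cmat (outer l l)) + imatrix ?S"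
    unfolding vec_eq_iff by (simp add: leaf_nth) (simp add: cmat_def outer_def imatrix_def axis_def algebra_simps)
  then show ?thesis
    using arg_cong[OF translate[OF leaf_siegel[OF pd assms(2,3)] S], of "\<lambda>M. M $ i $ k"]
    by (simp only: mat_at_def vec_lambda_beta)
qed

lemma leaf_translate:
  assumes "pd_off a W" "0 < Im \<tau>" "l $ a = 0" "transpose S = S"
  shows "fn (H $ i $ k) (leaf a \<tau> l (m + (\<chi> i. of_int (n $ i))) (W + imatrix S)) = fn (H $ i $ k) (leaf a \<tau> l m W)"
proof -
  let ?S = "outer (axis a 1) n + outer n (axis a 1) + S"
  have S: "transpose ?S = ?S" by (simp add: transpose_add transpose_outer assms(4) add.commute)
  have "leaf a \<tau> l (m + (\<chi> i. of_int (n $ i))) (W + imatrix S) = leaf a \<tau> l m W + imatrix ?S"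
    unfolding vec_eq_iff by (simp add: leaf_nth) (simp add: outer_def imatrix_def axis_def algebra_simps)
  then show ?thesis
    using arg_cong[OF translate[OF leaf_siegel[OF assms(1,2,3)] S], of "\<lambda>M. M $ i $ k"]
    by (simp only: mat_at_def vec_lambda_beta)
qed

text \<open>The pair \<open>(l, m)\<close> is rotated to \<open>(- m, l)\<close>, as for the
  elliptic torsion point \<open>l \<tau> + m\<close>, which inversion divides by
  \<open>\<tau>\<close>. \<open>W\<close> changes only by a real matrix.\<close>

lemma leaf_S:
  assumes W: "pd_off a W" and \<tau>: "0 < Im \<tau>" and l: "l $ a = 0" and m: "m $ a = 0" and ja: "j \<noteq> a"
  shows "fn (H $ j $ j) (leaf a (- 1 / \<tau>) (- m) l (W - cmat (outer l m + outer m l))) =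
    fn (H $ j $ j) (leaf a \<tau> l m W)"
proof (rule inversion_diag[OF leaf_siegel[OF W \<tau> l] _ ja])
  fix i k
  have t0: "\<tau> \<noteq> 0" using \<tau> by auto
  note z = pd_off_nth[OF W]
  show "leaf a (- 1 / \<tau>) (- m) l (W - cmat (outer l m + outer m l)) $ i $ a * leaf a \<tau> l m W $ a $ k +
      (if k = a then 0 else leaf a (- 1 / \<tau>) (- m) l (W - cmat (outer l m + outer m l)) $ i $ k) =
      (if i = a then if k = a then - 1 else 0 else leaf a \<tau> l m W $ i $ k)"
    using t0 l m z by (cases "i = a"; cases "k = a") (simp_all add: leaf_nth cmat_def outer_def field_simps)
qed

text \<open>The integral shear \<open>1 + n e^t\<close> sends \<open>e\<close> to
  \<open>e + n\<close> and fixes \<open>l\<close>, \<open>m\<close> and \<open>W\<close>. So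
  \<open>u\<close> becomes \<open>u + n\<close>, and \<open>e m^t + m e^t\<close> leaves a remainder
  that joins \<open>W\<close>. Column \<open>j \<noteq> a\<close> of the inverse shear is a unit
  vector, hence the diagonal entry is unchanged.\<close>

lemma leaf_shear:
  fixes n :: "(int, 'n) vec"
  assumes W: "pd_off a W" and \<tau>: "0 < Im \<tau>" and l: "l $ a = 0" and m: "m $ a = 0" and ja: "j \<noteq> a"
    and n: "n $ a = 0"
  defines "r \<equiv> (\<chi> i. real_of_int (n $ i))"
  shows "fn (H $ j $ j) (leaf a \<tau> (l + r) m (W + cmat (outer r m + outer m r))) = fn (H $ j $ j) (leaf a \<tau> l m W)"
proof -
  let ?U = "shear n (axis a 1)" and ?V = "shear n (- axis a 1)"
  have UV: "?U ** ?V = mat 1" "?V ** ?U = mat 1"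
    by (subst shear_mult; use n in \<open>simp add: axis_def if_distrib[of "\<lambda>x. x * _"] sum_negf cong: if_cong\<close>)+
  note Z = leaf_siegel[OF W \<tau> l, of m]
  have U: "imatrix ?U = shear (cvec r) (axis a 1)"
    by (simp add: imatrix_def shear_def outer_def mat_def cvec_def r_def axis_def vec_eq_iff)
  have col: "(Z *v axis a 1) $ i = Z $ i $ a" for Z :: "(complex, 'n) sqmat" and i
    by (simp add: matrix_vector_mult_def axis_def if_distrib[of "(*) _"] cong: if_cong)
  have q: "(\<Sum>k\<in>UNIV. axis a 1 $ k * Z $ k $ a) = Z $ a $ a" for Z :: "(complex, 'n) sqmat"
    by (simp add: axis_def if_distrib[of "\<lambda>x. x * _"] cong: if_cong)
  have sand: "imatrix ?U ** leaf a \<tau> l m W ** transpose (imatrix ?U) = leaf a \<tau> (l + r) m (W + cmat (outer r m + outer m r))"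
    unfolding vec_eq_iff U
  proof (intro allI)
    fix i k
    have W': "transpose W = W" using W by (simp add: pd_off_def)
    have ra: "r $ a = 0" using n by (simp add: r_def)
    note z = pd_off_nth[OF W]
    show "(shear (cvec r) (axis a 1) ** leaf a \<tau> l m W ** transpose (shear (cvec r) (axis a 1))) $ i $ k =
        leaf a \<tau> (l + r) m (W + cmat (outer r m + outer m r)) $ i $ k"
      unfolding shear_sandwich[OF leaf_sym[OF W']] col q
      by (simp add: leaf_nth l m ra z) (simp add: cmat_def outer_def cvec_def l m ra algebra_simps)
  qed
  have "(transpose (imatrix ?V) ** M ** imatrix ?V) $ j $ j = M $ j $ j" for M
  proof -
    have "imatrix ?V $ i $ j = (if i = j then 1 else 0)" for i
      using ja by (simp add: imatrix_def shear_def outer_def mat_def axis_def)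
    then show ?thesis
      by (simp add: matrix_matrix_mult_def transpose_def if_distrib[of "\<lambda>x. x * _"] if_distrib[of "(*) _"] cong: if_cong)
  qed
  then have "mat_at H (leaf a \<tau> (l + r) m (W + cmat (outer r m + outer m r))) $ j $ j = mat_at H (leaf a \<tau> l m W) $ j $ j"
    using unimodular(1)[OF Z UV] unfolding sand by simp
  then show ?thesis by (simp add: mat_at_def)
qed

lemma leaf_holomorphic:
  assumes "pd_off a W" "l $ a = 0"
  shows "(\<lambda>\<tau>. fn (H $ i $ k) (leaf a \<tau> l m W)) holomorphic_on uhp"
  unfolding leaf_def
  by (rule affine_holomorphic[OF hol open_uhp])
    (use leaf_siegel[OF assms(1) _ assms(2), of _ m] in \<open>simp add: leaf_def\<close>)

lemma leaf_growth:
  assumes W: "pd_off a W" and l: "l $ a = 0" and N: "N > 0" "\<And>i. real N * l $ i \<in> \<int>" and ja: "j \<noteq> a"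
  shows "moderate_growth (\<lambda>\<tau>. fn (H $ i $ k) (leaf a \<tau> l m W))"
proof -
  let ?u = "axis a 1 + l"
  have u: "?u $ a = 1" using l by (simp add: axis_def)
  have Nu: "real N * ?u $ i \<in> \<int>" for i
    using N(2)[of i] by (simp add: axis_def algebra_simps)
  have sW: "transpose W = W" using W by (simp add: pd_off_def)
  have st: "transpose (imat W + (1/4) *\<^sub>R outer ?u ?u) = imat W + (1/4) *\<^sub>R outer ?u ?u"
    using arg_cong[OF sW, of imat]
    by (simp add: transpose_def imat_def outer_def vec_eq_iff mult.commute)
  \<comment> \<open>\<open>Im W\<close> is degenerate in the direction \<open>e\<close>, so
    \<open>Im W + 1/4 u u^t\<close> serves as base point; \<open>\<eta> = Im \<tau> - 1/4\<close>
    stays positive for \<open>Im \<tau> \<ge> 1/2\<close>.\<close>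
  obtain C where C: "0 \<le> C" "\<And>\<eta> Z. 0 < \<eta> \<Longrightarrow> transpose Z = Z \<Longrightarrow>
      imat Z = imat W + (1/4) *\<^sub>R outer ?u ?u + \<eta> *\<^sub>R outer ?u ?u \<Longrightarrow> cmod (mat_at H Z $ i $ k) \<le> C * (1 + \<eta>)\<^sup>2"
    using koecher_growth[OF u N(1) Nu ja posdef_off[OF W _ u, of "1/4"] st] by auto
  have "cmod (fn (H $ i $ k) (leaf a \<tau> l m W)) \<le> C * (1 + Im \<tau>) ^ 2" if \<tau>: "1/2 \<le> Im \<tau>" for \<tau>
  proof -
    have "cmod (mat_at H (leaf a \<tau> l m W) $ i $ k) \<le> C * (1 + (Im \<tau> - 1/4))\<^sup>2"
      by (rule C(2)) (use \<tau> sW in \<open>auto simp: leaf_sym imat_leaf scaleR_left_diff_distrib\<close>)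
    also have "\<dots> \<le> C * (1 + Im \<tau>) ^ 2"
      using C(1) \<tau> by (intro mult_left_mono power_mono) auto
    finally show ?thesis by (simp add: mat_at_def)
  qed
  then show ?thesis unfolding moderate_growth_def by blast
qed

text \<open>The shift of \<open>W\<close> by \<open>N\<^sup>-\<^sup>2 k\<close> makes the family stable under \<open>T\<close> and \<open>S\<close>, which change \<open>W\<close> by
  \<open>l l\<^sup>t\<close> and \<open>l m\<^sup>t + m l\<^sup>t\<close>.\<close>

definition torsion :: "'n \<Rightarrow> 'n \<Rightarrow> nat \<Rightarrow> (complex, 'n) sqmat \<Rightarrow> (int, 'n) vec \<Rightarrow> (int, 'n) vec
    \<Rightarrow> (int, 'n) sqmat \<Rightarrow> complex \<Rightarrow> complex" where
  "torsion a j N W l m k \<tau> = (if 0 < Im \<tau> then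
     fn (H $ j $ j) (leaf a \<tau> (\<chi> i. of_int (l $ i) / real N) (\<chi> i. of_int (m $ i) / real N)
       (W + cmat (\<chi> x y. of_int (k $ x $ y) / real N ^ 2))) else 0)"

end

definition valid_torsion :: "'n \<Rightarrow> (int, 'n::finite) vec \<Rightarrow> (int, 'n) vec \<Rightarrow> (int, 'n) sqmat \<Rightarrow> bool" where
  "valid_torsion a l m k \<longleftrightarrow> l $ a = 0 \<and> m $ a = 0 \<and> transpose k = k \<and> (\<forall>i. k $ a $ i = 0)"

lemma valid_torsion_nth: "valid_torsion a l m k \<Longrightarrow> k $ i $ a = 0"
proof -
  assume v: "valid_torsion a l m k"
  then have "transpose k $ i $ a = k $ i $ a" by (simp add: valid_torsion_def)
  then show ?thesis using v by (simp add: valid_torsion_def transpose_def)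
qed

lemma finite_vec_set: "finite A \<Longrightarrow> finite {v :: ('a, 'n::finite) vec. \<forall>i. v $ i \<in> A}"
proof -
  assume "finite A"
  then have "finite (vec_lambda ` (Pi\<^sub>E (UNIV :: 'n set) (\<lambda>_. A)))"
    by (intro finite_imageI finite_PiE) auto
  moreover have "{v :: ('a, 'n) vec. \<forall>i. v $ i \<in> A} \<subseteq> vec_lambda ` (Pi\<^sub>E (UNIV :: 'n set) (\<lambda>_. A))"
  proof
    fix v :: "('a, 'n) vec" assume "v \<in> {v. \<forall>i. v $ i \<in> A}"
    then show "v \<in> vec_lambda ` (Pi\<^sub>E UNIV (\<lambda>_. A))"
      by (intro image_eqI[of _ _ "vec_nth v"]) auto
  qed
  ultimately show ?thesis by (rule finite_subset[rotated])
qed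

lemma pd_off_torsion:
  assumes "pd_off a W" "valid_torsion a l m k"
  shows "pd_off a (W + cmat (\<chi> x y. of_int (k $ x $ y) / real N ^ 2))"
proof (rule pd_off_add[OF assms(1)])
  have "k $ x $ y = k $ y $ x" for x y
  proof -
    have "transpose k $ y $ x = k $ y $ x" using assms(2) by (simp add: valid_torsion_def)
    then show ?thesis by (simp add: transpose_def)
  qed
  then show "transpose (\<chi> x y. of_int (k $ x $ y) / real N ^ 2) = (\<chi> x y. of_int (k $ x $ y) / real N ^ 2)"
    by (simp add: transpose_def vec_eq_iff)
qed (use assms(2) in \<open>simp add: valid_torsion_def\<close>)

context sym2_form
begin

lemma torsion_T:
  assumes W: "pd_off a W" and v: "valid_torsion a l m k" and N: "N > 0" and \<tau>: "0 < Im \<tau>"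
  shows "torsion a j N W l m k (\<tau> + 1) = torsion a j N W l (m + l) (k + outer l l) \<tau>"
proof -
  let ?l = "\<chi> i. of_int (l $ i) / real N" and ?m = "\<chi> i. of_int (m $ i) / real N"
  have 1: "(\<chi> i. of_int ((m + l) $ i) / real N) = ?m + ?l"
    by (simp add: vec_eq_iff add_divide_distrib)
  have 2: "W + cmat (\<chi> x y. of_int ((k + outer l l) $ x $ y) / real N ^ 2) =
      W + cmat (\<chi> x y. of_int (k $ x $ y) / real N ^ 2) + cmat (outer ?l ?l)"
    by (simp add: vec_eq_iff cmat_def outer_def add_divide_distrib power2_eq_square)
  have l: "?l $ a = 0" using v by (simp add: valid_torsion_def)
  show ?thesis
    unfolding torsion_def 1 2 using leaf_T[OF pd_off_torsion[OF W v] \<tau> l] \<tau> by simp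
qed

lemma torsion_S:
  assumes W: "pd_off a W" and v: "valid_torsion a l m k" and N: "N > 0" and \<tau>: "0 < Im \<tau>" and ja: "j \<noteq> a"
  shows "torsion a j N W l m k (- 1 / \<tau>) = torsion a j N W m (- l) (k - outer m l - outer l m) \<tau>"
proof -
  let ?l = "\<chi> i. of_int (l $ i) / real N" and ?m = "\<chi> i. of_int (m $ i) / real N"
  let ?K = "W + cmat (\<chi> x y. of_int (k $ x $ y) / real N ^ 2)"
  let ?W' = "?K - cmat (outer ?m ?l + outer ?l ?m)"
  have la: "?l $ a = 0" "?m $ a = 0" "(- ?l) $ a = 0" using v by (simp_all add: valid_torsion_def)
  have 1: "(\<chi> i. of_int ((- l) $ i) / real N) = - ?l"
    by (simp add: vec_eq_iff)
  have 2: "W + cmat (\<chi> x y. of_int ((k - outer m l - outer l m) $ x $ y) / real N ^ 2) = ?W'"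
    by (simp add: vec_eq_iff cmat_def outer_def diff_divide_distrib power2_eq_square)
  have "?W' = ?K + cmat (- (outer ?m ?l + outer ?l ?m))"
    by (simp add: vec_eq_iff cmat_def)
  then have pd: "pd_off a ?W'"
    by (simp only:, intro pd_off_add[OF pd_off_torsion[OF W v]])
      (use v in \<open>simp_all add: valid_torsion_def transpose_def outer_def vec_eq_iff mult.commute\<close>)
  have K: "?W' - cmat (outer ?m (- ?l) + outer (- ?l) ?m) = ?K"
    by (simp add: vec_eq_iff cmat_def outer_def)
  \<comment> \<open>\<open>leaf_S\<close> is applied to the leaf of \<open>(m, - l)\<close>, whose
    image under inversion has the parameters \<open>(l, m)\<close>.\<close>
  then have "fn (H $ j $ j) (leaf a (- 1 / \<tau>) ?l ?m ?K) = fn (H $ j $ j) (leaf a \<tau> ?m (- ?l) ?W')"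
    using leaf_S[OF pd \<tau> la(2,3) ja] by (simp only: K minus_minus)
  then show ?thesis
    unfolding torsion_def 1 2 using \<tau> neg_inverse_uhp[OF \<tau>] by (simp del: divide_minus_left)
qed

lemma torsion_shift_l:
  assumes W: "pd_off a W" and v: "valid_torsion a l m k" and N: "N > 0" and ja: "j \<noteq> a" and n: "n $ a = 0"
  shows "torsion a j N W (\<chi> i. l $ i + int N * n $ i) m
      (\<chi> x y. k $ x $ y + int N * (n $ x * m $ y + m $ x * n $ y)) = torsion a j N W l m k"
proof
  fix \<tau>
  let ?l = "\<chi> i. of_int (l $ i) / real N" and ?m = "\<chi> i. of_int (m $ i) / real N"
  let ?n = "\<chi> i. real_of_int (n $ i)"
  have la: "?l $ a = 0" "?m $ a = 0" using v by (simp_all add: valid_torsion_def)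
  have 1: "(\<chi> i. of_int ((\<chi> i. l $ i + int N * n $ i) $ i) / real N) = ?l + ?n"
    using N by (simp add: vec_eq_iff add_divide_distrib)
  have 2: "W + cmat (\<chi> x y. of_int ((\<chi> x y. k $ x $ y + int N * (n $ x * m $ y + m $ x * n $ y)) $ x $ y) / real N ^ 2) =
      (W + cmat (\<chi> x y. of_int (k $ x $ y) / real N ^ 2)) + cmat (outer ?n ?m + outer ?m ?n)"
    using N by (simp add: vec_eq_iff cmat_def outer_def field_simps power2_eq_square)
  show "torsion a j N W (\<chi> i. l $ i + int N * n $ i) m
      (\<chi> x y. k $ x $ y + int N * (n $ x * m $ y + m $ x * n $ y)) \<tau> = torsion a j N W l m k \<tau>"
    unfolding torsion_def 1 2
    using leaf_shear[OF pd_off_torsion[OF W v] _ la ja n, where \<tau> = \<tau>] by simp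
qed

lemma torsion_shift_mk:
  assumes W: "pd_off a W" and v: "valid_torsion a l m k" and N: "N > 0" and S: "transpose S = S"
  shows "torsion a j N W l (\<chi> i. m $ i + int N * n $ i) (\<chi> x y. k $ x $ y + int N ^ 2 * S $ x $ y)
    = torsion a j N W l m k"
proof
  fix \<tau>
  let ?l = "\<chi> i. of_int (l $ i) / real N" and ?m = "\<chi> i. of_int (m $ i) / real N"
  let ?n = "\<chi> i. real_of_int (n $ i)"
  have la: "?l $ a = 0" using v by (simp add: valid_torsion_def)
  have 1: "(\<chi> i. of_int ((\<chi> i. m $ i + int N * n $ i) $ i) / real N) = ?m + ?n"
    using N by (simp add: vec_eq_iff add_divide_distrib)
  have 2: "W + cmat (\<chi> x y. of_int ((\<chi> x y. k $ x $ y + int N ^ 2 * S $ x $ y) $ x $ y) / real N ^ 2) =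
      (W + cmat (\<chi> x y. of_int (k $ x $ y) / real N ^ 2)) + imatrix S"
    using N by (simp add: vec_eq_iff cmat_def imatrix_def add_divide_distrib)
  show "torsion a j N W l (\<chi> i. m $ i + int N * n $ i) (\<chi> x y. k $ x $ y + int N ^ 2 * S $ x $ y) \<tau>
      = torsion a j N W l m k \<tau>"
    unfolding torsion_def 1 2
    using leaf_translate[OF pd_off_torsion[OF W v] _ la S, where \<tau> = \<tau> and n = n] by simp
qed

text \<open>Integral shears reduce \<open>l\<close> modulo \<open>N\<close>; integral translations
  reduce \<open>m\<close> modulo \<open>N\<close> and \<open>k\<close> modulo \<open>N ^ 2\<close>.
  The value 0 off the half plane makes these reductions equalities of functions.\<close>

lemma finite_torsion:
  assumes W: "pd_off a W" and N: "N > 0" and ja: "j \<noteq> a"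
  shows "finite {torsion a j N W l m k | l m k. valid_torsion a l m k}" (is "finite ?F")
proof -
  define L :: "(int, 'n) vec set" where "L = {v. \<forall>i. v $ i \<in> {0..<int N}}"
  define K :: "(int, 'n) sqmat set" where "K = {v. \<forall>i. v $ i \<in> {w. \<forall>i. w $ i \<in> {0..<int N ^ 2}}}"
  have fin: "finite (L \<times> L \<times> K)"
    unfolding L_def K_def by (intro finite_cartesian_product finite_vec_set) auto
  have "?F \<subseteq> (\<lambda>(l, m, k). torsion a j N W l m k) ` (L \<times> L \<times> K)"
  proof clarify
    fix l m k assume v: "valid_torsion a l m k"
    \<comment> \<open>\<open>l\<close> is reduced first, because its shift also changes
      \<open>k\<close>.\<close>
    define q :: "(int, 'n) vec" where "q = (\<chi> i. - (l $ i div int N))"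
    define l' :: "(int, 'n) vec" where "l' = (\<chi> i. l $ i + int N * q $ i)"
    define k1 :: "(int, 'n) sqmat" where "k1 = (\<chi> x y. k $ x $ y + int N * (q $ x * m $ y + m $ x * q $ y))"
    define n :: "(int, 'n) vec" where "n = (\<chi> i. - (m $ i div int N))"
    define m' :: "(int, 'n) vec" where "m' = (\<chi> i. m $ i + int N * n $ i)"
    define S :: "(int, 'n) sqmat" where "S = (\<chi> x y. - (k1 $ x $ y div int N ^ 2))"
    define k' :: "(int, 'n) sqmat" where "k' = (\<chi> x y. k1 $ x $ y + int N ^ 2 * S $ x $ y)"
    have qa: "q $ a = 0" using v by (simp add: q_def valid_torsion_def)
    have ks: "k $ x $ y = k $ y $ x" for x y
    proof -
      have "transpose k $ y $ x = k $ y $ x" using v by (simp add: valid_torsion_def)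
      then show ?thesis by (simp add: transpose_def)
    qed
    have k1s: "k1 $ x $ y = k1 $ y $ x" for x y
      using ks[of x y] by (simp add: k1_def algebra_simps)
    have v1: "valid_torsion a l' m k1"
      using v qa k1s valid_torsion_nth[OF v]
      by (simp add: valid_torsion_def l'_def transpose_def vec_eq_iff) (simp add: k1_def)
    have Ss: "transpose S = S"
      using k1s by (simp add: S_def transpose_def vec_eq_iff)
    have "torsion a j N W l m k = torsion a j N W l' m k1"
      unfolding l'_def k1_def by (rule torsion_shift_l[OF W v N ja qa, symmetric])
    also have "\<dots> = torsion a j N W l' m' k'"
      unfolding m'_def k'_def by (rule torsion_shift_mk[OF W v1 N Ss, symmetric])
    finally have e: "torsion a j N W l m k = torsion a j N W l' m' k'" .
    have "l' $ i = l $ i mod int N" "m' $ i = m $ i mod int N" for i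
      by (simp_all add: l'_def m'_def q_def n_def minus_mult_div_eq_mod[symmetric])
    then have "l' \<in> L" "m' \<in> L" using N by (simp_all add: L_def)
    moreover have "k' $ x $ y = k1 $ x $ y mod int N ^ 2" for x y
      by (simp add: k'_def S_def minus_mult_div_eq_mod[symmetric])
    then have "k' \<in> K" using N by (simp add: K_def)
    ultimately show "torsion a j N W l m k \<in> (\<lambda>(l, m, k). torsion a j N W l m k) ` (L \<times> L \<times> K)"
      unfolding e by force
  qed
  then show ?thesis using fin finite_subset by blast
qed

lemma torsion_constant:
  assumes W: "pd_off a W" and v: "valid_torsion a l m k" and N: "N > 0" and ja: "j \<noteq> a"
  shows "torsion a j N W l m k constant_on uhp"
proof (rule finite_modular_family_constant[OF finite_torsion[OF W N ja]])
  have rep: "\<exists>l m k. f = torsion a j N W l m k \<and> valid_torsion a l m k"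
    if "f \<in> {torsion a j N W l m k | l m k. valid_torsion a l m k}" for f
    using that by blast
  fix f assume f: "f \<in> {torsion a j N W l m k | l m k. valid_torsion a l m k}"
  obtain l m k where flm: "f = torsion a j N W l m k" and v: "valid_torsion a l m k"
    using rep[OF f] by blast
  let ?l = "\<chi> i. of_int (l $ i) / real N" and ?m = "\<chi> i. of_int (m $ i) / real N"
  let ?K = "W + cmat (\<chi> x y. of_int (k $ x $ y) / real N ^ 2)"
  have la: "?l $ a = 0" using v by (simp add: valid_torsion_def)
  note pd = pd_off_torsion[OF W v, of N]
  show "f holomorphic_on uhp"
    by (rule holomorphic_transform[OF leaf_holomorphic[OF pd la, of j j ?m]])
      (simp add: flm torsion_def)
  have "moderate_growth (\<lambda>\<tau>. fn (H $ j $ j) (leaf a \<tau> ?l ?m ?K))"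
    by (rule leaf_growth[OF pd la N _ ja]) (use N in simp)
  then show "moderate_growth f"
    unfolding moderate_growth_def flm torsion_def by simp
  have "valid_torsion a l (m + l) (k + outer l l)"
    using v by (simp add: valid_torsion_def transpose_add transpose_outer) (simp add: outer_def)
  then show "\<exists>g\<in>{torsion a j N W l m k | l m k. valid_torsion a l m k}. \<forall>z\<in>uhp. f (z + 1) = g z"
    using torsion_T[OF W v N] unfolding flm by blast
  have "valid_torsion a m (- l) (k - outer m l - outer l m)"
    using v valid_torsion_nth[OF v]
    by (simp add: valid_torsion_def transpose_def vec_eq_iff outer_def mult.commute)
  then show "\<exists>g\<in>{torsion a j N W l m k | l m k. valid_torsion a l m k}. \<forall>z\<in>uhp. f (- 1 / z) = g z"
    using torsion_S[OF W v N _ ja] unfolding flm by blast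
next
  show "torsion a j N W l m k \<in> {torsion a j N W l m k | l m k. valid_torsion a l m k}"
    using v by blast
qed

lemma leaf_constant:
  assumes W: "pd_off a W" and l: "l $ a = 0" and m: "m $ a = 0" and ja: "j \<noteq> a"
    and \<tau>: "0 < Im \<tau>" "0 < Im \<tau>'"
  shows "fn (H $ j $ j) (leaf a \<tau> l m W) = fn (H $ j $ j) (leaf a \<tau>' l m W)"
proof -
  \<comment> \<open>Rational approximations with one denominator for both \<open>l\<close> and
    \<open>m\<close>, keeping the component 0 at \<open>a\<close>. The floors are the numerators
    expected by \<open>torsion\<close>.\<close>
  define r where "r = (\<lambda>(x::(real, 'n) vec) n. \<chi> i. of_int \<lfloor>real (Suc n) * x $ i\<rfloor> / real (Suc n))"
  have rlim: "(\<lambda>n. r x n $ i) \<longlonglongrightarrow> x $ i" for x i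
  proof (rule tendsto_sandwich)
    show "\<forall>\<^sub>F n in sequentially. x $ i - 1 / real (Suc n) \<le> r x n $ i"
    proof (rule always_eventually, rule allI)
      fix n
      have "real (Suc n) * x $ i - 1 \<le> of_int \<lfloor>real (Suc n) * x $ i\<rfloor>" by linarith
      then have "(real (Suc n) * x $ i - 1) / real (Suc n) \<le> of_int \<lfloor>real (Suc n) * x $ i\<rfloor> / real (Suc n)"
        by (intro divide_right_mono) auto
      then show "x $ i - 1 / real (Suc n) \<le> r x n $ i"
        by (simp add: r_def diff_divide_distrib)
    qed
    show "\<forall>\<^sub>F n in sequentially. r x n $ i \<le> x $ i"
    proof (rule always_eventually, rule allI)
      fix n
      have "of_int \<lfloor>real (Suc n) * x $ i\<rfloor> / real (Suc n) \<le> (real (Suc n) * x $ i) / real (Suc n)"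
        by (intro divide_right_mono) auto
      then show "r x n $ i \<le> x $ i" by (simp add: r_def)
    qed
    show "(\<lambda>n. x $ i - 1 / real (Suc n)) \<longlonglongrightarrow> x $ i"
      using tendsto_diff[OF tendsto_const LIMSEQ_inverse_real_of_nat, of "x $ i"]
      by (simp add: inverse_eq_divide)
  qed simp
  have ra: "r x n $ a = 0" if "x $ a = 0" for x n using that by (simp add: r_def)
  have lim: "(\<lambda>n. fn (H $ j $ j) (leaf a t (r l n) (r m n) W)) \<longlonglongrightarrow> fn (H $ j $ j) (leaf a t l m W)"
    if t: "0 < Im t" for t
  proof -
    have s: "leaf a t (r l n) (r m n) W \<in> siegel" "leaf a t l m W \<in> siegel" for n
      using leaf_siegel[OF W t] ra l by auto
    have "(\<lambda>n. coords (leaf a t (r l n) (r m n) W)) \<longlonglongrightarrow> coords (leaf a t l m W)"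
      unfolding coords_def leaf_nth
      by (intro tendsto_vec_lambda) (auto intro!: tendsto_intros rlim)
    then have "(\<lambda>n. fn (H $ j $ j) (symm (coords (leaf a t (r l n) (r m n) W)))) \<longlonglongrightarrow>
        fn (H $ j $ j) (symm (coords (leaf a t l m W)))"
      by (rule continuous_on_tendsto_compose[OF fn_continuous])
        (use s in \<open>auto intro!: always_eventually coords_chart\<close>)
    then show ?thesis using s by (simp add: symm_coords_siegel)
  qed
  have "fn (H $ j $ j) (leaf a \<tau> (r l n) (r m n) W) = fn (H $ j $ j) (leaf a \<tau>' (r l n) (r m n) W)" for n
  proof -
    define li mi :: "(int, 'n) vec" where "li = (\<chi> i. \<lfloor>real (Suc n) * l $ i\<rfloor>)"
      and "mi = (\<chi> i. \<lfloor>real (Suc n) * m $ i\<rfloor>)"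
    have v: "valid_torsion a li mi 0"
      using l m by (simp add: valid_torsion_def li_def mi_def transpose_zero)
    have e: "torsion a j (Suc n) W li mi 0 t = fn (H $ j $ j) (leaf a t (r l n) (r m n) W)" if "0 < Im t" for t
    proof -
      have "W + cmat (\<chi> x y. of_int ((0 :: (int, 'n) sqmat) $ x $ y) / real (Suc n) ^ 2) = W"
        by (simp add: vec_eq_iff cmat_def)
      then show ?thesis using that by (simp add: torsion_def r_def li_def mi_def)
    qed
    obtain c where c: "\<And>t. t \<in> uhp \<Longrightarrow> torsion a j (Suc n) W li mi 0 t = c"
      using torsion_constant[OF W v zero_less_Suc[of n] ja] unfolding constant_on_def by blast
    show ?thesis using c[of \<tau>] c[of \<tau>'] \<tau> by (simp only: e mem_Collect_eq)
  qed
  with lim[OF \<tau>(1)] have "(\<lambda>n. fn (H $ j $ j) (leaf a \<tau>' (r l n) (r m n) W)) \<longlonglongrightarrow> fn (H $ j $ j) (leaf a \<tau> l m W)"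
    by (simp only:)
  then show ?thesis by (rule LIMSEQ_unique[OF _ lim[OF \<tau>(2)]])
qed

end

section \<open>Vanishing of the difference of two solutions\<close>

lemma siegel_diag_pos:
  assumes "Z \<in> siegel"
  shows "0 < Im (Z $ a $ a)"
proof -
  have "0 < axis a 1 \<bullet> (imat Z *v axis a 1)"
    using assms by (simp add: siegel_iff)
  also have "axis a 1 \<bullet> (imat Z *v axis a 1) = Im (Z $ a $ a)"
    by (simp add: inner_axis' matrix_vector_mult_def imat_def)
      (simp add: axis_def if_distrib[of "(*) _"] cong: if_cong)
  finally show ?thesis .
qed

text \<open>Here \<open>l\<close> is the vector \<open>u\<close> of the leaf, whence the argument
  \<open>l - axis a 1\<close>. The choice \<open>u = y / y_a\<close> with \<open>y = Im Z e\<close>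
  matches the imaginary part of column \<open>a\<close>, and \<open>m\<close> absorbs the real
  remainder.\<close>

lemma siegel_leaf:
  fixes Z :: "(complex, 'n::finite) sqmat" and a :: 'n
  assumes Z: "Z \<in> siegel"
  defines "l \<equiv> (\<chi> i. Im (Z $ i $ a) / Im (Z $ a $ a))"
  obtains m W where "m $ a = 0" "pd_off a W"
    "\<And>t. Z + mscale t (cmat (outer l l)) = leaf a (Z $ a $ a + t) (l - axis a 1) m W"
proof -
  define y where "y = Im (Z $ a $ a)"
  have y: "0 < y" using siegel_diag_pos[OF Z] by (simp add: y_def)
  have la: "l $ a = 1" using y by (simp add: l_def y_def)
  define m where "m = (\<chi> i. Re (Z $ i $ a) - Re (Z $ a $ a) * l $ i)"
  define W where "W = Z - mscale (Z $ a $ a) (cmat (outer l l)) - cmat (outer (axis a 1) m + outer m (axis a 1))"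
  have ma: "m $ a = 0" by (simp add: m_def la)
  have leaf: "Z + mscale t (cmat (outer l l)) = leaf a (Z $ a $ a + t) (l - axis a 1) m W" for t
    unfolding leaf_def W_def by (simp add: mscale_def vec_eq_iff algebra_simps)
  have Wia: "W $ i $ a = 0" for i
  proof -
    have "W $ i $ a = Z $ i $ a - Z $ a $ a * of_real (l $ i) - of_real (m $ i)"
      using ma by (simp add: W_def mscale_def cmat_def outer_def axis_def la)
    also have "\<dots> = 0"
      using y by (simp add: complex_eq_iff m_def) (simp add: l_def y_def)
    finally show ?thesis .
  qed
  have Wsym: "W $ i $ k = W $ k $ i" for i k
    using siegel_sym[OF Z, of i k] by (simp add: W_def mscale_def cmat_def outer_def axis_def mult.commute)
  have "pd_off a W"
    unfolding pd_off_def
  proof (intro conjI allI impI)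
    show "transpose W = W" using Wsym by (simp add: transpose_def vec_eq_iff)
    show Wai: "W $ a $ i = 0" for i by (rule trans[OF Wsym Wia])
    fix v :: "(real, 'n) vec" assume v: "v $ a = 0" "v \<noteq> 0"
    \<comment> \<open>The multiple of \<open>e\<close> makes \<open>w\<close> orthogonal to
      \<open>l\<close>, so that the forms of \<open>Im Z\<close> and \<open>Im W\<close> agree at
      \<open>w\<close>.\<close>
    define w where "w = v - (l \<bullet> v) *\<^sub>R axis a 1"
    have "w \<noteq> 0"
    proof
      assume "w = 0"
      from arg_cong[OF this, of "\<lambda>v. v $ a"] v(1) have "l \<bullet> v = 0" by (simp add: w_def axis_def)
      with \<open>w = 0\<close> v(2) show False by (simp add: w_def)
    qed
    then have "0 < w \<bullet> (imat Z *v w)" using Z by (simp add: siegel_iff)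
    moreover have "imat Z = imat W + y *\<^sub>R outer l l"
      by (simp add: W_def imat_def vec_eq_iff mscale_def cmat_def y_def)
    moreover have "w \<bullet> ((imat W + y *\<^sub>R outer l l) *v w) = w \<bullet> (imat W *v w) + y * (l \<bullet> w)\<^sup>2"
      by (rule quadratic_add_outer)
    moreover have "l \<bullet> w = 0" using la by (simp add: w_def inner_diff_right inner_axis)
    moreover have "v \<bullet> (imat W *v v) = w \<bullet> (imat W *v w)"
      unfolding w_def by (rule imat_quadratic_off[OF Wai Wia])
    ultimately show "0 < v \<bullet> (imat W *v v)" by simp
  qed
  from ma this leaf show ?thesis by (rule that)
qed

text \<open>Convexity lets a vanishing derivative imply constancy in
  \<open>diagonal_constant\<close>.\<close>

lemma convex_siegel_chart: "convex (siegel_chart :: (complex ^ 'n::{finite,linorder} idx) set)"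
proof (rule convexI)
  fix x y :: "complex ^ 'n idx" and u v :: real
  assume xy: "x \<in> siegel_chart" "y \<in> siegel_chart" and uv: "0 \<le> u" "0 \<le> v" "u + v = 1"
  have "imat (symm (u *\<^sub>R x + v *\<^sub>R y)) = u *\<^sub>R imat (symm x) + v *\<^sub>R imat (symm y)"
    by (simp add: imat_def symm_def vec_eq_iff)
  moreover have "0 < w \<bullet> ((u *\<^sub>R imat (symm x) + v *\<^sub>R imat (symm y)) *v w)" if "w \<noteq> 0" for w
  proof -
    have p: "0 < w \<bullet> (imat (symm x) *v w)" "0 < w \<bullet> (imat (symm y) *v w)"
      using xy that by (simp_all add: siegel_chart_def siegel_iff)
    have "w \<bullet> ((u *\<^sub>R imat (symm x) + v *\<^sub>R imat (symm y)) *v w) =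
        u * (w \<bullet> (imat (symm x) *v w)) + v * (w \<bullet> (imat (symm y) *v w))"
      by (simp add: matrix_vector_mult_add_rdistrib inner_add_right scaleR_matrix_vector_assoc[symmetric])
    also have "\<dots> > 0"
    proof (cases "u = 0")
      case True
      then show ?thesis using uv p by simp
    next
      case False
      then show ?thesis using uv p by (simp add: add_pos_nonneg)
    qed
    finally show ?thesis .
  qed
  ultimately show "u *\<^sub>R x + v *\<^sub>R y \<in> siegel_chart"
    by (simp add: siegel_chart_def siegel_iff)
qed

text \<open>The derivatives of the \<open>E I\<close> in the directions \<open>A\<close> and \<open>\<i> A\<close> are proportional, and the
  former do not contribute when the \<open>q I\<close> depend only on imaginary parts.\<close>

lemma imaginary_derivative:
  fixes E :: "'n::{finite,linorder} idx \<Rightarrow> 'n cinf"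
  assumes hol: "\<And>I. siegel_holomorphic (E I)"
    and q: "\<And>I. (q I has_derivative q' I) (at z)"
    and sum0: "\<And>z. z \<in> siegel_chart \<Longrightarrow> (\<Sum>I\<in>UNIV. fn (E I) (symm z) * q I z) = 0"
    and real: "\<And>I. q' I (cvec A) = 0"
    and z: "z \<in> siegel_chart"
  shows "(\<Sum>I\<in>UNIV. fn (E I) (symm z) * q' I (\<i> *s cvec A)) = 0"
proof -
  define e where "e = (\<lambda>I v. \<Sum>J\<in>UNIV. v $ J * fn (pd J (E I)) (symm z))"
  have "((\<lambda>z. \<Sum>I\<in>UNIV. fn (E I) (symm z) * q I z) has_derivative
      (\<lambda>v. \<Sum>I\<in>UNIV. fn (E I) (symm z) * q' I v + e I v * q I z)) (at z)"
    unfolding e_def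
    by (rule has_derivative_sum) (rule has_derivative_mult[OF holomorphic_has_derivative[OF hol z] q])
  moreover have "((\<lambda>z. \<Sum>I\<in>UNIV. fn (E I) (symm z) * q I z) has_derivative (\<lambda>_. 0)) (at z)"
    by (rule has_derivative_transform_within_open[OF has_derivative_const[of 0] open_siegel_chart z])
      (simp add: sum0)
  ultimately have "(\<lambda>v. \<Sum>I\<in>UNIV. fn (E I) (symm z) * q' I v + e I v * q I z) = (\<lambda>_. 0)"
    by (rule has_derivative_unique)
  then have 0: "(\<Sum>I\<in>UNIV. fn (E I) (symm z) * q' I v + e I v * q I z) = 0" for v
    by (rule fun_cong)
  have "e I (\<i> *s cvec A) = \<i> * e I (cvec A)" for I
    by (simp add: e_def sum_distrib_left mult.assoc)
  then have "(\<Sum>I\<in>UNIV. fn (E I) (symm z) * q' I (\<i> *s cvec A)) +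
      \<i> * (\<Sum>I\<in>UNIV. e I (cvec A) * q I z) = 0"
    using 0[of "\<i> *s cvec A"] by (simp add: sum.distrib sum_distrib_left mult.assoc)
  moreover have "(\<Sum>I\<in>UNIV. e I (cvec A) * q I z) = 0"
    using 0[of "cvec A"] by (simp add: real)
  ultimately show ?thesis by simp
qed

context sym2_form
begin

text \<open>Translation of \<open>Z\<close> along its own leaf; a real \<open>t\<close> keeps the
  imaginary part and hence the half space.\<close>

lemma ray_constant:
  assumes Z: "Z \<in> siegel" and ja: "j \<noteq> a"
  defines "l \<equiv> (\<chi> i. Im (Z $ i $ a) / Im (Z $ a $ a))"
  shows "fn (H $ j $ j) (Z + mscale (of_real t) (cmat (outer l l))) = fn (H $ j $ j) Z"
    and "Z + mscale (of_real t) (cmat (outer l l)) \<in> siegel"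
proof -
  have la: "(l - axis a 1) $ a = 0" using siegel_diag_pos[OF Z, of a] by (simp add: l_def axis_def)
  obtain m W where m: "m $ a = 0" and W: "pd_off a W"
    and leaf: "\<And>t. Z + mscale t (cmat (outer l l)) = leaf a (Z $ a $ a + t) (l - axis a 1) m W"
    unfolding l_def by (rule siegel_leaf[OF Z]) blast
  have Z0: "Z = leaf a (Z $ a $ a) (l - axis a 1) m W"
  proof -
    have "Z + mscale 0 (cmat (outer l l)) = Z" by (simp add: mscale_def vec_eq_iff)
    from this[symmetric] leaf[of 0] show ?thesis unfolding add_0_right by (rule trans)
  qed
  have im: "0 < Im (Z $ a $ a + of_real t)" "0 < Im (Z $ a $ a)" using siegel_diag_pos[OF Z, of a] by simp_all
  show "fn (H $ j $ j) (Z + mscale (of_real t) (cmat (outer l l))) = fn (H $ j $ j) Z"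
    unfolding leaf
    by (rule trans[OF leaf_constant[OF W la m ja im] arg_cong[OF Z0[symmetric], of "fn (H $ j $ j)"]])
  show "Z + mscale (of_real t) (cmat (outer l l)) \<in> siegel"
    unfolding leaf by (rule leaf_siegel[OF W im(1) la])
qed

lemma diagonal_pd_zero:
  assumes ja: "j \<noteq> a" and Z: "Z \<in> siegel"
  shows "(\<Sum>I\<in>UNIV. fn (pd I (H $ j $ j)) Z *
    of_real (Im (Z $ fst (Rep_idx I) $ a) * Im (Z $ snd (Rep_idx I) $ a))) = 0"
proof -
  define l where "l = (\<chi> i. Im (Z $ i $ a) / Im (Z $ a $ a))"
  define L where "L = cmat (outer l l)"
  let ?f = "H $ j $ j"
  have z: "coords Z \<in> siegel_chart" by (rule coords_chart[OF Z])
  let ?c = "\<lambda>t::real. coords (Z + mscale (of_real t) L)"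
  have c0: "?c 0 = coords Z" by (simp add: mscale_def coords_def vec_eq_iff)
  have "(?c has_derivative (\<lambda>t. of_real t *s coords L)) (at 0)"
    unfolding has_derivative_vec_iff by (auto simp: coords_def mscale_def intro!: derivative_eq_intros)
  then have "((\<lambda>t. fn ?f (symm (?c t))) has_derivative
      (\<lambda>t. \<Sum>I\<in>UNIV. (of_real t *s coords L) $ I * fn (pd I ?f) (symm (coords Z)))) (at 0)"
    by (rule has_derivative_compose) (use holomorphic_has_derivative[OF hol z] c0 in simp)
  moreover have "(\<lambda>t. fn ?f (symm (?c t))) = (\<lambda>t. fn ?f Z)"
    using ray_constant[OF Z ja, folded l_def, folded L_def] by (simp add: symm_coords_siegel)
  ultimately have "((\<lambda>t::real. fn ?f Z) has_derivative
      (\<lambda>t. \<Sum>I\<in>UNIV. (of_real t *s coords L) $ I * fn (pd I ?f) (symm (coords Z)))) (at 0)"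
    by simp
  from has_derivative_unique[OF this has_derivative_const]
  have "(\<Sum>I\<in>UNIV. (of_real 1 *s coords L) $ I * fn (pd I ?f) (symm (coords Z))) = 0"
    by (rule fun_cong)
  then have 0: "(\<Sum>I\<in>UNIV. coords L $ I * fn (pd I ?f) Z) = 0"
    by (simp add: symm_coords_siegel[OF Z])
  \<comment> \<open>Multiplication by \<open>y ^ 2\<close> clears the denominators of
    \<open>l\<close> and leaves a polynomial in the imaginary parts.\<close>
  define y where "y = Im (Z $ a $ a)"
  have y: "y \<noteq> 0" using siegel_diag_pos[OF Z, of a] by (simp add: y_def)
  have eq: "fn (pd I ?f) Z * of_real (Im (Z $ fst (Rep_idx I) $ a) * Im (Z $ snd (Rep_idx I) $ a)) =
      of_real (y ^ 2) * (coords L $ I * fn (pd I ?f) Z)" for I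
  proof -
    have "Im (Z $ i $ a) = y * l $ i" for i using y by (simp add: l_def y_def)
    then show ?thesis
      by (simp add: L_def coords_def cmat_def outer_def power2_eq_square mult_ac)
  qed
  show ?thesis unfolding eq sum_distrib_left[symmetric] 0 by simp
qed

text \<open>\<open>diagonal_pd_zero\<close> is a quadratic form in imaginary parts with holomorphic
  coefficients. Two applications of \<open>imaginary_derivative\<close> replace the imaginary parts
  by arbitrary real vectors \<open>A\<close> and \<open>B\<close>, and unit vectors isolate each
  partial derivative.\<close>

lemma diagonal_constant:
  assumes ja: "j \<noteq> a"
  shows "\<exists>c. \<forall>Z\<in>siegel. fn (H $ j $ j) Z = c"
proof -
  let ?E = "\<lambda>I. pd I (H $ j $ j)"
  let ?p = "\<lambda>I. idx (fst (Rep_idx I)) a" and ?q = "\<lambda>I. idx (snd (Rep_idx I)) a"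
  have hE: "siegel_holomorphic (?E I)" for I by (rule siegel_holomorphic_pd[OF hol])
  have s0: "(\<Sum>I\<in>UNIV. fn (?E I) (symm z) * of_real (Im (z $ ?p I) * Im (z $ ?q I))) = 0"
    if "z \<in> siegel_chart" for z
    using diagonal_pd_zero[OF ja symm_chart[OF that]] by (simp add: symm_nth)
  have s1: "(\<Sum>I\<in>UNIV. fn (?E I) (symm z) * of_real (A $ ?p I * Im (z $ ?q I) + Im (z $ ?p I) * A $ ?q I)) = 0"
    if z: "z \<in> siegel_chart" for z and A :: "(real, 'n idx) vec"
  proof -
    have d: "((\<lambda>z. complex_of_real (Im (z $ ?p I) * Im (z $ ?q I))) has_derivative
        (\<lambda>v. of_real (Im (z $ ?p I) * Im (v $ ?q I) + Im (v $ ?p I) * Im (z $ ?q I)))) (at z)" for I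
      by (intro has_derivative_of_real has_derivative_mult bounded_linear.has_derivative[OF bounded_linear_Im]
          bounded_linear_imp_has_derivative[OF bounded_linear_vec_nth])
    show ?thesis
      using imaginary_derivative[of ?E, OF hE d s0 _ z, of A] by (simp add: cvec_def add.commute)
  qed
  have s2: "(\<Sum>I\<in>UNIV. fn (?E I) (symm z) * of_real (A $ ?p I * B $ ?q I + B $ ?p I * A $ ?q I)) = 0"
    if z: "z \<in> siegel_chart" for z and A B :: "(real, 'n idx) vec"
  proof -
    have d: "((\<lambda>z. complex_of_real (A $ ?p I * Im (z $ ?q I) + Im (z $ ?p I) * A $ ?q I)) has_derivative
        (\<lambda>v. of_real (A $ ?p I * Im (v $ ?q I) + Im (v $ ?p I) * A $ ?q I))) (at z)" for I
      by (intro has_derivative_of_real has_derivative_add has_derivative_mult_left has_derivative_mult_right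
          bounded_linear.has_derivative[OF bounded_linear_Im]
          bounded_linear_imp_has_derivative[OF bounded_linear_vec_nth])
    show ?thesis
      using imaginary_derivative[of ?E, OF hE d s1 _ z, of B] by (simp add: cvec_def)
  qed
  have pd0: "fn (?E J) (symm z) = 0" if z: "z \<in> siegel_chart" for z J
  proof -
    define r s where "r = fst (Rep_idx J)" and "s = snd (Rep_idx J)"
    have J: "J = idx r s" by (simp add: r_def s_def idx_Rep)
    \<comment> \<open>\<open>A\<close> and \<open>B\<close> are the unit vectors at
      \<open>(r, a)\<close> and \<open>(s, a)\<close>; only the index \<open>(r, s)\<close> pairs
      with both.\<close>
    define c :: "'n idx \<Rightarrow> real" where "c = (\<lambda>I. axis (idx r a) 1 $ ?p I * axis (idx s a) 1 $ ?q I
        + axis (idx s a) 1 $ ?p I * axis (idx r a) 1 $ ?q I)"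
    have ax: "axis (idx x a) 1 $ idx y a = (if y = x then 1 else (0::real))" for x y
      by (auto simp: axis_def idx_eq_iff)
    have c0: "c I = 0" if "I \<noteq> J" for I
    proof -
      have "I = idx (fst (Rep_idx I)) (snd (Rep_idx I))" by (rule idx_Rep[symmetric])
      with that have "idx (fst (Rep_idx I)) (snd (Rep_idx I)) \<noteq> idx r s" by (simp add: J)
      then show ?thesis unfolding c_def ax by (auto simp: idx_eq_iff)
    qed
    have cJ: "c J \<noteq> 0" unfolding c_def ax by (auto simp: r_def[symmetric] s_def[symmetric])
    have "(\<Sum>I\<in>UNIV. fn (?E I) (symm z) * of_real (c I)) = 0"
      unfolding c_def by (rule s2[OF z])
    moreover have "(\<Sum>I\<in>UNIV. fn (?E I) (symm z) * of_real (c I)) = fn (?E J) (symm z) * of_real (c J)"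
      by (subst sum.remove[of _ J]) (auto intro!: sum.neutral simp: c0)
    ultimately show ?thesis using cJ by simp
  qed
  have "\<exists>c. \<forall>z\<in>siegel_chart. fn (H $ j $ j) (symm z) = c"
  proof (rule has_derivative_zero_constant[OF convex_siegel_chart])
    fix z :: "complex ^ 'n idx" assume z: "z \<in> siegel_chart"
    show "((\<lambda>z. fn (H $ j $ j) (symm z)) has_derivative (\<lambda>_. 0)) (at z within siegel_chart)"
      using holomorphic_has_derivative[OF hol z, of j j]
      by (simp add: pd0[OF z] has_derivative_at_withinI)
  qed
  then obtain c where c: "\<And>z. z \<in> siegel_chart \<Longrightarrow> fn (H $ j $ j) (symm z) = c" by blast
  have "fn (H $ j $ j) Z = c" if "Z \<in> siegel" for Z
    using c[OF coords_chart[OF that]] symm_coords_siegel[OF that] by simp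
  then show ?thesis by blast
qed

lemma vanishes_higher_degree:
  assumes card: "CARD('n) \<noteq> 1" and Z: "Z \<in> siegel"
  shows "fn (H $ j $ k) Z = 0"
proof -
  have other: "\<exists>a. a \<noteq> j" for j :: 'n
  proof (rule ccontr)
    assume "\<nexists>a. a \<noteq> j"
    then have "UNIV = {j}" by auto
    then have "CARD('n) = card {j}" by (rule arg_cong)
    then show False using card by simp
  qed
  define c where "c = (\<lambda>j. fn (H $ j $ j) (mat \<i>))"
  have c: "fn (H $ j $ j) Z = c j" if "Z \<in> siegel" for j Z
  proof -
    obtain a where "a \<noteq> j" using other[of j] by blast
    then have "j \<noteq> a" by simp
    then obtain d where d: "\<forall>Z\<in>siegel. fn (H $ j $ j) Z = d" using diagonal_constant by blast
    have "fn (H $ j $ j) Z = d" "c j = d" unfolding c_def using d that siegel_nonempty by blast+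
    then show ?thesis by simp
  qed
  \<comment> \<open>The entry \<open>(j, j)\<close> is compared under the unimodular matrix with the
    extra entry \<open>s\<close> at \<open>(k, j)\<close>; constancy of the diagonal leaves this
    relation. The two signs together give \<open>c k = 0\<close>, and then the off-diagonal entry
    vanishes.\<close>
  have rel: "s * (2 * fn (H $ j $ k) Z) + c k = 0" if jk: "j \<noteq> k" and s: "s = 1 \<or> s = -1" and Z: "Z \<in> siegel"
    for j k s Z
  proof -
    define n :: int where "n = (if s = 1 then 1 else - 1)"
    let ?V = "shear (axis k 1) (n *s axis j 1)" and ?U = "shear (axis k 1) (- (n *s axis j 1))"
    have UV: "?U ** ?V = mat 1" "?V ** ?U = mat 1"
      by (subst shear_mult; use jk in \<open>simp add: axis_def if_distrib[of "\<lambda>x. x * _"] if_distrib[of "(*) _"] sum_negf cong: if_cong\<close>)+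
    have W: "imatrix ?U ** Z ** transpose (imatrix ?U) \<in> siegel" by (rule unimodular(2)[OF Z UV])
    have Hs: "H $ k $ j = H $ j $ k"
      using arg_cong[OF sym, of "\<lambda>M. M $ j $ k"] by (simp add: transpose_def)
    have sn: "of_int n = s" using s by (auto simp: n_def)
    have Vij: "imatrix ?V $ i $ j = (if i = j then 1 else 0) + (if i = k then s else 0)" for i
      by (simp add: imatrix_def shear_def outer_def mat_def axis_def sn)
    have "c j = mat_at H (imatrix ?U ** Z ** transpose (imatrix ?U)) $ j $ j"
      using c[OF W] by (simp add: mat_at_def)
    also have "\<dots> = (\<Sum>x\<in>UNIV. (\<Sum>y\<in>UNIV. imatrix ?V $ y $ j * mat_at H Z $ y $ x) * imatrix ?V $ x $ j)"
      unfolding unimodular(1)[OF Z UV] by (simp add: matrix_matrix_mult_def transpose_def)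
    also have "\<dots> = fn (H $ j $ j) Z + s * (2 * fn (H $ j $ k) Z) + s * s * fn (H $ k $ k) Z"
      unfolding Vij by (simp add: mat_at_def Hs algebra_simps sum.distrib if_distrib[of "\<lambda>x. x * _"]
          if_distrib[of "(*) _"] cong: if_cong)
    finally show ?thesis using c[OF Z] s by auto
  qed
  have ck: "c k = 0" for k
  proof -
    obtain j where "j \<noteq> k" using other by blast
    from rel[OF this _ Z, of 1] rel[OF this _ Z, of "-1"] show ?thesis by simp
  qed
  show ?thesis
  proof (cases "j = k")
    case True
    then show ?thesis using c[OF Z] ck by simp
  next
    case False
    from rel[OF this _ Z, of 1] ck show ?thesis by simp
  qed
qed

end

text \<open>In degree one the only vector with \<open>v $ a = 0\<close> is 0, so
  \<open>W = 0\<close> qualifies and the half space is a single leaf; the lemmas on leaves thus also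
  provide the classical one-variable function.\<close>

lemma degree_one_leaf:
  fixes Z :: "(complex, 'n::{finite,linorder}) sqmat"
  assumes "UNIV = {a :: 'n}"
  shows "pd_off a (0 :: (complex, 'n) sqmat)" "Z = leaf a (Z $ a $ a) 0 0 0"
proof -
  have a: "i = a" for i using assms by auto
  show "pd_off a (0 :: (complex, 'n) sqmat)"
    unfolding pd_off_def
  proof (intro conjI allI impI)
    fix v :: "(real, 'n) vec" assume v: "v $ a = 0" "v \<noteq> 0"
    have "v $ i = 0" for i using a[of i] v(1) by simp
    with v(2) show "0 < v \<bullet> (imat 0 *v v)" by (simp add: vec_eq_iff)
  qed (simp_all add: transpose_zero)
  show "Z = leaf a (Z $ a $ a) 0 0 0"
    unfolding vec_eq_iff
  proof (intro allI)
    fix i k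
    show "Z $ i $ k = leaf a (Z $ a $ a) 0 0 0 $ i $ k"
      using a[of i] a[of k] by (simp add: leaf_nth)
  qed
qed

context sym2_form
begin

text \<open>On the leaf, \<open>C Z + D\<close> is \<open>\<tau>\<close> for the inversion, so the
  law becomes that of weight two.\<close>

lemma vanishes_degree_one:
  assumes univ: "UNIV = {a :: 'n}"
    and bd: "\<And>Z. Z \<in> siegel \<Longrightarrow> 1 \<le> Im (Z $ a $ a) \<Longrightarrow> cmod (fn (H $ a $ a) Z) \<le> B"
    and Z: "Z \<in> siegel"
  shows "fn (H $ a $ a) Z = 0"
proof -
  note W = degree_one_leaf(1)[OF univ]
  let ?h = "\<lambda>\<tau>. fn (H $ a $ a) (leaf a \<tau> 0 0 0)"
  have s: "leaf a \<tau> 0 0 0 \<in> siegel" if "0 < Im \<tau>" for \<tau>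
    by (rule leaf_siegel[OF W that]) simp
  have aa: "leaf a \<tau> 0 0 0 $ a $ a = \<tau>" for \<tau> by (simp add: leaf_nth)
  have ia: "i = a" for i using univ by auto
  have "?h (Z $ a $ a) = 0"
  proof (rule weight_two_zero[of ?h B "Z $ a $ a"])
    show "?h holomorphic_on uhp" by (rule leaf_holomorphic[OF W]) simp
    show "?h (z + 1) = ?h z" if "0 < Im z" for z
    proof -
      have "0 + cmat (outer 0 0) = (0 :: (complex, 'n) sqmat)"
        by (simp add: cmat_def outer_def vec_eq_iff)
      then show ?thesis using leaf_T[OF W that, of 0 a a 0] by simp
    qed
    show "?h (- 1 / z) = z\<^sup>2 * ?h z" if z: "0 < Im z" for z
    proof -
      have "mat_at H (leaf a (- 1 / z) 0 0 0) = inversion_cocycle a (leaf a z 0 0 0) **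
          mat_at H (leaf a z 0 0 0) ** transpose (inversion_cocycle a (leaf a z 0 0 0))"
        by (rule inversion[OF s[OF z]]) (use z in \<open>auto simp: ia leaf_nth\<close>)
      from arg_cong[OF this, of "\<lambda>M. M $ a $ a"]
      have "?h (- 1 / z) = z * ?h z * z"
        by (simp add: matrix_matrix_mult_def transpose_def univ inversion_cocycle_def aa mat_at_def
            del: divide_minus_left)
      then show ?thesis by (simp add: power2_eq_square mult_ac)
    qed
    show "cmod (?h z) \<le> B" if "1 \<le> Im z" for z
      using bd[OF s] that by (simp add: aa)
    show "0 < Im (Z $ a $ a)" by (rule siegel_diag_pos[OF Z])
  qed
  with arg_cong[OF degree_one_leaf(2)[OF univ], of "fn (H $ a $ a)" Z] show ?thesis by (rule trans)
qed

lemma vanishes: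
  assumes "\<And>i j. cusp_condition (H $ i $ j)"
  shows "H = 0"
proof -
  have "fn (H $ i $ j) Z = 0" if Z: "Z \<in> siegel" for i j Z
  proof (cases "CARD('n) = 1")
    case True
    then obtain a :: 'n where a: "UNIV = {a}" by (rule card_1_singletonE)
    have ia: "i = a" for i using a by auto
    obtain B where B: "\<forall>Z\<in>siegel. (\<forall>i. 1 \<le> Im (Z $ i $ i)) \<longrightarrow> cmod (fn (H $ a $ a) Z) \<le> B"
      using assms True unfolding cusp_condition_def by blast
    have bd: "cmod (fn (H $ a $ a) Z) \<le> B" if "Z \<in> siegel" "1 \<le> Im (Z $ a $ a)" for Z
    proof -
      have "1 \<le> Im (Z $ i $ i)" for i using that(2) ia[of i] by simp
      then show ?thesis using B that(1) by blast
    qed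
    show ?thesis
      using vanishes_degree_one[OF a bd Z] ia[of i] ia[of j] by simp
  next
    case False
    then show ?thesis by (rule vanishes_higher_degree[OF _ Z])
  qed
  then show ?thesis by (simp add: vec_eq_iff fn_eqI fn_simps)
qed

end

text \<open>The inhomogeneous term \<open>2 C^t\<close> is common to both solutions and
  cancels.\<close>

lemma sym2_form_diff:
  fixes G1 G2 :: "('n::{finite,linorder} cinf, 'n) sqmat"
  assumes "transpose G1 = G1" "G_transforms G1" "\<And>i j. siegel_holomorphic (G1 $ i $ j)"
    and "transpose G2 = G2" "G_transforms G2" "\<And>i j. siegel_holomorphic (G2 $ i $ j)"
  shows "sym2_form (G1 - G2)"
proof
  show "transpose (G1 - G2) = G1 - G2"
    using assms(1,4) by (simp add: transpose_def vec_eq_iff)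
  show "siegel_holomorphic ((G1 - G2) $ i $ j)" for i j
    using assms by (simp add: siegel_holomorphic_diff)
  fix \<gamma> :: "(int, 'n + 'n) sqmat" and Z :: "(complex, 'n) sqmat"
  assume \<gamma>: "\<gamma> \<in> Sp" and Z: "Z \<in> siegel"
  let ?J = "cocycle \<gamma> Z"
  have d: "mat_at (G1 - G2) Z = mat_at G1 Z - mat_at G2 Z" for Z
    by (simp add: mat_at_def fn_simps vec_eq_iff)
  have "matrix_inv ?J ** mat_at (G1 - G2) (act \<gamma> Z) = mat_at (G1 - G2) Z ** transpose ?J"
    using assms(2,5) \<gamma> Z by (simp add: d mat_ring G_transforms_def)
  then have "?J ** (matrix_inv ?J ** mat_at (G1 - G2) (act \<gamma> Z)) = ?J ** (mat_at (G1 - G2) Z ** transpose ?J)"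
    by (rule arg_cong)
  then show "mat_at (G1 - G2) (act \<gamma> Z) = ?J ** mat_at (G1 - G2) Z ** transpose ?J"
    by (simp add: matrix_mul_assoc matrix_inv_mult[OF invertible_cocycle[OF \<gamma> Z]])
qed

section \<open>The cusp condition\<close>

text \<open>Cauchy's estimate on discs of radius 1/2: around points of height at least 1 they stay
  above height 1/2, and between 1/2 and 1 periodicity supplies the bound.\<close>

lemma periodic_bounded_deriv:
  assumes hol: "F holomorphic_on uhp" and T: "\<And>z. 0 < Im z \<Longrightarrow> F (z + 1) = F z"
    and bd: "\<And>z. 1 \<le> Im z \<Longrightarrow> cmod (F z) \<le> B"
  shows "\<exists>C. \<forall>z. 1 \<le> Im z \<longrightarrow> cmod (deriv F z) \<le> C"
proof -
  obtain M where M: "\<And>z. 1/2 \<le> Im z \<Longrightarrow> Im z \<le> 1 \<Longrightarrow> cmod (F z) \<le> M"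
    using periodic_bounded_strip[OF holomorphic_on_imp_continuous_on[OF hol] T] by blast
  have half: "cmod (F z) \<le> max B M" if z: "1/2 \<le> Im z" for z
    using bd[of z] M[of z] z by (cases "1 \<le> Im z") auto
  have "cmod (deriv F z) \<le> fact 1 * max B M / (1/2) ^ 1" if z: "1 \<le> Im z" for z
  proof -
    have Im: "1/2 \<le> Im w" if "dist z w \<le> 1/2" for w
      using abs_Im_le_cmod[of "z - w"] that z by (simp add: dist_norm)
    have sub: "cball z (1/2) \<subseteq> uhp"
    proof
      fix w assume "w \<in> cball z (1/2)"
      then show "w \<in> uhp" using Im[of w] by simp
    qed
    have "cmod ((deriv ^^ 1) F z) \<le> fact 1 * max B M / (1/2) ^ 1"
    proof (rule Cauchy_inequality)
      show "F holomorphic_on ball z (1/2)"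
        by (rule holomorphic_on_subset[OF hol]) (use sub ball_subset_cball in blast)
      show "continuous_on (cball z (1/2)) F"
        by (rule continuous_on_subset[OF holomorphic_on_imp_continuous_on[OF hol] sub])
      show "cmod (F w) \<le> max B M" if "cmod (z - w) = 1/2" for w
        by (rule half, rule Im) (use that in \<open>simp add: dist_norm\<close>)
    qed simp
    then show ?thesis by simp
  qed
  then show ?thesis by blast
qed

lemma smooth_modular_form_translate:
  fixes f :: "('n::{finite,linorder}) cinf"
  assumes f: "f \<in> smooth_modular_forms w" and Z: "Z \<in> siegel" and S: "transpose S = S"
  shows "fn f (Z + imatrix S) = fn f Z"
proof -
  have "fn f (act (block (mat 1) S 0 (mat 1)) Z) = det (cocycle (block (mat 1) S 0 (mat 1)) Z) ^ w * fn f Z"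
    using f Z translation_in_Sp(1)[OF Z S] by (simp add: smooth_modular_forms_def)
  then show ?thesis by (simp add: translation_in_Sp(2,3)[OF Z S])
qed

text \<open>In degree one the determinant is \<open>f' - k G f\<close>, and \<open>f'\<close> is
  bounded near the cusp by Cauchy's estimate for the periodic function \<open>f\<close>.\<close>

lemma cusp_condition_det_nabla:
  fixes G :: "('n::{finite,linorder} cinf, 'n) sqmat"
  assumes G: "\<And>i j. cusp_condition (G $ i $ j)"
    and f: "f \<in> smooth_modular_forms w" "siegel_holomorphic f" "cusp_condition f"
  shows "cusp_condition (det (nabla k G f))"
  unfolding cusp_condition_def
proof
  assume card: "CARD('n) = 1"
  then obtain a :: 'n where a: "UNIV = {a}" by (rule card_1_singletonE)
  have ia: "i = a" for i using a by auto
  note W = degree_one_leaf(1)[OF a]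
  let ?I = "idx a a"
  define L where "L = (\<lambda>\<tau>. leaf a \<tau> 0 0 0)"
  have s: "L \<tau> \<in> siegel" if "0 < Im \<tau>" for \<tau>
    unfolding L_def by (rule leaf_siegel[OF W that]) simp
  have ZL: "Z = L (Z $ a $ a)" for Z unfolding L_def by (rule degree_one_leaf(2)[OF a])
  have Lii: "L \<tau> $ i $ i = \<tau>" for \<tau> i using ia[of i] by (simp add: L_def leaf_nth)
  let ?F = "\<lambda>\<tau>. fn f (L \<tau>)"
  obtain Bf where Bf: "\<And>Z. Z \<in> siegel \<Longrightarrow> (\<forall>i. 1 \<le> Im (Z $ i $ i)) \<Longrightarrow> cmod (fn f Z) \<le> Bf"
    using f(3) card unfolding cusp_condition_def by blast
  obtain BG where BG: "\<And>Z. Z \<in> siegel \<Longrightarrow> (\<forall>i. 1 \<le> Im (Z $ i $ i)) \<Longrightarrow> cmod (fn (G $ a $ a) Z) \<le> BG"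
    using G card unfolding cusp_condition_def by blast
  have L_affine: "L \<tau> = cmat 0 + mscale \<tau> (cmat (outer (axis a 1) (axis a 1)))" for \<tau>
    by (simp add: L_def leaf_def vec_eq_iff cmat_def mscale_def outer_def)
  have hol: "?F holomorphic_on uhp"
    unfolding L_affine
    by (rule affine_holomorphic[OF f(2) open_uhp]) (use s L_affine in simp)
  have T: "?F (z + 1) = ?F z" if z: "0 < Im z" for z
  proof -
    have "L (z + 1) = L z + imatrix (outer (axis a 1) (axis a 1))"
      by (simp add: L_affine vec_eq_iff cmat_def mscale_def outer_def imatrix_def axis_def algebra_simps)
    then show ?thesis
      using smooth_modular_form_translate[OF f(1) s[OF z] transpose_outer] by simp
  qed
  have bF: "cmod (?F z) \<le> Bf" if "1 \<le> Im z" for z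
    by (rule Bf) (use that s Lii in auto)
  obtain C where C: "\<And>z. 1 \<le> Im z \<Longrightarrow> cmod (deriv ?F z) \<le> C"
    using periodic_bounded_deriv[OF hol T bF] by blast
  have dF: "deriv ?F \<tau> = fn (pd ?I f) (L \<tau>)" if \<tau>: "0 < Im \<tau>" for \<tau>
  proof -
    have I: "I = ?I" for I
      using idx_Rep[of I] ia[of "fst (Rep_idx I)"] ia[of "snd (Rep_idx I)"] by simp
    then have UI: "(UNIV :: 'n idx set) = {?I}" by blast
    let ?c = "\<lambda>\<tau>. coords (L \<tau>)"
    have "(?c has_derivative (\<lambda>t. t *s axis ?I 1)) (at \<tau>)"
      unfolding has_derivative_vec_iff
    proof
      fix I
      have "?c \<tau> $ I = \<tau>" for \<tau>
        by (simp add: coords_def ia[of "fst (Rep_idx I)"] ia[of "snd (Rep_idx I)"] Lii)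
      then show "((\<lambda>\<tau>. ?c \<tau> $ I) has_derivative (\<lambda>h. (h *s axis ?I 1) $ I)) (at \<tau>)"
        using I[of I] by simp
    qed
    from has_derivative_compose[OF this holomorphic_has_derivative[OF f(2) coords_chart[OF s[OF \<tau>]]]]
    have "((\<lambda>\<tau>. fn f (symm (?c \<tau>))) has_derivative (\<lambda>t. t * fn (pd ?I f) (L \<tau>))) (at \<tau>)"
      by (simp add: UI symm_coords_siegel[OF s[OF \<tau>]])
    then have "((\<lambda>\<tau>. fn f (symm (?c \<tau>))) has_field_derivative fn (pd ?I f) (L \<tau>)) (at \<tau>)"
      by (simp add: has_field_derivative_def mult.commute[of _ "fn _ _"])
    then have "(?F has_field_derivative fn (pd ?I f) (L \<tau>)) (at \<tau>)"
      by (rule has_field_derivative_transform_within_open[OF _ open_uhp])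
        (use \<tau> s in \<open>auto simp: symm_coords_siegel\<close>)
    then show ?thesis by (rule DERIV_imp_deriv)
  qed
  have "cmod (fn (det (nabla k G f)) Z) \<le> C + real k * BG * Bf"
    if Z: "Z \<in> siegel" "\<forall>i. 1 \<le> Im (Z $ i $ i)" for Z
  proof -
    have Im: "1 \<le> Im (Z $ a $ a)" using Z(2) by blast
    have det: "det M = M $ a $ a" for M :: "('n cinf, 'n) sqmat"
    proof -
      have "M $ i $ j = 0" if "i \<noteq> j" for i j using that ia by metis
      then have "det M = (\<Prod>i\<in>UNIV. M $ i $ i)" by (rule det_diagonal)
      then show ?thesis by (simp add: a)
    qed
    have "fn (det (nabla k G f)) Z = fn (pd ?I f) Z - of_nat k * fn (G $ a $ a) Z * fn f Z"
      unfolding det by (simp add: nabla_def ddZ_def fn_simps fn_consts[OF Z(1)])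
    then have "cmod (fn (det (nabla k G f)) Z) \<le> cmod (fn (pd ?I f) Z) + cmod (of_nat k * fn (G $ a $ a) Z * fn f Z)"
      using norm_triangle_ineq4 by simp
    moreover have "cmod (fn (pd ?I f) Z) \<le> C"
      using C[OF Im] dF[of "Z $ a $ a"] Im arg_cong[OF ZL, of "fn (pd ?I f)" Z] by simp
    moreover have "cmod (of_nat k * fn (G $ a $ a) Z * fn f Z) \<le> real k * BG * Bf"
    proof -
      have "0 \<le> BG" by (rule order.trans[OF norm_ge_zero BG[OF Z]])
      then show ?thesis
        unfolding norm_mult by (intro mult_mono BG[OF Z] Bf[OF Z]) auto
    qed
    ultimately show ?thesis by linarith
  qed
  then show "\<exists>B. \<forall>Z\<in>siegel. (\<forall>i. 1 \<le> Im (Z $ i $ i)) \<longrightarrow> cmod (fn (det (nabla k G f)) Z) \<le> B"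
    by blast
qed

lemma cusp_condition_diff:
  assumes "cusp_condition f" "cusp_condition (g :: ('n::{finite,linorder}) cinf)"
  shows "cusp_condition (f - g)"
  unfolding cusp_condition_def
proof
  assume card: "CARD('n) = 1"
  obtain B where B: "\<And>Z. Z \<in> siegel \<Longrightarrow> (\<forall>i. 1 \<le> Im (Z $ i $ i)) \<Longrightarrow> cmod (fn f Z) \<le> B"
    using assms(1) card unfolding cusp_condition_def by blast
  obtain C where C: "\<And>Z. Z \<in> siegel \<Longrightarrow> (\<forall>i. 1 \<le> Im (Z $ i $ i)) \<Longrightarrow> cmod (fn g Z) \<le> C"
    using assms(2) card unfolding cusp_condition_def by blast
  have "cmod (fn (f - g) Z) \<le> B + C" if "Z \<in> siegel" "\<forall>i. 1 \<le> Im (Z $ i $ i)" for Z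
    using norm_triangle_ineq4[of "fn f Z" "fn g Z"] B[OF that] C[OF that] by (simp add: fn_simps)
  then show "\<exists>B. \<forall>Z\<in>siegel. (\<forall>i. 1 \<le> Im (Z $ i $ i)) \<longrightarrow> cmod (fn (f - g) Z) \<le> B"
    by blast
qed

text \<open>In degree one, \<open>(pi i / 3) E_2\<close> with the Eisenstein series of weight 2 is
  the holomorphic solution, and \<open>f \<mapsto> f' - k G f\<close> is a multiple of Serre's
  derivative. Holomorphy of the operator appears in two forms: for its values alone and, with the
  bound at the cusp, as a map into \<open>modular_forms\<close>.\<close>

theorem theorem2p9:
  fixes G :: "('n::{finite,linorder} cinf, 'n) sqmat"
  assumes G_sym: "transpose G = G"
    and G_trans: "G_transforms G"
  shows
    "(\<exists>!\<D>. modular_connection \<D> \<and>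
        (\<forall>r s. \<D> (dZ (idx r s)) =
           - (\<Sum>i\<in>UNIV. \<Sum>j\<in>UNIV. cf (G $ i $ j) * dZ (idx s i) * dZ (idx r j))) \<and>
        (\<forall>f k. \<D> (cf f * det dZmat ^ k) =
           trace ((\<chi> i j. cf (nabla k G f $ i $ j)) ** dZmat) * det dZmat ^ k))
     \<and> (\<forall>k. \<forall>f\<in>modular_forms (2 * k).
          det (nabla k G f) \<in> smooth_modular_forms (2 * k * CARD('n) + 2))
     \<and> (\<exists>\<^sub>\<le>\<^sub>1 G' :: ('n cinf, 'n) sqmat. transpose G' = G' \<and> G_transforms G' \<and>
          (\<forall>i j. siegel_holomorphic (G' $ i $ j) \<and> cusp_condition (G' $ i $ j)))
     \<and> ((\<forall>i j. siegel_holomorphic (G $ i $ j)) \<longrightarrow>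
          (\<forall>k. \<forall>f\<in>modular_forms (2 * k). siegel_holomorphic (det (nabla k G f))))
     \<and> ((\<forall>i j. siegel_holomorphic (G $ i $ j) \<and> cusp_condition (G $ i $ j)) \<longrightarrow>
          (\<forall>k. \<forall>f\<in>modular_forms (2 * k).
             det (nabla k G f) \<in> modular_forms (2 * k * CARD('n) + 2)))"
proof -
  have smooth: "det (nabla k G f) \<in> smooth_modular_forms (2 * k * CARD('n) + 2)"
    if "f \<in> modular_forms (2 * k)" for k f
    using det_nabla_modular[OF G_sym G_trans] that by (simp add: modular_forms_def)
  have holomorphic: "siegel_holomorphic (det (nabla k G f))"
    if "\<forall>i j. siegel_holomorphic (G $ i $ j)" "f \<in> modular_forms (2 * k)" for k f
    using det_nabla_holomorphic[of G f k] that by (simp add: modular_forms_def)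
  have modular: "det (nabla k G f) \<in> modular_forms (2 * k * CARD('n) + 2)"
    if G: "\<forall>i j. siegel_holomorphic (G $ i $ j) \<and> cusp_condition (G $ i $ j)"
      and f: "f \<in> modular_forms (2 * k)" for k f
  proof -
    have "cusp_condition (det (nabla k G f))"
      by (rule cusp_condition_det_nabla) (use G f in \<open>auto simp: modular_forms_def\<close>)
    then show ?thesis
      using smooth[OF f] holomorphic[OF _ f] G by (simp add: modular_forms_def)
  qed
  have unique: "\<exists>\<^sub>\<le>\<^sub>1 G' :: ('n cinf, 'n) sqmat. transpose G' = G' \<and> G_transforms G' \<and>
      (\<forall>i j. siegel_holomorphic (G' $ i $ j) \<and> cusp_condition (G' $ i $ j))"
  proof (rule Uniq_I)
    fix G1 G2 :: "('n cinf, 'n) sqmat"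
    assume 1: "transpose G1 = G1 \<and> G_transforms G1 \<and>
        (\<forall>i j. siegel_holomorphic (G1 $ i $ j) \<and> cusp_condition (G1 $ i $ j))"
      and 2: "transpose G2 = G2 \<and> G_transforms G2 \<and>
        (\<forall>i j. siegel_holomorphic (G2 $ i $ j) \<and> cusp_condition (G2 $ i $ j))"
    interpret sym2_form "G1 - G2"
      by (rule sym2_form_diff) (use 1 2 in auto)
    have "G1 - G2 = 0"
      by (rule vanishes) (use 1 2 in \<open>simp add: cusp_condition_diff\<close>)
    then show "G1 = G2" by simp
  qed
  show ?thesis
    using connection_existence_uniqueness[OF G_sym G_trans] smooth unique holomorphic modular
    by blast
qed

end
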